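(* Let $m\ge 1$ be an integer and $\delta>-m$ a real number. Consider the preferential attachment model $(\mathrm{PA}_s)_{s\ge1}$ without self-loops with parameters $m,\delta$ and its degree counts $N_k(s,i)$, and let $p_k$ ($k\ge m$) be the limiting degree proportions, all as defined in the context. Then for each fixed $i\in\{0,1,\dots,m\}$, as $s\to\infty$, $$\Bigg(\sqrt{s}\Big(\frac{N_k(s,i)}{s}-p_k\Big),\ k=m,m+1,\dots\Bigg)\Rightarrow (Z_k,\ k=m,m+1,\dots),$$ where $(Z_k,\ k=m,m+1,\dots)$ is a mean zero Gaussian process whose covariance function $R_Z(r,l)$ is given, for $r,l\ge m$, by $$ \begin{aligned} R_Z(r,l)=\;&\frac{(-1)^{r+l}}{\Gamma(l+r+1+2(\delta+1)+\delta/m)}\sum_{q=m}^{\infty}(q+\delta)p_q\Big(\frac{b_m^{(l)}b_m^{(r)}}{m}\,\Gamma(2(m+\delta+1)+\delta/m)\,(l+r-2m)!\\ &+\frac{(-1)^{m+q+1}}{m}\big(b_m^{(l)}b_q^{(r)}+b_m^{(r)}b_q^{(l)}\big)\Gamma(m+q+2(\delta+1)+\delta/m)\,(l+r-q-m)!\\ &+\frac{(-1)^{m+q+1}}{m}\big(b_m^{(l)}b_{q+1}^{(r)}+b_m^{(r)}b_{q+1}^{(l)}\big)\Gamma(m+q+1+2(\delta+1)+\delta/m)\,(l+r-m-q-1)!\\ &+b_q^{(l)}b_q^{(r)}\,\Gamma(2q+2(\delta+1)+\delta/m)\,(l+r-2q)!\\ &+\big(b_q^{(l)}b_{q+1}^{(r)}+b_q^{(r)}b_{q+1}^{(l)}\big)\Gamma(2q+1+2(\delta+1)+\delta/m)\,(l+r-2q-1)!\\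 &+b_{q+1}^{(l)}b_{q+1}^{(r)}\,\Gamma(2(q+\delta+2)+\delta/m)\,(l+r-2q-2)!\Big)\\ &-\frac{(2m+\delta)\Gamma(l+\delta)\Gamma(r+\delta)}{(\Gamma(m+\delta))^2}\sum_{t_1=m}^{l}\sum_{t_2=m}^{r}(-1)^{t_1+t_2}\\ &\qquad\times\frac{[m(t_1+t_2)+2m(\delta+1)+\delta]^{-1}(t_1+2+\delta-t_1/m)(t_2+2+\delta-t_2/m)}{(t_1-m)!\,(t_2-m)!\,(l-t_1)!\,(r-t_2)!\,(t_1+2+\delta+\delta/m)(t_2+2+\delta+\delta/m)}\\ &-\frac{(2m+\delta)(m-1)\Gamma(l+\delta)\Gamma(r+\delta)}{m^2(\Gamma(m+\delta))^2}\sum_{t_1=m}^{l}\sum_{t_2=m}^{r}(-1)^{t_1+t_2}\\ &\qquad\times\frac{(\delta+t_1)(\delta+t_2)[m(t_1+t_2)+2m(\delta+1)+\delta]^{-1}}{(t_1-m)!\,(t_2-m)!\,(l-t_1)!\,(r-t_2)!\,(t_1+2+\delta+\delta/m)(t_2+2+\delta+\delta/m)}, \end{aligned} $$ with coefficients $$b_j^{(k)}=\prod_{t=j}^{k-1}\frac{t+\delta}{t-k}=(-1)^{k-j}\frac{\Gamma(k+\delta)}{(k-j)!\,\Gamma(j+\delta)}\qquad (m\le j\le k).$$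
   Context: **Model.** Fix an integer $m\ge1$ and a real $\delta>-m$. The preferential attachment model is a growing sequence of random (multi)graphs $(\mathrm{PA}_s)_{s\ge1}$, where $\mathrm{PA}_s$ has vertex set $\{0,1,\dots,s\}$. $\mathrm{PA}_1$ consists of the vertices $0$ and $1$ joined by $m$ edges. For $s\ge2$, $\mathrm{PA}_s$ is obtained from $\mathrm{PA}_{s-1}$ by adding a new vertex $s$ together with $m$ edges, attached one after the other: set $\mathrm{PA}_{s,0}=\mathrm{PA}_{s-1}$, and for $i=1,\dots,m$ obtain $\mathrm{PA}_{s,i}$ from $\mathrm{PA}_{s,i-1}$ by drawing one edge from $s$ to a random vertex of $\{0,1,\dots,s-1\}$ (so there are no self-loops). Conditionally on the construction so far, a vertex $v\in\{0,\dots,s-1\}$ whose current degree (in $\mathrm{PA}_{s,i-1}$) is $d$ is chosen with probability proportional to $d+\delta$; degrees are updated after each edge. Finally $\mathrm{PA}_s=\mathrm{PA}_{s,m}$. **Degree counts.** For $s\ge2$ and $1\le i\le m-1$, $N_k(s,i)$ is the number of vertices of degree $k$ in $\mathrm{PA}_{s,i}$, excluding the vertex $s$; $N_k(s,m)$ is the number of vertices of degree $k$ in $\mathrm{PA}_{s}$ (now including the vertex $s$, which has degree $m$); and $N_k(s+1,0):=N_k(s,m)$. Thus $N_k(s,0)$ is the number of vertices of degree $k$ in $\mathrm{PA}_{s-1}$. Let $D_{s,i}$ be the degree in $\mathrm{PA}_{s,i-1}$ of the vertex to which the $i$-th edge of $s$ is attached, and $\mathcal F_{s,i}$ the $\sigma$-algebra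 generated by the construction up to and including the attachment of the $i$-th edge of vertex $s$. The attachment rule gives $$\mathbb P(D_{s,i}=k\mid\mathcal F_{s,i-1})=\frac{(k+\delta)N_k(s,i-1)}{\sum_j(j+\delta)N_j(s,i-1)},\qquad \sum_{j\ge1}(j+\delta)N_j(s,i-1)=s(2m+\delta)-2m+i-1 .$$ **Limiting proportions.** For $k\ge m$, $$p_k=(2+\delta/m)\frac{\Gamma(k+\delta)\,\Gamma(m+2+\delta+\delta/m)}{\Gamma(m+\delta)\,\Gamma(k+3+\delta+\delta/m)},$$ where $\Gamma$ is the Gamma function. **Conventions.** $b_k^{(k)}=1$ and $b_j^{(k)}=0$ for $j>k$; any term containing a vanishing product of $b$-coefficients is $0$ (even if the accompanying factorial has a negative argument), so only finitely many terms involving $b_q$ or $b_{q+1}$ are nonzero. **Convergence.** For random sequences, $(X^{(s)}_m,X^{(s)}_{m+1},\dots)\Rightarrow(X_m,X_{m+1},\dots)$ means that for every $k\ge m$ the finite vector $(X^{(s)}_m,\dots,X^{(s)}_k)$ converges in distribution to $(X_m,\dots,X_k)$ as $s\to\infty$. *)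

theory Defs
  imports "HOL-Probability.Probability"
begin

section \<open>The preferential attachment graphs\<close>

text \<open>
  \<open>V s i\<close> is the vertex to which the \<open>i\<close>-th edge of vertex \<open>s\<close> is attached (\<open>s \<ge> 2\<close>,
  \<open>1 \<le> i \<le> m\<close>).  A multigraph is given by the multiset of its edges, an edge between \<open>u\<close> and \<open>v\<close>
  with \<open>v < u\<close> being stored as the pair \<open>(u, v)\<close>; \<open>PA m V s i\<close> is the multigraph after \<open>i\<close> edges of
  vertex \<open>s\<close> have been drawn.  The value at \<open>s = 0\<close> is irrelevant, and at \<open>s = 1\<close> the index \<open>i\<close> is
  ignored.
\<close>

type_synonym multigraph = "(nat \<times> nat) multiset"

fun PA :: "nat \<Rightarrow> (nat \<Rightarrow> nat \<Rightarrow> nat) \<Rightarrow> nat \<Rightarrow> nat \<Rightarrow> multigraph" where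
  "PA m V 0 i = {#}"
| "PA m V (Suc 0) i = replicate_mset m (1, 0)"
| "PA m V (Suc (Suc s)) 0 = PA m V (Suc s) m"
| "PA m V (Suc (Suc s)) (Suc i) =
     add_mset (Suc (Suc s), V (Suc (Suc s)) (Suc i)) (PA m V (Suc (Suc s)) i)"

definition vertex_degree :: "multigraph \<Rightarrow> nat \<Rightarrow> nat" where
  "vertex_degree G v = size {#e \<in># G. fst e = v#} + size {#e \<in># G. snd e = v#}"

text \<open>
  The number of vertices of degree \<open>k\<close> in \<open>PA m V s i\<close>.  The vertex \<open>s\<close> counts only once all its
  \<open>m\<close> edges are drawn; in particular \<open>deg_count m V k s 0\<close> is the count in the graph on
  \<open>{0, \<dots>, s - 1}\<close>.
\<close>

definition deg_count :: "nat \<Rightarrow> (nat \<Rightarrow> nat \<Rightarrow> nat) \<Rightarrow> nat \<Rightarrow> nat \<Rightarrow> nat \<Rightarrow> nat" where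
  "deg_count m V k s i =
     card {v \<in> (if i = m then {..s} else {..<s}). vertex_degree (PA m V s i) v = k}"

section \<open>The random model\<close>

text \<open>The edges drawn (after the initial graph) up to and including the \<open>i\<close>-th edge of vertex \<open>s\<close>.\<close>

definition edges_upto :: "nat \<Rightarrow> nat \<Rightarrow> nat \<Rightarrow> (nat \<times> nat) set" where
  "edges_upto m s i = {2..<s} \<times> {1..m} \<union> {s} \<times> {1..i}"

definition history ::
  "'a measure \<Rightarrow> nat \<Rightarrow> (nat \<Rightarrow> nat \<Rightarrow> 'a \<Rightarrow> nat) \<Rightarrow> nat \<Rightarrow> nat \<Rightarrow> 'a measure" where
  "history M m V s i =
     sigma (space M) (\<Union>(t, j)\<in>edges_upto m s i. {V t j -` A \<inter> space M | A. True})"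

text \<open>
  Any realisation of the growing random graph: the only requirements are that the attachment
  targets are random variables with values in the set of older vertices, and that they obey the
  conditional attachment probabilities.
\<close>

locale preferential_attachment = prob_space M
  for M :: "'a measure" and m :: nat and \<delta> :: real and V :: "nat \<Rightarrow> nat \<Rightarrow> 'a \<Rightarrow> nat" +
  assumes target_measurable:
    "\<And>s i. 2 \<le> s \<Longrightarrow> i \<in> {1..m} \<Longrightarrow> V s i \<in> measurable M (count_space {..<s})"
  and attachment_rule:
    "\<And>s i v. 2 \<le> s \<Longrightarrow> i \<in> {1..m} \<Longrightarrow> v < s \<Longrightarrow>
       AE \<omega> in M.
         real_cond_exp M (history M m V s (i - 1)) (indicator {\<omega> \<in> space M. V s i \<omega> = v}) \<omega> =
           (let G = PA m (\<lambda>t j. V t j \<omega>) s (i - 1)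
            in (real (vertex_degree G v) + \<delta>) / (\<Sum>u<s. real (vertex_degree G u) + \<delta>))"

section \<open>Limiting proportions and the covariance function\<close>

definition p_lim :: "nat \<Rightarrow> real \<Rightarrow> nat \<Rightarrow> real" where
  "p_lim m \<delta> k =
     (2 + \<delta> / m) * (Gamma (k + \<delta>) * Gamma (m + 2 + \<delta> + \<delta> / m))
       / (Gamma (m + \<delta>) * Gamma (k + 3 + \<delta> + \<delta> / m))"

text \<open>\<open>b_coeff \<delta> j k\<close> is the coefficient with lower index \<open>j\<close> and upper index \<open>k\<close>.\<close>

definition b_coeff :: "real \<Rightarrow> nat \<Rightarrow> nat \<Rightarrow> real" where
  "b_coeff \<delta> j k = (if j \<le> k then \<Prod>t\<in>{j..<k}. (real t + \<delta>) / (real t - real k) else 0)"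

text \<open>
  The subtractions under the factorials are truncated, but only where the accompanying
  coefficient vanishes.
\<close>

definition R_Z :: "nat \<Rightarrow> real \<Rightarrow> nat \<Rightarrow> nat \<Rightarrow> real" where
  "R_Z m \<delta> r l =
    (let b = b_coeff \<delta> in
     (-1) ^ (r + l) / Gamma (l + r + 1 + 2 * (\<delta> + 1) + \<delta> / m) *
     (\<Sum>\<^sub>\<infinity>q\<in>{m..}. (q + \<delta>) * p_lim m \<delta> q *
       (b m l * b m r / m * Gamma (2 * (m + \<delta> + 1) + \<delta> / m) * fact (l + r - 2 * m)
        + (-1) ^ (m + q + 1) / m * (b m l * b q r + b m r * b q l)
            * Gamma (m + q + 2 * (\<delta> + 1) + \<delta> / m) * fact (l + r - q - m)
        + (-1) ^ (m + q + 1) / m * (b m l * b (q + 1) r + b m r * b (q + 1) l)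
            * Gamma (m + q + 1 + 2 * (\<delta> + 1) + \<delta> / m) * fact (l + r - m - q - 1)
        + b q l * b q r * Gamma (2 * q + 2 * (\<delta> + 1) + \<delta> / m) * fact (l + r - 2 * q)
        + (b q l * b (q + 1) r + b q r * b (q + 1) l)
            * Gamma (2 * q + 1 + 2 * (\<delta> + 1) + \<delta> / m) * fact (l + r - 2 * q - 1)
        + b (q + 1) l * b (q + 1) r
            * Gamma (2 * (q + \<delta> + 2) + \<delta> / m) * fact (l + r - 2 * q - 2)))
     - (2 * m + \<delta>) * Gamma (l + \<delta>) * Gamma (r + \<delta>) / (Gamma (m + \<delta>))\<^sup>2 *
       (\<Sum>t1=m..l. \<Sum>t2=m..r. (-1) ^ (t1 + t2) *
          (inverse (m * (t1 + t2) + 2 * m * (\<delta> + 1) + \<delta>)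
             * (t1 + 2 + \<delta> - t1 / m) * (t2 + 2 + \<delta> - t2 / m))
          / (fact (t1 - m) * fact (t2 - m) * fact (l - t1) * fact (r - t2)
             * (t1 + 2 + \<delta> + \<delta> / m) * (t2 + 2 + \<delta> + \<delta> / m)))
     - (2 * m + \<delta>) * (real m - 1) * Gamma (l + \<delta>) * Gamma (r + \<delta>)
         / ((real m)\<^sup>2 * (Gamma (m + \<delta>))\<^sup>2) *
       (\<Sum>t1=m..l. \<Sum>t2=m..r. (-1) ^ (t1 + t2) *
          ((\<delta> + t1) * (\<delta> + t2) * inverse (m * (t1 + t2) + 2 * m * (\<delta> + 1) + \<delta>))
          / (fact (t1 - m) * fact (t2 - m) * fact (l - t1) * fact (r - t2)
             * (t1 + 2 + \<delta> + \<delta> / m) * (t2 + 2 + \<delta> + \<delta> / m))))"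

section \<open>Gaussian processes and convergence in distribution\<close>

text \<open>Normal distributions of variance zero (point masses) are included.\<close>

definition normal_rv :: "'b measure \<Rightarrow> ('b \<Rightarrow> real) \<Rightarrow> bool" where
  "normal_rv N X \<longleftrightarrow> X \<in> borel_measurable N \<and>
     (\<exists>\<mu> \<sigma>. \<sigma> > 0 \<and> distributed N lborel X (normal_density \<mu> \<sigma>) \<or>
            \<sigma> = 0 \<and> (AE x in N. X x = \<mu>))"

definition gaussian_process :: "'b measure \<Rightarrow> 'i set \<Rightarrow> ('i \<Rightarrow> 'b \<Rightarrow> real) \<Rightarrow> bool" where
  "gaussian_process N I Z \<longleftrightarrow> prob_space N \<and>
     (\<forall>J a. finite J \<and> J \<subseteq> I \<longrightarrow> normal_rv N (\<lambda>x. \<Sum>j\<in>J. a j * Z j x))"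

definition cov :: "'b measure \<Rightarrow> ('b \<Rightarrow> real) \<Rightarrow> ('b \<Rightarrow> real) \<Rightarrow> real" where
  "cov N X Y =
     (\<integral>x. (X x - (\<integral>y. X y \<partial>N)) * (Y x - (\<integral>y. Y y \<partial>N)) \<partial>N)"

text \<open>
  Convergence in distribution of the random vectors with index set \<open>J\<close> (finite in the application),
  tested on bounded continuous functions.
\<close>

definition vector_conv_distr ::
  "'i set \<Rightarrow> 'a measure \<Rightarrow> (nat \<Rightarrow> 'i \<Rightarrow> 'a \<Rightarrow> real) \<Rightarrow> 'b measure \<Rightarrow> ('i \<Rightarrow> 'b \<Rightarrow> real) \<Rightarrow> bool"
  where
  "vector_conv_distr J M X N Y \<longleftrightarrow>
     (\<forall>f. continuous_map (product_topology (\<lambda>_. euclideanreal) J) euclideanreal f \<and>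
          bounded (f ` (\<Pi>\<^sub>E j\<in>J. UNIV)) \<longrightarrow>
        (\<lambda>s. \<integral>\<omega>. f (\<lambda>j\<in>J. X s j \<omega>) \<partial>M)
          \<longlonglongrightarrow> (\<integral>x. f (\<lambda>j\<in>J. Y j x) \<partial>N))"

definition sequence_conv_distr ::
  "nat \<Rightarrow> 'a measure \<Rightarrow> (nat \<Rightarrow> nat \<Rightarrow> 'a \<Rightarrow> real) \<Rightarrow> 'b measure \<Rightarrow> (nat \<Rightarrow> 'b \<Rightarrow> real) \<Rightarrow> bool"
  where
  "sequence_conv_distr m M X N Y \<longleftrightarrow> (\<forall>k\<ge>m. vector_conv_distr {m..k} M X N Y)"

end

theory Submission
  imports Defs
begin

text \<open>
  Number the attachment steps consecutively and let \<open>S\<^sub>n\<close> be the (deterministic) total weight at step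
  \<open>n\<close>.  The coefficients are eigenfunctions of the attachment rule,
  \<open>(d + \<delta>) (b\<^sub>d\<^sub>+\<^sub>1 - b\<^sub>d) = - (t + \<delta>) b\<^sub>d\<close> for \<open>b\<^sub>d = b\<^sub>d\<^sup>(\<^sup>t\<^sup>)\<close>, so the statistics
  \<open>U\<^sub>t = \<Sum>\<^sub>k b\<^sub>k\<^sup>(\<^sup>t\<^sup>) N\<^sub>k\<close> evolve independently of each other in the mean:
  \<open>U\<^sub>t(n + 1)\<close> has conditional mean \<open>\<lambda>\<^sub>t U\<^sub>t(n)\<close> plus a constant, \<open>\<lambda>\<^sub>t = 1 - (t + \<delta>) / S\<^sub>n\<close>.
  Recursions for the mean and the variance give a law of large numbers, hence the conditional
  covariances of the increments converge.  Therefore the characteristic function of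
  \<open>h \<Sum>\<^sub>t \<alpha>\<^sub>t (U\<^sub>t - E U\<^sub>t)\<close> at step \<open>n + 1\<close> is, up to a summable error, \<open>exp (- h\<^sup>2 q(\<alpha>) / 2)\<close> times the one at
  step \<open>n\<close> with coefficients \<open>\<lambda>\<^sub>t \<alpha>\<^sub>t\<close>.  Iterating this produces a Gaussian limit whose covariance solves
  a linear recursion; transforming back from \<open>U\<close> to \<open>N\<close> and evaluating the resulting
  alternating binomial sums as Beta functions gives \<open>R\<^sub>Z\<close>.

  \<open>R\<^sub>Z\<close> is positive semidefinite because characteristic functions are bounded by 1, so a Gaussian
  process with this covariance is obtained from independent normal variables by a Cholesky
  decomposition.
\<close>

section \<open>Linear recursions with slowly varying coefficients\<close>

text \<open>The scaling decides which precision is required where. With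
  \<open>h = 1 / sqrt s\<close> and about \<open>s m\<close> steps, one-step errors of order
  \<open>h^3\<close> and \<open>h^4\<close> have a vanishing total. The error in the conditional
  covariance carries only \<open>h^2\<close>, and \<open>s m h^2\<close> stays bounded; there a
  Cesaro mean of errors tending to 0 is enough, which is why a law of large numbers without a rate
  suffices. The centring is more delicate: the mean of \<open>U_t\<close> must be known up to
  \<open>o(sqrt n)\<close>, and its drift is periodic because a new vertex is counted only at every
  m-th step. A limit of \<open>mean_U t n / n\<close> is too coarse for this, hence the explicit
  sequence \<open>center\<close>. The coefficients of \<open>U_t\<close> vanish above degree t, so
  all increments are bounded and third order Taylor bounds hold uniformly. The multipliers
  \<open>lam t n\<close> eventually lie in [0, 1], so going back in time keeps the coefficients
  \<alpha> bounded and the iteration can run on the \<open>U_t\<close> directly. Finally,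
  \<open>R_Z\<close> is a deterministic expression, but its positive semidefiniteness is read off
  from the model at hand.\<close>

lemma div_n_tendsto_0:
  fixes y e :: "nat \<Rightarrow> real"
  assumes step: "\<forall>\<^sub>F n in sequentially. \<bar>y (Suc n)\<bar> \<le> \<bar>y n\<bar> + e n" and e: "e \<longlonglongrightarrow> 0"
  shows "(\<lambda>n. y n / real n) \<longlonglongrightarrow> 0"
proof (rule LIMSEQ_I)
  fix r :: real assume "r > 0"
  have "\<forall>\<^sub>F n in sequentially. e n < r / 2"
    using e \<open>r > 0\<close> by (intro order_tendstoD) auto
  with step have "\<forall>\<^sub>F n in sequentially. \<bar>y (Suc n)\<bar> \<le> \<bar>y n\<bar> + r / 2"
    by eventually_elim linarith
  then obtain n0 where n0: "\<And>n. n \<ge> n0 \<Longrightarrow> \<bar>y (Suc n)\<bar> \<le> \<bar>y n\<bar> + r / 2"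
    by (auto simp: eventually_sequentially)
  \<comment> \<open>Once the increments stay below \<open>r / 2\<close>, growth is linear with slope
    at most \<open>r / 2\<close>. After division by n only the start value \<open>y n0\<close>
    remains, which \<open>n1\<close> makes smaller than another \<open>r / 2\<close>.\<close>
  have bound: "\<bar>y n\<bar> \<le> \<bar>y n0\<bar> + r / 2 * real (n - n0)" if "n \<ge> n0" for n
    using that
  proof (induction n rule: dec_induct)
    case (step n)
    have "r / 2 * real (Suc n - n0) = r / 2 * real (n - n0) + r / 2"
      using step.hyps by (simp add: field_simps)
    then show ?case using n0[OF step.hyps(1)] step.IH by linarith
  qed simp
  define n1 where "n1 = Suc (n0 + nat \<lceil>2 * \<bar>y n0\<bar> / r\<rceil>)"
  have "norm (y n / real n - 0) < r" if "n \<ge> n1" for n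
  proof -
    have n: "n \<ge> n0" "n > 0" using that by (auto simp: n1_def)
    have "2 * \<bar>y n0\<bar> / r < real n1" unfolding n1_def by linarith
    also have "\<dots> \<le> real n" using that by simp
    finally have "\<bar>y n0\<bar> < r / 2 * real n" using \<open>r > 0\<close> by (simp add: field_simps)
    moreover have "r / 2 * real (n - n0) \<le> r / 2 * real n" using \<open>r > 0\<close> by (intro mult_left_mono) auto
    ultimately have "\<bar>y n\<bar> < r * real n" using bound[OF n(1)] by simp
    then show ?thesis using n(2) by (simp add: field_simps)
  qed
  then show "\<exists>no. \<forall>n\<ge>no. norm (y n / real n - 0) < r" by blast
qed

text \<open>The hypothesis means \<open>lam n = 1 - \<beta> / n + o(1 / n)\<close>: a positive limit
  gives \<open>lam n \<le> 1\<close>, and division by n gives \<open>1 - lam n -> 0\<close>, hence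
  \<open>0 \<le> lam n\<close>.\<close>

lemma eventually_contraction:
  fixes lam :: "nat \<Rightarrow> real"
  assumes lam: "(\<lambda>n. real n * (1 - lam n)) \<longlonglongrightarrow> \<beta>" and "\<beta> > 0"
  shows "\<forall>\<^sub>F n in sequentially. 0 \<le> lam n \<and> lam n \<le> 1"
proof -
  have "(\<lambda>n. real n * (1 - lam n) * inverse (real n)) \<longlonglongrightarrow> \<beta> * 0"
    by (intro tendsto_mult lam lim_inverse_n)
  then have "(\<lambda>n. real n * (1 - lam n) * inverse (real n)) \<longlonglongrightarrow> 0" by simp
  then have "\<forall>\<^sub>F n in sequentially. real n * (1 - lam n) * inverse (real n) < 1"
    by (intro order_tendstoD) auto
  moreover have "\<forall>\<^sub>F n in sequentially. real n * (1 - lam n) > 0"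
    using lam \<open>\<beta> > 0\<close> by (intro order_tendstoD) auto
  ultimately show ?thesis
  proof eventually_elim
    case (elim n)
    then have "n > 0" by (cases n) auto
    with elim show ?case by (auto simp: zero_less_mult_iff divide_simps)
  qed
qed

text \<open>The slope comes from the ansatz \<open>x n = g n\<close>, which leads to
  \<open>g = \<gamma> - \<beta> g\<close>. The remainder \<open>y\<close> obeys the same recursion
  with a source tending to 0, and the contraction makes it \<open>o(n)\<close>.\<close>

lemma linear_recursion_limit:
  fixes x c lam :: "nat \<Rightarrow> real"
  assumes step: "\<forall>\<^sub>F n in sequentially. x (Suc n) = lam n * x n + c n"
    and lam: "(\<lambda>n. real n * (1 - lam n)) \<longlonglongrightarrow> \<beta>" and "\<beta> > 0" and c: "c \<longlonglongrightarrow> \<gamma>"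
  shows "(\<lambda>n. x n / real n) \<longlonglongrightarrow> \<gamma> / (1 + \<beta>)"
proof -
  define g where "g = \<gamma> / (1 + \<beta>)"
  define y where "y n = x n - real n * g" for n
  define e where "e n = c n - g - g * (real n * (1 - lam n))" for n
  have "e \<longlonglongrightarrow> \<gamma> - g - g * \<beta>"
    unfolding e_def by (intro tendsto_intros c lam)
  also have "\<gamma> - g - g * \<beta> = 0" using \<open>\<beta> > 0\<close> by (simp add: g_def field_simps)
  finally have "(\<lambda>n. \<bar>e n\<bar>) \<longlonglongrightarrow> 0" by (rule tendsto_rabs_zero)
  moreover have "\<forall>\<^sub>F n in sequentially. \<bar>y (Suc n)\<bar> \<le> \<bar>y n\<bar> + \<bar>e n\<bar>"
    using step eventually_contraction[OF lam \<open>\<beta> > 0\<close>]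
  proof eventually_elim
    case (elim n)
    have "y (Suc n) = lam n * y n + e n"
      using elim(1) by (simp add: y_def e_def algebra_simps)
    then have "\<bar>y (Suc n)\<bar> \<le> \<bar>lam n * y n\<bar> + \<bar>e n\<bar>" by simp
    also have "\<bar>lam n * y n\<bar> \<le> 1 * \<bar>y n\<bar>"
      unfolding abs_mult using elim(2) by (intro mult_right_mono) auto
    finally show ?case by simp
  qed
  ultimately have "(\<lambda>n. y n / real n) \<longlonglongrightarrow> 0" by (intro div_n_tendsto_0)
  then have "(\<lambda>n. y n / real n + g) \<longlonglongrightarrow> 0 + g" by (intro tendsto_intros)
  moreover have "\<forall>\<^sub>F n in sequentially. y n / real n + g = x n / real n"
    using eventually_gt_at_top[of 0] by eventually_elim (simp add: y_def field_simps)
  ultimately show ?thesis unfolding g_def by (simp add: filterlim_cong)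
qed

text \<open>Passing to squares turns the increments \<open>O(1/n)\<close> into increments that vanish.\<close>

lemma linear_recursion_sqrt:
  fixes y e lam :: "nat \<Rightarrow> real"
  assumes step: "\<forall>\<^sub>F n in sequentially. y (Suc n) = lam n * y n + e n"
    and lam: "\<forall>\<^sub>F n in sequentially. 0 \<le> lam n \<and> lam n \<le> 1"
    and e: "\<forall>\<^sub>F n in sequentially. \<bar>e n\<bar> \<le> C / real n"
  shows "(\<lambda>n. y n / sqrt (real n)) \<longlonglongrightarrow> 0"
proof -
  have Cn: "(\<lambda>n. C / real n) \<longlonglongrightarrow> 0"
    by (rule lim_const_over_n)
  have step': "\<forall>\<^sub>F n in sequentially. \<bar>y (Suc n)\<bar> \<le> \<bar>y n\<bar> + C / real n"
    using step lam e
  proof eventually_elim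
    case (elim n)
    have "\<bar>y (Suc n)\<bar> \<le> \<bar>lam n * y n\<bar> + \<bar>e n\<bar>" using elim(1) by simp
    also have "\<bar>lam n * y n\<bar> \<le> 1 * \<bar>y n\<bar>"
      unfolding abs_mult using elim(2) by (intro mult_right_mono) auto
    finally show ?case using elim(3) by simp
  qed
  then have y: "(\<lambda>n. y n / real n) \<longlonglongrightarrow> 0"
    using Cn by (rule div_n_tendsto_0)
  \<comment> \<open>Squaring the bound for \<open>y (Suc n)\<close> produces the cross term
    \<open>2 C |y n| / n\<close>, which vanishes because \<open>y n = o(n)\<close> has just been
    shown.\<close>
  define e' where "e' n = 2 * C * \<bar>y n / real n\<bar> + (C / real n)\<^sup>2" for n
  have "e' \<longlonglongrightarrow> 2 * C * \<bar>0\<bar> + 0\<^sup>2"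
    unfolding e'_def by (intro tendsto_intros y Cn)
  then have "e' \<longlonglongrightarrow> 0" by simp
  moreover have "\<forall>\<^sub>F n in sequentially. \<bar>(y (Suc n))\<^sup>2\<bar> \<le> \<bar>(y n)\<^sup>2\<bar> + e' n"
    using step' eventually_gt_at_top[of 0]
  proof eventually_elim
    case (elim n)
    have "\<bar>y (Suc n)\<bar>\<^sup>2 \<le> (\<bar>y n\<bar> + C / real n)\<^sup>2"
      using elim(1) by (intro power_mono) auto
    then show ?case unfolding e'_def by (simp add: power2_sum algebra_simps)
  qed
  ultimately have "(\<lambda>n. (y n)\<^sup>2 / real n) \<longlonglongrightarrow> 0" by (intro div_n_tendsto_0)
  then have "(\<lambda>n. sqrt ((y n)\<^sup>2 / real n)) \<longlonglongrightarrow> sqrt 0" by (intro tendsto_intros)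
  then have "(\<lambda>n. \<bar>y n / sqrt (real n)\<bar>) \<longlonglongrightarrow> 0"
    by (simp add: real_sqrt_divide abs_divide)
  then show ?thesis by (rule tendsto_rabs_zero_cancel)
qed

text \<open>The quotient \<open>v n / n\<close> grows by at most a multiple of \<open>1 / n\<close>
  per step, so \<open>div_n_tendsto_0\<close> applies to it.\<close>

lemma linear_growth_div_square:
  fixes v :: "nat \<Rightarrow> real"
  assumes step: "\<forall>\<^sub>F n in sequentially. v (Suc n) \<le> v n + C" and nonneg: "\<And>n. v n \<ge> 0"
  shows "(\<lambda>n. v n / (real n)\<^sup>2) \<longlonglongrightarrow> 0"
proof -
  define y where "y n = v n / real n" for n
  have "\<forall>\<^sub>F n in sequentially. \<bar>y (Suc n)\<bar> \<le> \<bar>y n\<bar> + \<bar>C\<bar> / real n"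
    using step eventually_gt_at_top[of 0]
  proof eventually_elim
    case (elim n)
    have "\<bar>y (Suc n)\<bar> = v (Suc n) / real (Suc n)" using nonneg by (simp add: y_def)
    also have "\<dots> \<le> (v n + \<bar>C\<bar>) / real n"
      using elim nonneg[of n] nonneg[of "Suc n"] by (intro frac_le) auto
    finally show ?case using nonneg by (simp add: y_def add_divide_distrib)
  qed
  then have "(\<lambda>n. y n / real n) \<longlonglongrightarrow> 0"
    by (rule div_n_tendsto_0) (rule lim_const_over_n)
  then show ?thesis by (simp add: y_def power2_eq_square)
qed

lemma cesaro_zero:
  fixes \<eta> :: "nat \<Rightarrow> real"
  assumes "\<eta> \<longlonglongrightarrow> 0" "\<And>n. \<eta> n \<ge> 0"
  shows "(\<lambda>n. (\<Sum>j<n. \<eta> j) / real n) \<longlonglongrightarrow> 0"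
  by (rule div_n_tendsto_0[of _ \<eta>]) (use assms in \<open>auto simp: sum_nonneg\<close>)

text \<open>Second order Taylor expansion of the characteristic function of a finite distribution:
  centring at \<mu> removes the linear term, and the remainder is cubic in
  \<open>|z v - \<mu>| \<le> 2 B\<close>. Afterwards \<open>1 - h^2 V / 2\<close>, with
  \<open>V\<close> the variance, is compared with the Gaussian factor of variance
  \<open>q\<close>.\<close>

lemma iexp_mean_approx:
  fixes z P :: "'v \<Rightarrow> real" and q h B :: real
  assumes P: "\<And>v. v \<in> A \<Longrightarrow> 0 \<le> P v" "(\<Sum>v\<in>A. P v) = 1"
    and z: "\<And>v. v \<in> A \<Longrightarrow> \<bar>z v\<bar> \<le> B" and "0 \<le> q" "0 \<le> h"
  defines "\<mu> \<equiv> \<Sum>v\<in>A. P v * z v"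
  shows "norm ((\<Sum>v\<in>A. of_real (P v) * iexp (h * (z v - \<mu>))) - of_real (exp (- (h\<^sup>2 * q / 2))))
    \<le> (2 * h * B) ^ 3 / 6 + h\<^sup>2 / 2 * \<bar>(\<Sum>v\<in>A. P v * (z v)\<^sup>2) - \<mu>\<^sup>2 - q\<bar> + (h\<^sup>2 * q)\<^sup>2 / 8"
proof -
  let ?e = "\<lambda>v. (1 + \<i> * of_real (h * (z v - \<mu>)) - of_real ((h * (z v - \<mu>))\<^sup>2 / 2))"
  let ?I = "(\<Sum>v\<in>A. of_real (P v) * iexp (h * (z v - \<mu>)))"
  define V where "V = (\<Sum>v\<in>A. P v * (z v)\<^sup>2) - \<mu>\<^sup>2"
  have \<mu>: "\<bar>\<mu>\<bar> \<le> B"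
  proof -
    have "\<bar>\<mu>\<bar> \<le> (\<Sum>v\<in>A. \<bar>P v * z v\<bar>)" unfolding \<mu>_def by (rule sum_abs)
    also have "\<dots> \<le> (\<Sum>v\<in>A. P v * B)"
      using P z by (intro sum_mono) (auto simp: abs_mult intro!: mult_left_mono)
    also have "\<dots> = B" using P by (simp flip: sum_distrib_right)
    finally show ?thesis .
  qed
  have poly: "(\<Sum>k\<le>2. (\<i> * complex_of_real x) ^ k / fact k) = 1 + \<i> * of_real x - of_real (x\<^sup>2 / 2)" for x
    by (simp add: numeral_2_eq_2 power_mult_distrib field_simps)
  have iexp: "norm (iexp x - (1 + \<i> * of_real x - of_real (x\<^sup>2 / 2))) \<le> \<bar>x\<bar> ^ 3 / 6" for x :: real
    using iexp_approx1[of x 2] unfolding poly by (simp add: eval_nat_numeral fact_numeral)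
  have "norm (?I - of_real (1 - h\<^sup>2 / 2 * V)) \<le> (2 * h * B) ^ 3 / 6"
  proof -
    have "(\<Sum>v\<in>A. of_real (P v) * ?e v)
        = complex_of_real (1 - h\<^sup>2 / 2 * V)"
    proof -
      have mean0: "(\<Sum>v\<in>A. P v * (h * (z v - \<mu>))) = 0"
      proof -
        have "(\<Sum>v\<in>A. P v * (h * (z v - \<mu>))) = h * ((\<Sum>v\<in>A. P v * z v) - (\<Sum>v\<in>A. P v) * \<mu>)"
          by (simp add: sum_distrib_left sum_distrib_right sum_subtractf algebra_simps)
        then show ?thesis using P by (simp add: \<mu>_def)
      qed
      have var: "(\<Sum>v\<in>A. P v * ((h * (z v - \<mu>))\<^sup>2 / 2)) = h\<^sup>2 / 2 * V"
      proof -
        have "(\<Sum>v\<in>A. P v * ((h * (z v - \<mu>))\<^sup>2 / 2))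
            = (\<Sum>v\<in>A. h\<^sup>2 / 2 * (P v * (z v)\<^sup>2 - 2 * \<mu> * (P v * z v) + \<mu>\<^sup>2 * P v))"
          by (intro sum.cong refl) (simp add: power_mult_distrib power2_diff power2_eq_square field_simps)
        also have "\<dots> = h\<^sup>2 / 2 * ((\<Sum>v\<in>A. P v * (z v)\<^sup>2) - 2 * \<mu> * \<mu> + \<mu>\<^sup>2 * (\<Sum>v\<in>A. P v))"
          by (simp only: sum_distrib_left[symmetric] sum.distrib sum_subtractf \<mu>_def)
        also have "\<dots> = h\<^sup>2 / 2 * V" using P by (simp add: V_def power2_eq_square)
        finally show ?thesis .
      qed
      have "(\<Sum>v\<in>A. of_real (P v) * ?e v)
          = of_real (\<Sum>v\<in>A. P v) + \<i> * of_real (\<Sum>v\<in>A. P v * (h * (z v - \<mu>)))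
            - of_real (\<Sum>v\<in>A. P v * ((h * (z v - \<mu>))\<^sup>2 / 2))"
        unfolding of_real_sum of_real_mult sum_distrib_left sum.distrib[symmetric] sum_subtractf[symmetric]
        by (intro sum.cong refl) (simp add: algebra_simps)
      also have "\<dots> = of_real (1 - h\<^sup>2 / 2 * V)" unfolding mean0 var P(2) by simp
      finally show ?thesis .
    qed
    then have "?I - of_real (1 - h\<^sup>2 / 2 * V)
       = (\<Sum>v\<in>A. of_real (P v) * (iexp (h * (z v - \<mu>))
            - ?e v))"
      by (simp only: right_diff_distrib sum_subtractf)
    also have "norm \<dots> \<le> (\<Sum>v\<in>A. P v * ((2 * h * B) ^ 3 / 6))"
    proof (rule sum_norm_le)
      fix v assume v: "v \<in> A"
      have "\<bar>h * (z v - \<mu>)\<bar> \<le> h * (2 * B)"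
        unfolding abs_mult using \<mu> z[OF v] \<open>0 \<le> h\<close> by (intro mult_mono) auto
      then have "\<bar>h * (z v - \<mu>)\<bar> ^ 3 \<le> (2 * h * B) ^ 3"
        by (intro power_mono) (auto simp: mult_ac)
      then have "norm (iexp (h * (z v - \<mu>)) - ?e v)
        \<le> (2 * h * B) ^ 3 / 6"
        using iexp[of "h * (z v - \<mu>)"] by linarith
      then show "norm (of_real (P v) * (iexp (h * (z v - \<mu>))
            - ?e v)) \<le> P v * ((2 * h * B) ^ 3 / 6)"
        unfolding norm_mult norm_of_real using P(1)[OF v] by (intro mult_mono) auto
    qed
    also have "\<dots> = (2 * h * B) ^ 3 / 6" unfolding sum_distrib_right[symmetric] P(2) by simp
    finally show ?thesis .
  qed
  moreover have "norm (complex_of_real (1 - h\<^sup>2 / 2 * V) - of_real (exp (- (h\<^sup>2 * q / 2))))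
      \<le> h\<^sup>2 / 2 * \<bar>V - q\<bar> + (h\<^sup>2 * q)\<^sup>2 / 8"
  proof -
    define x where "x = h\<^sup>2 * q / 2"
    have "x \<ge> 0" using assms by (simp add: x_def)
    have "\<bar>exp (- x) - (1 - x)\<bar> \<le> x\<^sup>2 / 2"
    proof -
      have "1 - x \<le> exp (- x)" using exp_ge_add_one_self[of "- x"] by simp
      moreover have "exp (- x) \<le> 1 - x + x\<^sup>2 / 2"
      proof (cases "x = 0")
        case False
        with \<open>x \<ge> 0\<close> have "x > 0" by simp
        \<comment> \<open>Second order expansion with remainder at some \<open>t < 0\<close>, where
          \<open>exp t \<le> 1\<close>.\<close>
        from Maclaurin_minus[of "- x" 2 "\<lambda>_. exp" exp] \<open>x > 0\<close>
        obtain t where "- x < t" "t < 0" "exp (- x) = (\<Sum>k<2. exp 0 / fact k * (- x) ^ k) + exp t / fact 2 * (- x)\<^sup>2"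
          by (auto intro!: derivative_eq_intros)
        moreover have "exp t * x\<^sup>2 \<le> 1 * x\<^sup>2" using \<open>t < 0\<close> by (intro mult_right_mono) auto
        ultimately show ?thesis by (simp add: eval_nat_numeral fact_numeral)
      qed simp
      ultimately show ?thesis by linarith
    qed
    moreover have "x\<^sup>2 / 2 = (h\<^sup>2 * q)\<^sup>2 / 8" by (simp add: x_def power_divide)
    moreover have "\<bar>h\<^sup>2 / 2 * V - x\<bar> = h\<^sup>2 / 2 * \<bar>V - q\<bar>"
      by (simp add: x_def abs_mult right_diff_distrib[symmetric] diff_divide_distrib[symmetric])
    ultimately have "\<bar>(1 - h\<^sup>2 / 2 * V) - exp (- x)\<bar> \<le> h\<^sup>2 / 2 * \<bar>V - q\<bar> + (h\<^sup>2 * q)\<^sup>2 / 8" by linarith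
    then show ?thesis unfolding x_def of_real_diff[symmetric] norm_of_real by simp
  qed
  ultimately show ?thesis
    unfolding V_def[symmetric]
    using norm_triangle_le[of "?I - of_real (1 - h\<^sup>2 / 2 * V)"
        "complex_of_real (1 - h\<^sup>2 / 2 * V) - of_real (exp (- (h\<^sup>2 * q / 2)))"] by fastforce
qed

section \<open>The coefficients, the limiting proportions and the covariance\<close>

text \<open>Pascal's rule: a difference of order \<open>Suc n\<close> is the difference of order n
  of a first difference. It drives the inductions for the two reciprocal sums.\<close>

lemma alternating_binomial_Suc:
  fixes f :: "nat \<Rightarrow> real"
  shows "(\<Sum>i\<le>Suc n. (-1) ^ i * real (Suc n choose i) * f i)
       = (\<Sum>i\<le>n. (-1) ^ i * real (n choose i) * (f i - f (Suc i)))"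
proof -
  have "(\<Sum>i\<le>Suc n. (-1) ^ i * real (Suc n choose i) * f i)
      = f 0 + (\<Sum>i\<le>n. (-1) ^ Suc i * real ((n choose i) + (n choose Suc i)) * f (Suc i))"
    by (subst sum.atMost_Suc_shift)
       (simp only: binomial_Suc_Suc binomial_n_0 power_0 of_nat_1 mult_1_left)
  also have "\<dots> = (f 0 + (\<Sum>i\<le>n. (-1) ^ Suc i * real (n choose Suc i) * f (Suc i)))
                 - (\<Sum>i\<le>n. (-1) ^ i * real (n choose i) * f (Suc i))"
    by (simp add: sum.distrib sum_subtractf sum_negf algebra_simps)
  also have "f 0 + (\<Sum>i\<le>n. (-1) ^ Suc i * real (n choose Suc i) * f (Suc i))
      = (\<Sum>i\<le>Suc n. (-1) ^ i * real (n choose i) * f i)"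
    by (subst sum.atMost_Suc_shift) simp
  also have "\<dots> = (\<Sum>i\<le>n. (-1) ^ i * real (n choose i) * f i)" by simp
  finally show ?thesis by (simp add: right_diff_distrib sum_subtractf)
qed

text \<open>Both sides are the Beta integral of \<open>u^(x-1) (1-u)^b\<close> over [0, 1], the left
  one with \<open>(1-u)^b\<close> expanded. The induction replaces the integral by a difference step
  and the functional equation of Gamma.\<close>

lemma alternating_binomial_reciprocal:
  fixes x :: real
  assumes "x > 0"
  shows "(\<Sum>k\<le>b. (-1) ^ k * real (b choose k) * (1 / (x + real k))) = fact b * Gamma x / Gamma (x + real b + 1)"
  using assms
proof (induction b arbitrary: x)
  case 0
  have "Gamma (x + 1) = x * Gamma x"
    using 0 by (intro Gamma_plus1) (auto elim!: nonpos_Ints_cases)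
  moreover have "Gamma x \<noteq> 0"
    using Gamma_real_pos[OF 0] by linarith
  ultimately show ?case using 0 by (simp add: field_simps)
next
  case (Suc b)
  have "(\<Sum>k\<le>Suc b. (-1) ^ k * real (Suc b choose k) * (1 / (x + real k)))
      = (\<Sum>k\<le>b. (-1) ^ k * real (b choose k) * (1 / (x + real k)))
      - (\<Sum>k\<le>b. (-1) ^ k * real (b choose k) * (1 / ((x + 1) + real k)))"
    unfolding alternating_binomial_Suc by (simp add: right_diff_distrib sum_subtractf add_ac)
  also have "\<dots> = fact b * Gamma x / Gamma (x + real b + 1) - fact b * Gamma (x + 1) / Gamma (x + real b + 1 + 1)"
    using Suc.IH[of x] Suc.IH[of "x + 1"] Suc.prems by (simp add: add_ac)
  also have "\<dots> = fact (Suc b) * Gamma x / Gamma (x + real b + 1 + 1)"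
  proof -
    have "Gamma (x + real b + 1 + 1) = (x + real b + 1) * Gamma (x + real b + 1)"
      using Suc.prems by (intro Gamma_plus1) (auto elim!: nonpos_Ints_cases)
    moreover have "Gamma (x + 1) = x * Gamma x"
      using Suc.prems by (intro Gamma_plus1) (auto elim!: nonpos_Ints_cases)
    moreover have "Gamma (x + real b + 1) > 0" using Suc.prems by (intro Gamma_real_pos) auto
    moreover have "x + real b + 1 > 0" using Suc.prems by auto
    ultimately show ?thesis by (simp add: divide_simps) (simp add: algebra_simps)
  qed
  finally show ?case by (simp add: add_ac)
qed

text \<open>The corresponding integral contains \<open>(1-u)^a (1-u)^b\<close>, which explains why
  only \<open>a + b\<close> enters the value.\<close>

lemma alternating_binomial_reciprocal2:
  fixes x :: real
  assumes "x > 0"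
  shows "(\<Sum>i\<le>a. (-1) ^ i * real (a choose i) * (\<Sum>k\<le>b. (-1) ^ k * real (b choose k) * (1 / (x + real i + real k))))
     = fact (a + b) * Gamma x / Gamma (x + real (a + b) + 1)"
  using assms
proof (induction a arbitrary: x)
  case 0
  then show ?case using alternating_binomial_reciprocal[of x b] by simp
next
  case (Suc a)
  define g where "g i = (\<Sum>k\<le>b. (-1) ^ k * real (b choose k) * (1 / (x + real i + real k)))" for i
  have g: "g (Suc i) = (\<Sum>k\<le>b. (-1) ^ k * real (b choose k) * (1 / ((x + 1) + real i + real k)))" for i
    by (simp add: g_def add_ac)
  have "(\<Sum>i\<le>Suc a. (-1) ^ i * real (Suc a choose i) * g i)
      = (\<Sum>i\<le>a. (-1) ^ i * real (a choose i) * g i) - (\<Sum>i\<le>a. (-1) ^ i * real (a choose i) * g (Suc i))"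
    unfolding alternating_binomial_Suc by (simp add: right_diff_distrib sum_subtractf)
  also have "\<dots> = fact (a + b) * Gamma x / Gamma (x + real (a + b) + 1)
       - fact (a + b) * Gamma (x + 1) / Gamma (x + real (a + b) + 1 + 1)"
    unfolding g using Suc.IH[of x] Suc.IH[of "x + 1"] Suc.prems unfolding g_def by (simp add: add_ac)
  also have "\<dots> = fact (Suc (a + b)) * Gamma x / Gamma (x + real (a + b) + 1 + 1)"
  proof -
    define y where "y = x + real (a + b)"
    have "y > 0" using Suc.prems by (simp add: y_def)
    have "Gamma (y + 1 + 1) = (y + 1) * Gamma (y + 1)"
      using \<open>y > 0\<close> by (intro Gamma_plus1) (auto elim!: nonpos_Ints_cases)
    moreover have "Gamma (x + 1) = x * Gamma x"
      using Suc.prems by (intro Gamma_plus1) (auto elim!: nonpos_Ints_cases)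
    moreover have "Gamma (y + 1) > 0" using \<open>y > 0\<close> by (intro Gamma_real_pos) auto
    moreover have "fact (Suc (a + b)) = (y + 1 - x) * (fact (a + b) :: real)" by (simp add: y_def)
    ultimately show ?thesis unfolding y_def[symmetric]
      using \<open>y > 0\<close> by (simp add: divide_simps) (simp add: algebra_simps)
  qed
  finally show ?case unfolding g_def by (simp add: add_ac)
qed

section \<open>The coefficients \<open>b\<close> and their inverse matrix
  \<open>b_abs\<close>\<close>

lemma b_coeff_self [simp]: "b_coeff \<delta> k k = 1"
  by (simp add: b_coeff_def)

lemma b_coeff_eq_0: "k < j \<Longrightarrow> b_coeff \<delta> j k = 0"
  by (simp add: b_coeff_def)

text \<open>The recursion behind the product in \<open>b_coeff\<close>, cleared of denominators. In
  this form it holds for all j and k, because for \<open>j \<ge> k\<close> both sides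
  vanish.\<close>

lemma b_coeff_Suc: "(real j + \<delta>) * b_coeff \<delta> (Suc j) k = (real j - real k) * b_coeff \<delta> j k"
proof -
  consider "j < k" | "j = k" | "j > k" by linarith
  then show ?thesis
  proof cases
    case 1
    then have "b_coeff \<delta> j k = (real j + \<delta>) / (real j - real k) * b_coeff \<delta> (Suc j) k"
      by (simp add: b_coeff_def prod.atLeast_Suc_lessThan)
    with 1 show ?thesis by simp
  qed (auto simp: b_coeff_def)
qed

lemma b_coeff_diff:
  "(real d + \<delta>) * (b_coeff \<delta> (Suc d) t - b_coeff \<delta> d t) = - (real t + \<delta>) * b_coeff \<delta> d t"
  using b_coeff_Suc[of d \<delta> t] by (simp add: algebra_simps)

locale pa_params =
  fixes m :: nat and \<delta> :: real
  assumes m_pos: "1 \<le> m" and delta_gt: "- real m < \<delta>"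
begin

text \<open>The growth rate of the total weight: each vertex brings \<open>2 m + \<delta>\<close>,
  that is \<theta> per edge on average.\<close>

definition \<theta> :: real where "\<theta> = 2 + \<delta> / real m"

lemma m_theta: "real m * \<theta> = 2 * real m + \<delta>"
  using m_pos by (simp add: \<theta>_def field_simps)

lemma theta_gt_1: "\<theta> > 1"
proof -
  have "real m * \<theta> > real m * 1" using delta_gt m_theta m_pos by linarith
  then show ?thesis using m_pos mult_less_cancel_left_pos[of "real m" 1 \<theta>] by simp
qed

lemma plus_delta_pos: "m \<le> k \<Longrightarrow> 0 < real k + \<delta>"
  using delta_gt by linarith

lemma Gamma_plus_delta_pos: "m \<le> k \<Longrightarrow> 0 < Gamma (real k + \<delta>)"
  using plus_delta_pos by (intro Gamma_real_pos)

lemma Gamma_Suc_delta: "m \<le> k \<Longrightarrow> Gamma (real (Suc k) + \<delta>) = (real k + \<delta>) * Gamma (real k + \<delta>)"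
proof -
  assume "m \<le> k"
  then have "real k + \<delta> \<notin> \<int>\<^sub>\<le>\<^sub>0"
    using plus_delta_pos[of k] by (auto elim!: nonpos_Ints_cases)
  from Gamma_plus1[OF this] show ?thesis by (simp add: add_ac)
qed

abbreviation b :: "nat \<Rightarrow> nat \<Rightarrow> real" where "b \<equiv> b_coeff \<delta>"
abbreviation p :: "nat \<Rightarrow> real" where "p \<equiv> p_lim m \<delta>"

text \<open>For \<open>m \<le> j \<le> k\<close> this is the absolute value of \<open>b j k\<close>.
  The same numbers form the matrix inverse to \<open>b\<close>, see \<open>b_inversion\<close>, and
  so recover the counts \<open>N_k\<close> from the \<open>U_t\<close>.\<close>

definition b_abs :: "nat \<Rightarrow> nat \<Rightarrow> real" where
  "b_abs j k = (-1) ^ (k - j) * b j k"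

lemma b_abs_eq_0: "k < j \<Longrightarrow> b_abs j k = 0"
  by (simp add: b_abs_def b_coeff_eq_0)

text \<open>Induction downwards from the value 1 at \<open>j = k\<close>; every use of
  \<open>b_coeff_Suc\<close> supplies one factor of the Gamma quotient and one of the
  factorial.\<close>

lemma b_abs_Gamma:
  assumes "m \<le> j" "j \<le> k"
  shows "b_abs j k = Gamma (real k + \<delta>) / (fact (k - j) * Gamma (real j + \<delta>))"
  using assms(2)
proof (induction rule: inc_induct)
  case base
  then show ?case using Gamma_plus_delta_pos[of k] assms by (simp add: b_abs_def)
next
  case (step n)
  then have n: "m \<le> n" "n < k" using assms by auto
  have k: "k - n = Suc (k - Suc n)" using n by simp
  have "(real n + \<delta>) * b_abs (Suc n) k = (-1) ^ (k - Suc n) * ((real n + \<delta>) * b (Suc n) k)"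
    by (simp add: b_abs_def)
  also have "\<dots> = (real k - real n) * b_abs n k"
    unfolding b_coeff_Suc b_abs_def k by (simp add: algebra_simps)
  finally have "b_abs n k = (real n + \<delta>) * b_abs (Suc n) k / (real k - real n)"
    using n by (simp add: field_simps)
  also have "\<dots> = Gamma (real k + \<delta>) / (fact (k - n) * Gamma (real n + \<delta>))"
  proof -
    have kn: "real k - real n = real (k - n)" using n by simp
    have fact: "fact (k - n) = (real k - real n) * fact (k - Suc n)"
      unfolding kn by (simp only: k fact_Suc)
    have "A * (G / (f * (A * g))) / D = G / (D * f * g)" if "A > 0" for A D f g G :: real
      using that by simp
    then show ?thesis
      unfolding step.IH Gamma_Suc_delta[OF n(1)] fact using plus_delta_pos[OF n(1)] .
  qed
  finally show ?case .
qed

text \<open>The factors \<open>Gamma (t + \<delta>)\<close> cancel and the two factorials form a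
  binomial coefficient. This is what turns sums over t into finite differences.\<close>

lemma b_abs_mult_b:
  assumes "m \<le> j" "j \<le> t" "t \<le> l"
  shows "b_abs t l * b j t = (-1) ^ (t - j) * real ((l - j) choose (t - j)) * b_abs j l"
proof -
  have "b j t = (-1) ^ (t - j) * b_abs j t"
    by (simp add: b_abs_def)
  then have "b_abs t l * b j t = (-1) ^ (t - j) * (b_abs t l * b_abs j t)" by simp
  also have "b_abs t l * b_abs j t = real ((l - j) choose (t - j)) * b_abs j l"
  proof -
    have "(l - j) - (t - j) = l - t" using assms by simp
    then have "real ((l - j) choose (t - j)) = fact (l - j) / (fact (t - j) * fact (l - t))"
      using assms by (subst binomial_fact) auto
    then show ?thesis
      using assms Gamma_plus_delta_pos[of t] Gamma_plus_delta_pos[of j] by (simp add: b_abs_Gamma)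
  qed
  finally show ?thesis by simp
qed

text \<open>Constant \<open>f\<close> will yield the inversion and reciprocals the Beta values:
  after \<open>b_abs_mult_b\<close> the sum is, up to sign, a finite difference of \<open>f\<close>
  of order \<open>l - j\<close>, taken at \<open>j\<close>.\<close>

lemma sum_b_abs_b:
  assumes "m \<le> j"
  shows "(\<Sum>t=m..l. b_abs t l * b j t * f t)
    = (if j \<le> l then b_abs j l * (\<Sum>i\<le>l - j. (-1) ^ i * real ((l - j) choose i) * f (j + i)) else 0)"
proof (cases "j \<le> l")
  case True
  have "(\<Sum>t=m..l. b_abs t l * b j t * f t) = (\<Sum>t=j..l. b_abs t l * b j t * f t)"
    using assms by (intro sum.mono_neutral_right) (auto simp: b_coeff_eq_0)
  also have "\<dots> = (\<Sum>t=j..l. b_abs j l * ((-1) ^ (t - j) * real ((l - j) choose (t - j)) * f t))"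
    using assms by (intro sum.cong refl) (simp add: b_abs_mult_b)
  also have "\<dots> = (\<Sum>i\<le>l - j. b_abs j l * ((-1) ^ i * real ((l - j) choose i) * f (j + i)))"
    using True by (intro sum.reindex_bij_witness[of _ "\<lambda>i. j + i" "\<lambda>t. t - j"]) auto
  finally show ?thesis using True by (simp add: sum_distrib_left)
qed (auto simp: b_coeff_eq_0 intro!: sum.neutral)

text \<open>Differences of positive order annihilate constants. Read on functions of the degree: for
  degrees at least m, the indicator of degree l is a combination of the eigenfunctions with weights
  \<open>b_abs t l\<close>.\<close>

lemma b_inversion:
  assumes "m \<le> j"
  shows "(\<Sum>t=m..l. b_abs t l * b j t) = (if j = l then 1 else 0)"
proof -
  have "(\<Sum>i\<le>n. (-1) ^ i * real (n choose i)) = (if n = 0 then 1 else 0)" for n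
    using choose_alternating_sum[of n, where 'a = real] by auto
  with sum_b_abs_b[OF assms, where f = "\<lambda>_. 1" and l = l] show ?thesis
    by (auto simp: b_abs_def)
qed

section \<open>The limiting proportions \<open>p\<close> and the limits \<open>c_lim\<close>\<close>

lemma p_m: "p m = \<theta> / (real m + \<delta> + \<theta>)"
proof -
  define x where "x = real m + 2 + \<delta> + \<delta> / real m"
  have x: "x = real m + \<delta> + \<theta>" by (simp add: x_def \<theta>_def)
  have "x > 0" using plus_delta_pos[of m] theta_gt_1 x by linarith
  have "Gamma (x + 1) = x * Gamma x"
    using \<open>x > 0\<close> by (intro Gamma_plus1) (auto elim!: nonpos_Ints_cases)
  moreover have "real m + 3 + \<delta> + \<delta> / real m = x + 1" by (simp add: x_def)
  moreover have "Gamma x > 0" using \<open>x > 0\<close> by (rule Gamma_real_pos)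
  ultimately have "p m = (2 + \<delta> / m) * (Gamma (m + \<delta>) * Gamma x) / (Gamma (m + \<delta>) * (x * Gamma x))"
    unfolding p_lim_def x_def[symmetric] by (simp only:)
  also have "\<dots> = \<theta> / x" using Gamma_plus_delta_pos[of m] \<open>Gamma x > 0\<close> by (simp add: \<theta>_def)
  finally show ?thesis by (simp add: x)
qed

text \<open>The balance equation of the limiting degree distribution: the gain from degree q equals
  the loss of degree \<open>Suc q\<close> plus the growth of its count. Together with
  \<open>p_m\<close> it carries everything shown about \<open>p\<close> below.\<close>

lemma p_Suc:
  assumes "m \<le> q"
  shows "(real (Suc q) + \<delta> + \<theta>) * p (Suc q) = (real q + \<delta>) * p q"
proof -
  define x where "x = real q + 3 + \<delta> + \<delta> / real m"
  have x: "x = real (Suc q) + \<delta> + \<theta>" by (simp add: x_def \<theta>_def)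
  have "x > 0" using plus_delta_pos[OF assms] theta_gt_1 x by simp
  have e: "real (Suc q) + 3 + \<delta> + \<delta> / real m = x + 1" by (simp add: x_def)
  have "Gamma (x + 1) = x * Gamma x"
    using \<open>x > 0\<close> by (intro Gamma_plus1) (auto elim!: nonpos_Ints_cases)
  then show ?thesis
    unfolding p_lim_def x[symmetric] x_def[symmetric] e Gamma_Suc_delta[OF assms]
    using \<open>x > 0\<close> Gamma_real_pos[OF \<open>x > 0\<close>] Gamma_plus_delta_pos[of m] by (simp add: divide_simps)
qed

lemma p_pos: "m \<le> q \<Longrightarrow> 0 < p q"
proof (induction q rule: dec_induct)
  case base
  then show ?case using p_m theta_gt_1 plus_delta_pos[of m] by (simp add: divide_pos_pos)
next
  case (step q)
  then have "0 < (real (Suc q) + \<delta> + \<theta>) * p (Suc q)"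
    unfolding p_Suc[OF step.hyps(1)] using plus_delta_pos[of q] by simp
  moreover have "0 < real (Suc q) + \<delta> + \<theta>" using plus_delta_pos[of "Suc q"] step.hyps theta_gt_1 by linarith
  ultimately show ?case by (simp add: zero_less_mult_iff)
qed

text \<open>The limit of \<open>U\<^sub>t / s\<close>, where \<open>U\<^sub>t\<close> is the linear statistic \<open>\<Sum>\<^sub>k b\<^sub>k\<^sup>(\<^sup>t\<^sup>) N\<^sub>k\<close>.\<close>

definition c_lim :: "nat \<Rightarrow> real" where
  "c_lim t = b m t * \<theta> / (real t + \<delta> + \<theta>)"

text \<open>Weight the sum with \<open>q + \<delta> + \<theta>\<close> and apply
  \<open>p_Suc\<close>. After an index shift \<open>b_coeff_Suc\<close> turns the terms into
  \<open>(q - t) b q t p q\<close>; subtracting them leaves the factor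
  \<open>t + \<delta> + \<theta>\<close> on one side and the boundary term at m on the
  other.\<close>

lemma sum_b_p:
  assumes "m \<le> t"
  shows "(\<Sum>q=m..t. b q t * p q) = c_lim t"
proof -
  have "(\<Sum>q=m..t. b q t * (real q + \<delta> + \<theta>) * p q)
      = b m t * \<theta> + (\<Sum>q=Suc m..t. b q t * ((real q + \<delta> + \<theta>) * p q))"
  proof -
    have "(real m + \<delta> + \<theta>) * p m = \<theta>"
      using p_m theta_gt_1 plus_delta_pos[of m] by (simp add: field_simps)
    then show ?thesis
      using assms by (simp add: sum.atLeast_Suc_atMost mult.assoc)
  qed
  also have "(\<Sum>q=Suc m..t. b q t * ((real q + \<delta> + \<theta>) * p q)) = (\<Sum>q=m..<t. b (Suc q) t * ((real (Suc q) + \<delta> + \<theta>) * p (Suc q)))"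
    by (rule sum.reindex_bij_witness[of _ Suc "\<lambda>q. q - 1"]) auto
  also have "\<dots> = (\<Sum>q=m..<t. (real q - real t) * b q t * p q)"
  proof (intro sum.cong refl)
    fix q assume "q \<in> {m..<t}"
    then have "b (Suc q) t * ((real (Suc q) + \<delta> + \<theta>) * p (Suc q)) = ((real q + \<delta>) * b (Suc q) t) * p q"
      by (subst p_Suc) (simp_all add: mult_ac)
    then show "b (Suc q) t * ((real (Suc q) + \<delta> + \<theta>) * p (Suc q)) = (real q - real t) * b q t * p q"
      unfolding b_coeff_Suc .
  qed
  also have "\<dots> = (\<Sum>q=m..t. (real q - real t) * b q t * p q)"
    by (intro sum.mono_neutral_left) auto
  finally have "(\<Sum>q=m..t. b q t * (real q + \<delta> + \<theta>) * p q) - (\<Sum>q=m..t. (real q - real t) * b q t * p q) = b m t * \<theta>"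
    by simp
  then have "(real t + \<delta> + \<theta>) * (\<Sum>q=m..t. b q t * p q) = b m t * \<theta>"
    by (simp add: sum_subtractf[symmetric] sum_distrib_left algebra_simps)
  moreover have "real t + \<delta> + \<theta> > 0" using plus_delta_pos[OF assms] theta_gt_1 by linarith
  ultimately show ?thesis unfolding c_lim_def by (simp add: field_simps)
qed

lemma sum_b_abs_c_lim:
  assumes "m \<le> l"
  shows "(\<Sum>t=m..l. b_abs t l * c_lim t) = p l"
proof -
  have "(\<Sum>t=m..l. b_abs t l * c_lim t) = (\<Sum>t=m..l. \<Sum>q=m..l. b_abs t l * (b q t * p q))"
  proof (intro sum.cong refl)
    fix t assume t: "t \<in> {m..l}"
    then have "c_lim t = (\<Sum>q=m..t. b q t * p q)" by (simp add: sum_b_p)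
    also have "\<dots> = (\<Sum>q=m..l. b q t * p q)"
      using t by (intro sum.mono_neutral_left) (auto simp: b_coeff_eq_0)
    finally show "b_abs t l * c_lim t = (\<Sum>q=m..l. b_abs t l * (b q t * p q))"
      by (simp add: sum_distrib_left)
  qed
  also have "\<dots> = (\<Sum>q=m..l. (\<Sum>t=m..l. b_abs t l * b q t) * p q)"
    by (subst sum.swap) (simp add: sum_distrib_right mult.assoc)
  also have "\<dots> = (\<Sum>q=m..l. (if q = l then 1 else 0) * p q)"
    by (intro sum.cong refl) (simp add: b_inversion)
  also have "\<dots> = p l" using assms by (simp add: if_distrib[of "\<lambda>x. x * _"] cong: if_cong)
  finally show ?thesis .
qed

text \<open>By \<open>p_Suc\<close> the terms are differences of \<open>F\<close>, and
  \<open>F m\<close> is the claimed sum. What remains is that \<open>F\<close> tends to 0.\<close>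

lemma has_sum_degree_p: "((\<lambda>q. (real q + \<delta>) * p q) has_sum (2 * real m + \<delta>)) {m..}"
proof -
  define F where "F q = (real q + \<delta>) * (real q + \<delta> + \<theta>) * p q / (\<theta> - 1)" for q
  have F_diff: "F q - F (Suc q) = (real q + \<delta>) * p q" if "m \<le> q" for q
  proof -
    have "F (Suc q) = (real (Suc q) + \<delta>) * ((real q + \<delta>) * p q) / (\<theta> - 1)"
      unfolding F_def p_Suc[OF that, symmetric] by (simp only: mult.assoc)
    then have "F q - F (Suc q) = ((real q + \<delta>) * p q) * ((real q + \<delta> + \<theta>) - (real (Suc q) + \<delta>)) / (\<theta> - 1)"
      unfolding F_def by (simp only: diff_divide_distrib right_diff_distrib mult_ac)
    also have "\<dots> = (real q + \<delta>) * p q" using theta_gt_1 by simp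
    finally show ?thesis .
  qed
  have F_pos: "F q > 0" if "m \<le> q" for q
    unfolding F_def using p_pos[OF that] plus_delta_pos[OF that] theta_gt_1
    by (intro divide_pos_pos mult_pos_pos) auto
  have F_m: "F m = 2 * real m + \<delta>"
  proof -
    have "F m = (real m + \<delta>) * \<theta> / (\<theta> - 1)"
      unfolding F_def p_m using plus_delta_pos[of m] theta_gt_1 by simp
    also have "real m + \<delta> = real m * (\<theta> - 1)" using m_theta by (simp add: algebra_simps)
    finally show ?thesis using theta_gt_1 m_theta by simp
  qed
  define G where "G n = F (m + n)" for n
  have G_diff: "G n - G (Suc n) = (real (m + n) + \<delta>) * p (m + n)" for n
    using F_diff[of "m + n"] by (simp add: G_def)
  have "decseq G"
    using G_diff p_pos[of "m + _"] plus_delta_pos[of "m + _"]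
    by (intro decseq_SucI) (metis diff_gt_0_iff_gt le_add1 less_imp_le mult_pos_pos)
  moreover have G_pos: "G n > 0" for n by (simp add: G_def F_pos)
  ultimately obtain L where L: "G \<longlonglongrightarrow> L" "\<And>i. L \<le> G i"
    using decseq_convergent[of G 0] by (metis less_imp_le)
  have "L \<ge> 0" using L(1) G_pos by (meson LIMSEQ_le_const less_imp_le)
  \<comment> \<open>The terms equal
    \<open>(\<theta> - 1) G n / (m + n + \<delta> + \<theta>)\<close>. A positive limit of
    \<open>G\<close> would bound them below by a multiple of \<open>1 / (n + 1)\<close>, and the
    convergent telescoping series would dominate the harmonic one.\<close>
  have "L = 0"
  proof (rule ccontr)
    assume "L \<noteq> 0"
    with \<open>L \<ge> 0\<close> have "L > 0" by simp
    have summ: "summable (\<lambda>n. G n - G (Suc n))"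
      using telescope_summable'[OF L(1)] by simp
    define C where "C = real m + \<bar>\<delta>\<bar> + \<theta> + 1"
    have "C > 0" using theta_gt_1 by (simp add: C_def)
    have "norm ((\<theta> - 1) * L / C * (1 / real (Suc n))) \<le> G n - G (Suc n)" for n
    proof -
      have pos: "real (m + n) + \<delta> + \<theta> > 0" using plus_delta_pos[of "m + n"] theta_gt_1 by linarith
      have "C * real (Suc n) = C + C * real n" by (simp add: algebra_simps)
      moreover have "1 * real n \<le> C * real n" using theta_gt_1 by (intro mult_right_mono) (auto simp: C_def)
      ultimately have le: "real (m + n) + \<delta> + \<theta> \<le> C * real (Suc n)" unfolding C_def by auto
      have "norm ((\<theta> - 1) * L / C * (1 / real (Suc n))) = (\<theta> - 1) * L / (C * real (Suc n))"
        using theta_gt_1 \<open>L > 0\<close> \<open>C > 0\<close> by (simp add: abs_mult)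
      also have "\<dots> \<le> (\<theta> - 1) * G n / (real (m + n) + \<delta> + \<theta>)"
        using theta_gt_1 \<open>L > 0\<close> L(2)[of n] pos le by (intro frac_le mult_left_mono mult_nonneg_nonneg) auto
      also have "\<dots> = G n - G (Suc n)"
        unfolding G_diff using theta_gt_1 pos by (simp add: G_def F_def)
      finally show ?thesis .
    qed
    then have "summable (\<lambda>n. (\<theta> - 1) * L / C * (1 / real (Suc n)))"
      using summ by (intro summable_comparison_test'[OF summ])
    then have "summable (\<lambda>n. 1 / real (Suc n))"
      using theta_gt_1 \<open>L > 0\<close> \<open>C > 0\<close> by (subst (asm) summable_cmult_iff) auto
    then show False using not_summable_harmonic[where 'a = real] summable_Suc_iff[of "\<lambda>n. 1 / real n"]
      by (simp add: inverse_eq_divide)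
  qed
  have "(\<lambda>n. G n - G (Suc n)) sums (G 0 - 0)"
    using L(1) unfolding \<open>L = 0\<close> by (rule telescope_sums')
  then have "(\<lambda>n. (real (m + n) + \<delta>) * p (m + n)) sums (2 * real m + \<delta>)"
    unfolding G_diff by (simp add: G_def F_m)
  then have "((\<lambda>n. (real (m + n) + \<delta>) * p (m + n)) has_sum (2 * real m + \<delta>)) UNIV"
    using p_pos[of "m + _"] plus_delta_pos[of "m + _"]
    by (intro norm_summable_imp_has_sum) (auto simp: sums_iff abs_mult less_imp_le)
  then show ?thesis
    by (rule has_sum_reindex_bij_witness[of _ "\<lambda>q. q - m" "\<lambda>n. m + n", THEN iffD1, rotated -1]) auto
qed

end

section \<open>Evaluation of \<open>R_Z\<close> in terms of the covariances of the
  \<open>U_t\<close>\<close>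

context pa_params
begin

text \<open>The last factor is the Beta value \<open>B(x, n + 1)\<close> with
  \<open>x = j + j' + 2 \<delta> + \<theta>\<close> and \<open>n = r + l - j - j'\<close>, as it
  comes out of \<open>alternating_binomial_reciprocal2\<close>.\<close>

definition beta_kernel :: "nat \<Rightarrow> nat \<Rightarrow> nat \<Rightarrow> nat \<Rightarrow> real" where
  "beta_kernel r l j j' = b_abs j r * b_abs j' l *
     (fact (r + l - j - j') * Gamma (real j + real j' + 2 * \<delta> + \<theta>) / Gamma (real r + real l + 2 * \<delta> + \<theta> + 1))"

text \<open>Two applications of \<open>sum_b_abs_b\<close> leave a double alternating sum of
  reciprocals. The denominator \<open>\<theta> + t1 + t2 + 2 \<delta>\<close> is the one produced by
  the covariance recursion, see \<open>cov_U\<close>.\<close>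

lemma beta_kernel_expansion:
  assumes "m \<le> j" "m \<le> j'"
  shows "(\<Sum>t1=m..r. \<Sum>t2=m..l. b_abs t1 r * b_abs t2 l / (\<theta> + real t1 + real t2 + 2 * \<delta>) * (b j t1 * b j' t2))
       = beta_kernel r l j j'"
proof (cases "j \<le> r \<and> j' \<le> l")
  case True
  define x where "x = real j + real j' + 2 * \<delta> + \<theta>"
  have "x > 0" unfolding x_def using plus_delta_pos[of j] plus_delta_pos[of j'] theta_gt_1 assms by linarith
  define g where "g t1 = (\<Sum>t2=m..l. b_abs t2 l * b j' t2 * (1 / (\<theta> + real t1 + real t2 + 2 * \<delta>)))" for t1 :: nat
  have g: "g (j + i) = b_abs j' l * (\<Sum>k\<le>l - j'. (-1) ^ k * real ((l - j') choose k) * (1 / (x + real i + real k)))" for i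
    unfolding g_def sum_b_abs_b[OF assms(2)] using True by (simp add: x_def add_ac)
  have "(\<Sum>t1=m..r. \<Sum>t2=m..l. b_abs t1 r * b_abs t2 l / (\<theta> + real t1 + real t2 + 2 * \<delta>) * (b j t1 * b j' t2))
      = (\<Sum>t1=m..r. b_abs t1 r * b j t1 * g t1)"
    unfolding g_def by (simp add: sum_distrib_left mult_ac)
  also have "\<dots> = b_abs j r * (\<Sum>i\<le>r - j. (-1) ^ i * real ((r - j) choose i) * g (j + i))"
    using True by (simp add: sum_b_abs_b[OF assms(1)])
  also have "(\<Sum>i\<le>r - j. (-1) ^ i * real ((r - j) choose i) * g (j + i))
      = b_abs j' l * (\<Sum>i\<le>r - j. (-1) ^ i * real ((r - j) choose i) *
          (\<Sum>k\<le>l - j'. (-1) ^ k * real ((l - j') choose k) * (1 / (x + real i + real k))))"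
    by (simp add: g sum_distrib_left mult_ac)
  also have "\<dots> = b_abs j' l * (fact ((r - j) + (l - j')) * Gamma x / Gamma (x + real ((r - j) + (l - j')) + 1))"
    unfolding alternating_binomial_reciprocal2[OF \<open>x > 0\<close>] ..
  also have "(r - j) + (l - j') = r + l - j - j'" using True by auto
  also have "x + real (r + l - j - j') + 1 = real r + real l + 2 * \<delta> + \<theta> + 1"
    using True by (simp add: x_def of_nat_diff)
  finally show ?thesis unfolding beta_kernel_def x_def by (simp only: mult.assoc)
next
  case False
  have "b_abs t1 r * b_abs t2 l / (\<theta> + real t1 + real t2 + 2 * \<delta>) * (b j t1 * b j' t2) = 0"
    if "t1 \<le> r" "t2 \<le> l" for t1 t2
    using False that by (auto simp: b_coeff_eq_0)
  then have "(\<Sum>t1=m..r. \<Sum>t2=m..l. b_abs t1 r * b_abs t2 l / (\<theta> + real t1 + real t2 + 2 * \<delta>) * (b j t1 * b j' t2)) = 0"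
    by (intro sum.neutral ballI) auto
  then show ?thesis using False by (auto simp: beta_kernel_def b_abs_eq_0)
qed

lemma sign_b: "(-1) ^ r * b j r = (-1) ^ j * b_abs j r"
proof (cases "j \<le> r")
  case True
  then have "(-1::real) ^ r = (-1) ^ (r - j) * (-1) ^ j" by (simp flip: power_add)
  then show ?thesis by (simp add: b_abs_def)
qed (simp add: b_abs_eq_0 b_coeff_eq_0)

text \<open>Translates a term of \<open>R_Z\<close>, with its global sign and Gamma prefactor, into
  a kernel: passing from \<open>b\<close> to \<open>b_abs\<close> leaves just the sign
  \<open>(-1) ^ (j + j')\<close>.\<close>

lemma sign_beta_kernel:
  assumes "y = real j + real j' + 2 * \<delta> + \<theta>" "n = r + l - j - j'"
  shows "(-1) ^ (r + l) / Gamma (real r + real l + 2 * \<delta> + \<theta> + 1) * (b j r * b j' l * Gamma y * fact n)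
    = (-1) ^ (j + j') * beta_kernel r l j j'"
proof -
  have "(-1) ^ (r + l) / Gamma (real r + real l + 2 * \<delta> + \<theta> + 1) * (b j r * b j' l * Gamma y * fact n)
      = ((-1) ^ r * b j r) * ((-1) ^ l * b j' l) * (fact n * Gamma y / Gamma (real r + real l + 2 * \<delta> + \<theta> + 1))"
    by (simp add: power_add mult_ac)
  then show ?thesis unfolding sign_b beta_kernel_def assms by (simp add: power_add mult_ac)
qed

text \<open>What \<open>U_t\<close> gains when an edge is attached to a vertex of degree q.\<close>

definition b_diff :: "nat \<Rightarrow> nat \<Rightarrow> real" where
  "b_diff q t = b (Suc q) t - b q t"

lemma degree_b_diff: "(real q + \<delta>) * b_diff q t = - (real t + \<delta>) * b q t"
  unfolding b_diff_def by (rule b_coeff_diff)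

lemma b_diff_eq_0: "t < q \<Longrightarrow> b_diff q t = 0"
  by (simp add: b_diff_def b_coeff_eq_0)

text \<open>The covariance of the increments of \<open>U\<^sub>t\<^sub>1\<close> and \<open>U\<^sub>t\<^sub>2\<close> over one edge, in the limit.\<close>

definition Q_lim :: "nat \<Rightarrow> nat \<Rightarrow> real" where
  "Q_lim t1 t2 = (\<Sum>q=m..t1. (real q + \<delta>) * p q * (b_diff q t1 * b_diff q t2)) / (2 * real m + \<delta>)
     - (real t1 + \<delta>) * (real t2 + \<delta>) * (c_lim t1 * c_lim t2) / (2 * real m + \<delta>)\<^sup>2"

lemma has_sum_atLeast_finite:
  fixes f :: "nat \<Rightarrow> real"
  assumes "\<And>q. t < q \<Longrightarrow> f q = 0"
  shows "(f has_sum (\<Sum>q=m..t. f q)) {m..}"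
proof -
  have "(f has_sum (\<Sum>q=m..t. f q)) {m..t}" by (rule has_sum_finite) simp
  then show ?thesis
    by (rule has_sum_cong_neutral[THEN iffD1, rotated -1]) (use assms in auto)
qed

lemma has_sum_degree_p_b_diff:
  assumes "m \<le> t"
  shows "((\<lambda>q. (real q + \<delta>) * p q * b_diff q t) has_sum - (real t + \<delta>) * c_lim t) {m..}"
proof -
  have "((\<lambda>q. (real q + \<delta>) * p q * b_diff q t) has_sum (\<Sum>q=m..t. (real q + \<delta>) * p q * b_diff q t)) {m..}"
    by (rule has_sum_atLeast_finite) (simp add: b_diff_eq_0)
  also have "(\<Sum>q=m..t. (real q + \<delta>) * p q * b_diff q t) = (\<Sum>q=m..t. - (real t + \<delta>) * (b q t * p q))"
  proof (intro sum.cong refl)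
    fix q
    have "(real q + \<delta>) * p q * b_diff q t = ((real q + \<delta>) * b_diff q t) * p q" by simp
    then show "(real q + \<delta>) * p q * b_diff q t = - (real t + \<delta>) * (b q t * p q)"
      unfolding degree_b_diff by simp
  qed
  also have "\<dots> = - (real t + \<delta>) * c_lim t"
    unfolding sum_distrib_left[symmetric] sum_b_p[OF assms] ..
  finally show ?thesis .
qed

text \<open>This is the coefficient of the pair \<open>t1\<close>, \<open>t2\<close> in
  \<open>R_Z\<close> once the sum over q is carried out. Put
  \<open>v = (t + \<delta>) / (t + \<delta> + \<theta>)\<close>. Then
  \<open>t + 2 + \<delta> - t / m\<close> divided by \<open>t + \<delta> + \<theta>\<close> is
  \<open>1 - v / m\<close>, the terms linear in v cancel, and the quadratic ones have the weights
  \<open>1 / m^2\<close> and \<open>(m - 1) / m^2\<close>, which add up to the \<open>1 / m\<close>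
  coming from \<open>Q_lim\<close>.\<close>

lemma covariance_term:
  fixes t1 t2 :: nat
  assumes "m \<le> t1" "m \<le> t2"
  defines "x1 \<equiv> real t1 + \<delta> + \<theta>" and "x2 \<equiv> real t2 + \<delta> + \<theta>"
  shows "(2 * real m + \<delta>) * (b m t1 * b m t2) / real m
       + 1 / real m * (b m t1 * (- (real t2 + \<delta>) * c_lim t2) + (- (real t1 + \<delta>) * c_lim t1) * b m t2)
       + (\<Sum>q=m..t1. (real q + \<delta>) * p q * (b_diff q t1 * b_diff q t2))
       - (2 * real m + \<delta>) / real m * (b m t1 * b m t2)
           * ((real t1 + 2 + \<delta> - real t1 / real m) * (real t2 + 2 + \<delta> - real t2 / real m) / (x1 * x2))
       - (2 * real m + \<delta>) * (real m - 1) / (real m) ^ 3 * (b m t1 * b m t2)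
           * ((\<delta> + real t1) * (\<delta> + real t2) / (x1 * x2))
       = (2 * real m + \<delta>) * Q_lim t1 t2"
proof -
  define u1 u2 B where "u1 = real t1 + \<delta>" and "u2 = real t2 + \<delta>" and "B = b m t1 * b m t2"
  define \<mu> where "\<mu> = real m"
  have "\<mu> > 0" using m_pos by (simp add: \<mu>_def)
  have x: "x1 > 0" "x2 > 0" "u1 = x1 - \<theta>" "u2 = x2 - \<theta>"
    using plus_delta_pos[of t1] plus_delta_pos[of t2] theta_gt_1 assms by (auto simp: u1_def u2_def)
  define S where "S = (\<Sum>q=m..t1. (real q + \<delta>) * p q * (b_diff q t1 * b_diff q t2))"
  have "c_lim t1 = b m t1 * \<theta> / x1" "c_lim t2 = b m t2 * \<theta> / x2"
    by (simp_all add: c_lim_def x1_def x2_def)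
  then have c: "b m t1 * (- u2 * c_lim t2) = - u2 * (B * \<theta> / x2)" "(- u1 * c_lim t1) * b m t2 = - u1 * (B * \<theta> / x1)"
    "c_lim t1 * c_lim t2 = B * \<theta>\<^sup>2 / (x1 * x2)"
    by (simp_all add: B_def power2_eq_square)
  have mt: "2 * real m + \<delta> = \<mu> * \<theta>" using m_theta by (simp add: \<mu>_def)
  have y: "real t1 + 2 + \<delta> - real t1 / real m = x1 - u1 / \<mu>"
          "real t2 + 2 + \<delta> - real t2 / real m = x2 - u2 / \<mu>"
    using \<open>\<mu> > 0\<close> by (simp_all add: x1_def x2_def u1_def u2_def \<theta>_def \<mu>_def field_simps)
  have "\<theta> > 0" using theta_gt_1 by simp
  have "\<mu> * \<theta> * B / \<mu> + 1 / \<mu> * (- u2 * (B * \<theta> / x2) + - u1 * (B * \<theta> / x1))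
      - \<mu> * \<theta> / \<mu> * B * ((x1 - u1 / \<mu>) * (x2 - u2 / \<mu>) / (x1 * x2))
      - \<mu> * \<theta> * (\<mu> - 1) / \<mu> ^ 3 * B * (u1 * u2 / (x1 * x2))
      = - (\<mu> * \<theta>) * (u1 * u2 * (B * \<theta>\<^sup>2 / (x1 * x2)) / (\<mu> * \<theta>)\<^sup>2)"
    using \<open>\<mu> > 0\<close> \<open>\<theta> > 0\<close> \<open>x1 > 0\<close> \<open>x2 > 0\<close>
    by (simp add: field_simps power2_eq_square power3_eq_cube)
  moreover have "(2 * real m + \<delta>) * Q_lim t1 t2 = S - (\<mu> * \<theta>) * (u1 * u2 * (B * \<theta>\<^sup>2 / (x1 * x2)) / (\<mu> * \<theta>)\<^sup>2)"
    unfolding Q_lim_def mt S_def[symmetric] u1_def[symmetric] u2_def[symmetric] c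
    using \<open>\<mu> > 0\<close> \<open>\<theta> > 0\<close> by (simp add: right_diff_distrib)
  moreover have "A1 + A2 + s - A3 - A4 = z" if "A1 + A2 - A3 - A4 = - k * w" "z = s - k * w"
    for A1 A2 A3 A4 s z k w :: real
    using that by simp
  ultimately show ?thesis
    unfolding mt y unfolding \<mu>_def[symmetric] add.commute[of \<delta>] u1_def[symmetric] u2_def[symmetric] c
      B_def[symmetric] S_def[symmetric] by blast
qed

text \<open>The covariance of the Gaussian limit of the \<open>U_t\<close>, scaled by
  \<open>sqrt s\<close>. The recursion with source \<open>Q_lim\<close> and multiplier about
  \<open>1 - (t1 + t2 + 2 \<delta>) / (\<theta> n)\<close> has slope
  \<open>\<theta> Q_lim / (\<theta> + t1 + t2 + 2 \<delta>)\<close> per step; a vertex has m steps,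
  and \<open>m \<theta> = 2 m + \<delta>\<close>.\<close>

definition cov_U :: "nat \<Rightarrow> nat \<Rightarrow> real" where
  "cov_U t1 t2 = (2 * real m + \<delta>) * Q_lim t1 t2 / (\<theta> + real t1 + real t2 + 2 * \<delta>)"

lemma b_abs_mult_b_m:
  assumes "m \<le> t" "t \<le> l"
  shows "b_abs t l * b m t = (-1) ^ t * (-1) ^ m * Gamma (real l + \<delta>) / (Gamma (real m + \<delta>) * (fact (t - m) * fact (l - t)))"
proof -
  have "(-1::real) ^ t = (-1) ^ (t - m) * (-1) ^ m" using assms by (simp flip: power_add)
  then have sign: "(-1::real) ^ (t - m) = (-1) ^ t * (-1) ^ m" by simp
  have "b m t = (-1) ^ (t - m) * b_abs m t" by (simp add: b_abs_def)
  then have "b_abs t l * b m t = (-1) ^ (t - m) * (b_abs t l * b_abs m t)" by simp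
  also have "b_abs t l * b_abs m t = Gamma (real l + \<delta>) / (Gamma (real m + \<delta>) * (fact (t - m) * fact (l - t)))"
    using assms Gamma_plus_delta_pos[of t] by (simp add: b_abs_Gamma)
  finally show ?thesis unfolding sign by simp
qed

text \<open>Substituting \<open>b (Suc q) - b q\<close> for \<open>b_diff q\<close> splits the right
  side into nine products, each of which is a kernel. The sign \<open>(-1) ^ (j + j')\<close> of the
  kernels converts the alternating signs of \<open>R_Z\<close> into those of the
  differences.\<close>

lemma covariance_summand:
  fixes r l q :: nat
  assumes "m \<le> q"
  defines "y \<equiv> \<lambda>j j'. b j l * b j' r * Gamma (real j + real j' + 2 * \<delta> + \<theta>) * fact (l + r - j - j')"
  shows "(-1) ^ (r + l) / Gamma (real l + real r + 2 * \<delta> + \<theta> + 1) *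
      (y m m / real m + (-1) ^ (m + q + 1) / real m * (y m q + y q m)
       + (-1) ^ (m + q + 1) / real m * (y m (Suc q) + y (Suc q) m)
       + y q q + (y q (Suc q) + y (Suc q) q) + y (Suc q) (Suc q))
    = (\<Sum>t1=m..l. \<Sum>t2=m..r. b_abs t1 l * b_abs t2 r / (\<theta> + real t1 + real t2 + 2 * \<delta>) *
         (b m t1 * b m t2 / real m + 1 / real m * (b m t1 * b_diff q t2 + b_diff q t1 * b m t2)
          + b_diff q t1 * b_diff q t2))"
proof -
  let ?tm = "\<lambda>t1 t2. (b m t1 * b m t2 / real m + 1 / real m * (b m t1 * b_diff q t2 + b_diff q t1 * b m t2)
       + b_diff q t1 * b_diff q t2)"
  define pre where "pre = (-1) ^ (r + l) / Gamma (real l + real r + 2 * \<delta> + \<theta> + 1)"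
  define K where "K = beta_kernel l r"
  define W where "W t1 t2 = b_abs t1 l * b_abs t2 r / (\<theta> + real t1 + real t2 + 2 * \<delta>)" for t1 t2
  have K: "K j j' = (\<Sum>t1=m..l. \<Sum>t2=m..r. W t1 t2 * (b j t1 * b j' t2))" if "m \<le> j" "m \<le> j'" for j j'
    unfolding K_def W_def by (rule beta_kernel_expansion[OF that, symmetric])
  have y: "pre * y j j' = (-1) ^ (j + j') * K j j'" for j j'
    unfolding pre_def y_def K_def using sign_beta_kernel[OF refl refl, of l r j j'] by (simp only: add.commute[of r l])
  have "pre * (y m m / real m + (-1) ^ (m + q + 1) / real m * (y m q + y q m)
       + (-1) ^ (m + q + 1) / real m * (y m (Suc q) + y (Suc q) m)
       + y q q + (y q (Suc q) + y (Suc q) q) + y (Suc q) (Suc q))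
     = pre * y m m / real m + (-1) ^ (m + q + 1) / real m * (pre * y m q + pre * y q m)
       + (-1) ^ (m + q + 1) / real m * (pre * y m (Suc q) + pre * y (Suc q) m)
       + pre * y q q + (pre * y q (Suc q) + pre * y (Suc q) q) + pre * y (Suc q) (Suc q)"
  proof -
    have "k * (a / \<mu> + s / \<mu> * (b1 + b2) + s / \<mu> * (c1 + c2) + d + (e1 + e2) + f)
        = k * a / \<mu> + s / \<mu> * (k * b1 + k * b2) + s / \<mu> * (k * c1 + k * c2) + k * d + (k * e1 + k * e2) + k * f"
      for k a \<mu> s b1 b2 c1 c2 d e1 e2 f :: real
      by (simp add: algebra_simps add_divide_distrib)
    then show ?thesis .
  qed
  also have "\<dots> = 1 / real m * K m m - 1 / real m * K m q - 1 / real m * K q m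
       + 1 / real m * K m (Suc q) + 1 / real m * K (Suc q) m
       + K q q - K q (Suc q) - K (Suc q) q + K (Suc q) (Suc q)"
  proof -
    have sq: "(-1::real) ^ n * (-1) ^ n = 1" for n by (simp flip: power_add)
    have s: "(-1::real) ^ (m + q + 1) / real m * ((-1) ^ (m + q) * a + (-1) ^ (q + m) * a') = - (1 / real m * a) - 1 / real m * a'"
            "(-1::real) ^ (m + q + 1) / real m * ((-1) ^ (m + Suc q) * a + (-1) ^ (Suc q + m) * a') = 1 / real m * a + 1 / real m * a'" for a a'
      using sq[of m] sq[of q] by (cases "even m"; cases "even q"; simp add: add_divide_distrib diff_divide_distrib)+
    show ?thesis unfolding y s by simp
  qed
  also have "\<dots> = (\<Sum>t1=m..l. \<Sum>t2=m..r. W t1 t2 *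
         ?tm t1 t2)"
  proof -
    have "W t1 t2 * ?tm t1 t2
      = 1 / real m * (W t1 t2 * (b m t1 * b m t2)) - 1 / real m * (W t1 t2 * (b m t1 * b q t2))
        - 1 / real m * (W t1 t2 * (b q t1 * b m t2)) + 1 / real m * (W t1 t2 * (b m t1 * b (Suc q) t2))
        + 1 / real m * (W t1 t2 * (b (Suc q) t1 * b m t2)) + W t1 t2 * (b q t1 * b q t2)
        - W t1 t2 * (b q t1 * b (Suc q) t2) - W t1 t2 * (b (Suc q) t1 * b q t2)
        + W t1 t2 * (b (Suc q) t1 * b (Suc q) t2)" for t1 t2
    proof -
      define i where "i = 1 / real m"
      have "x / real m = i * x" for x by (simp add: i_def)
      then show ?thesis unfolding b_diff_def i_def[symmetric] by (simp add: algebra_simps)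
    qed
    then show ?thesis
      using assms(1) by (simp only: K le_refl le_SucI sum.distrib sum_subtractf sum_distrib_left)
  qed
  finally show ?thesis unfolding pre_def W_def .
qed

text \<open>All three parts of \<open>R_Z\<close> are brought to double sums with the same weights
  \<open>W t1 t2\<close>, and \<open>covariance_term\<close> collapses the bracket. So
  \<open>R_Z\<close> is \<open>cov_U\<close> transformed by the change of basis from the
  \<open>U_t\<close> back to the \<open>N_k\<close>.\<close>

lemma R_Z_eq:
  assumes "m \<le> r" "m \<le> l"
  shows "R_Z m \<delta> r l = (\<Sum>t1=m..l. \<Sum>t2=m..r. b_abs t1 l * b_abs t2 r * cov_U t1 t2)"
proof -
  let ?F = "\<lambda>t1 t2. (2 * real m + \<delta>) * (b m t1 * b m t2) / real m
       + 1 / real m * (b m t1 * (- (real t2 + \<delta>) * c_lim t2) + (- (real t1 + \<delta>) * c_lim t1) * b m t2)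
       + (\<Sum>q=m..t1. (real q + \<delta>) * p q * (b_diff q t1 * b_diff q t2))"
  let ?d = "\<lambda>t1 t2. (fact (t1 - m) * fact (t2 - m) * fact (l - t1) * fact (r - t2)
       * (real t1 + 2 + \<delta> + \<delta> / real m) * (real t2 + 2 + \<delta> + \<delta> / real m))"
  let ?i = "\<lambda>t1 t2. inverse (real m * (real t1 + real t2) + 2 * real m * (\<delta> + 1) + \<delta>)"
  define W where "W t1 t2 = b_abs t1 l * b_abs t2 r / (\<theta> + real t1 + real t2 + 2 * \<delta>)" for t1 t2
  define y where "y j j' = b j l * b j' r * Gamma (real j + real j' + 2 * \<delta> + \<theta>) * fact (l + r - j - j')" for j j'
  define pre where "pre = (-1) ^ (r + l) / Gamma (real l + real r + 2 * \<delta> + \<theta> + 1)"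
  define E where "E q = (b m l * b m r / m * Gamma (2 * (m + \<delta> + 1) + \<delta> / m) * fact (l + r - 2 * m)
        + (-1) ^ (m + q + 1) / m * (b m l * b q r + b m r * b q l)
            * Gamma (m + q + 2 * (\<delta> + 1) + \<delta> / m) * fact (l + r - q - m)
        + (-1) ^ (m + q + 1) / m * (b m l * b (q + 1) r + b m r * b (q + 1) l)
            * Gamma (m + q + 1 + 2 * (\<delta> + 1) + \<delta> / m) * fact (l + r - m - q - 1)
        + b q l * b q r * Gamma (2 * q + 2 * (\<delta> + 1) + \<delta> / m) * fact (l + r - 2 * q)
        + (b q l * b (q + 1) r + b q r * b (q + 1) l)
            * Gamma (2 * q + 1 + 2 * (\<delta> + 1) + \<delta> / m) * fact (l + r - 2 * q - 1)
        + b (q + 1) l * b (q + 1) r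
            * Gamma (2 * (q + \<delta> + 2) + \<delta> / m) * fact (l + r - 2 * q - 2))" for q :: nat
  define term_q where "term_q q t1 t2 = b m t1 * b m t2 / real m
     + 1 / real m * (b m t1 * b_diff q t2 + b_diff q t1 * b m t2) + b_diff q t1 * b_diff q t2" for q t1 t2
  define c2 where "c2 t1 t2 = (real t1 + 2 + \<delta> - real t1 / real m) * (real t2 + 2 + \<delta> - real t2 / real m)
     / ((real t1 + \<delta> + \<theta>) * (real t2 + \<delta> + \<theta>))" for t1 t2
  define c3 where "c3 t1 t2 = (\<delta> + real t1) * (\<delta> + real t2)
     / ((real t1 + \<delta> + \<theta>) * (real t2 + \<delta> + \<theta>))" for t1 t2
  let ?g2 = "\<lambda>t1 t2. (2 * real m + \<delta>) / real m * (b m t1 * b m t2) * c2 t1 t2"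
  let ?g3 = "\<lambda>t1 t2. (2 * real m + \<delta>) * (real m - 1) / (real m) ^ 3 * (b m t1 * b m t2) * c3 t1 t2"
  have E: "E q = y m m / real m + (-1) ^ (m + q + 1) / real m * (y m q + y q m)
       + (-1) ^ (m + q + 1) / real m * (y m (Suc q) + y (Suc q) m)
       + y q q + (y q (Suc q) + y (Suc q) q) + y (Suc q) (Suc q)" for q
  proof -
    have G: "2 * (real m + \<delta> + 1) + \<delta> / real m = real m + real m + 2 * \<delta> + \<theta>"
      "real (m + q) + 2 * (\<delta> + 1) + \<delta> / real m = real m + real q + 2 * \<delta> + \<theta>"
      "real (m + q + 1) + 2 * (\<delta> + 1) + \<delta> / real m = real m + real (Suc q) + 2 * \<delta> + \<theta>"
      "real (2 * q) + 2 * (\<delta> + 1) + \<delta> / real m = real q + real q + 2 * \<delta> + \<theta>"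
      "real (2 * q + 1) + 2 * (\<delta> + 1) + \<delta> / real m = real q + real (Suc q) + 2 * \<delta> + \<theta>"
      "2 * (real q + \<delta> + 2) + \<delta> / real m = real (Suc q) + real (Suc q) + 2 * \<delta> + \<theta>"
      by (simp_all add: \<theta>_def)
    have F: "l + r - 2 * m = l + r - m - m" "l + r - m - q - 1 = l + r - m - Suc q"
      "l + r - 2 * q = l + r - q - q" "l + r - 2 * q - 1 = l + r - q - Suc q"
      "l + r - 2 * q - 2 = l + r - Suc q - Suc q"
      by simp_all
    have S: "y q m = b q l * b m r * Gamma (real m + real q + 2 * \<delta> + \<theta>) * fact (l + r - q - m)"
      "y m q = b m l * b q r * Gamma (real m + real q + 2 * \<delta> + \<theta>) * fact (l + r - q - m)"
      "y (Suc q) m = b (Suc q) l * b m r * Gamma (real m + real (Suc q) + 2 * \<delta> + \<theta>) * fact (l + r - m - Suc q)"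
      "y (Suc q) q = b (Suc q) l * b q r * Gamma (real q + real (Suc q) + 2 * \<delta> + \<theta>) * fact (l + r - q - Suc q)"
      unfolding y_def by (simp_all only: add.commute[of "real q" "real m"] add.commute[of "real (Suc q)" "real m"]
          add.commute[of "real (Suc q)" "real q"] diff_diff_left add.commute[of m q] add.commute[of "Suc q" m] add.commute[of "Suc q" q])
    have S': "y m (Suc q) = b m l * b (Suc q) r * Gamma (real m + real (Suc q) + 2 * \<delta> + \<theta>) * fact (l + r - m - Suc q)"
      "y q (Suc q) = b q l * b (Suc q) r * Gamma (real q + real (Suc q) + 2 * \<delta> + \<theta>) * fact (l + r - q - Suc q)"
      "y q q = b q l * b q r * Gamma (real q + real q + 2 * \<delta> + \<theta>) * fact (l + r - q - q)"
      "y m m = b m l * b m r * Gamma (real m + real m + 2 * \<delta> + \<theta>) * fact (l + r - m - m)"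
      "y (Suc q) (Suc q) = b (Suc q) l * b (Suc q) r * Gamma (real (Suc q) + real (Suc q) + 2 * \<delta> + \<theta>) * fact (l + r - Suc q - Suc q)"
      unfolding y_def by (rule refl)+
    show ?thesis unfolding E_def G F(2,4,5) unfolding F(1,3) S S' Suc_eq_plus1[symmetric]
      by (simp only: distrib_left distrib_right add_divide_distrib mult_ac times_divide_eq_left times_divide_eq_right)
  qed
  have pre_E: "pre * E q = (\<Sum>t1=m..l. \<Sum>t2=m..r. W t1 t2 * term_q q t1 t2)" if "m \<le> q" for q
    unfolding E pre_def W_def term_q_def y_def by (rule covariance_summand[OF that])
  \<comment> \<open>Three kinds of terms: \<open>has_sum_degree_p\<close> covers the product free of
    q, \<open>has_sum_degree_p_b_diff\<close> the mixed ones, and the product of two differences is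
    a finite sum.\<close>
  have hs: "((\<lambda>q. (real q + \<delta>) * p q * term_q q t1 t2) has_sum
      (?F t1 t2)) {m..}"
    if "m \<le> t1" "m \<le> t2" for t1 t2
  proof -
    have "((\<lambda>q. (b m t1 * b m t2 / real m) * ((real q + \<delta>) * p q)
       + (b m t1 / real m * ((real q + \<delta>) * p q * b_diff q t2) + b m t2 / real m * ((real q + \<delta>) * p q * b_diff q t1))
       + (real q + \<delta>) * p q * (b_diff q t1 * b_diff q t2)) has_sum
       ((b m t1 * b m t2 / real m) * (2 * real m + \<delta>)
       + (b m t1 / real m * (- (real t2 + \<delta>) * c_lim t2) + b m t2 / real m * (- (real t1 + \<delta>) * c_lim t1))
       + (\<Sum>q=m..t1. (real q + \<delta>) * p q * (b_diff q t1 * b_diff q t2)))) {m..}"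
      by (intro has_sum_add has_sum_cmult_right has_sum_degree_p has_sum_degree_p_b_diff that has_sum_atLeast_finite)
         (simp add: b_diff_eq_0)
    then show ?thesis unfolding term_q_def by (simp add: algebra_simps)
  qed
  \<comment> \<open>The summation over q is exchanged with the finite sums over \<open>t1\<close>
    and \<open>t2\<close>.\<close>
  have hs_sum: "((\<lambda>q. pre * ((real q + \<delta>) * p q * E q)) has_sum
      (\<Sum>t1=m..l. \<Sum>t2=m..r. W t1 t2 * (?F t1 t2))) {m..}"
  proof -
    have fin: "((\<lambda>q. \<Sum>t\<in>T. f t q) has_sum (\<Sum>t\<in>T. g t)) {m..}"
      if "finite T" "\<And>t. t \<in> T \<Longrightarrow> ((\<lambda>q. f t q) has_sum g t) {m..}" for T and f :: "nat \<Rightarrow> nat \<Rightarrow> real" and g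
      using that by (induction T rule: finite_induct) (auto intro: has_sum_add)
    have "((\<lambda>q. \<Sum>t1=m..l. \<Sum>t2=m..r. W t1 t2 * ((real q + \<delta>) * p q * term_q q t1 t2)) has_sum
      (\<Sum>t1=m..l. \<Sum>t2=m..r. W t1 t2 * (?F t1 t2))) {m..}"
      by (intro fin has_sum_cmult_right hs) auto
    moreover have "(\<Sum>t1=m..l. \<Sum>t2=m..r. W t1 t2 * ((real q + \<delta>) * p q * term_q q t1 t2))
        = pre * ((real q + \<delta>) * p q * E q)" if "q \<in> {m..}" for q
    proof -
      have "pre * ((real q + \<delta>) * p q * E q) = (real q + \<delta>) * p q * (pre * E q)" by simp
      also have "\<dots> = (\<Sum>t1=m..l. \<Sum>t2=m..r. W t1 t2 * ((real q + \<delta>) * p q * term_q q t1 t2))"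
        using that by (simp add: pre_E sum_distrib_left mult_ac)
      finally show ?thesis by simp
    qed
    ultimately show ?thesis by (subst (asm) has_sum_cong) auto
  qed
  have part: "Gamma (real l + \<delta>) * Gamma (real r + \<delta>) / (Gamma (real m + \<delta>))\<^sup>2 *
        ((-1) ^ (t1 + t2) / (fact (t1 - m) * fact (t2 - m) * fact (l - t1) * fact (r - t2)))
      = (b_abs t1 l * b m t1) * (b_abs t2 r * b m t2)" if "t1 \<in> {m..l}" "t2 \<in> {m..r}" for t1 t2
  proof -
    have "(-1::real) ^ m * (-1) ^ m = 1" by (simp flip: power_add)
    then have sign: "(-1) ^ t1 * (-1) ^ m * ((-1) ^ t2 * (-1) ^ m) = (-1::real) ^ (t1 + t2)"
      by (simp add: power_add mult_ac)
    have e: "G * H / g\<^sup>2 * (s / (f1 * f2 * f3 * f4)) = (s1 * s2 * G / (g * (f1 * f3))) * (s3 * s2 * H / (g * (f2 * f4)))"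
      if "s1 * s2 * (s3 * s2) = s" for G H g s s1 s2 s3 f1 f2 f3 f4 :: real
      unfolding that[symmetric] by (simp add: power2_eq_square mult_ac)
    have t: "m \<le> t1" "t1 \<le> l" "m \<le> t2" "t2 \<le> r" using that by auto
    show ?thesis unfolding b_abs_mult_b_m[OF t(1,2)] b_abs_mult_b_m[OF t(3,4)] by (rule e[OF sign])
  qed
  \<comment> \<open>The bracket in \<open>R_Z\<close> is m times the denominator of
    \<open>cov_U\<close>; this factor accounts for the powers of m in \<open>?g2\<close> and
    \<open>?g3\<close>.\<close>
  have I: "?i t1 t2
      = 1 / real m * (1 / (\<theta> + real t1 + real t2 + 2 * \<delta>))" for t1 t2
  proof -
    have "real m * (real t1 + real t2) + 2 * real m * (\<delta> + 1) + \<delta> = real m * (\<theta> + real t1 + real t2 + 2 * \<delta>)"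
      using m_theta by (simp add: algebra_simps)
    then show ?thesis by (simp add: divide_inverse)
  qed
  have x: "real t + 2 + \<delta> + \<delta> / real m = real t + \<delta> + \<theta>" for t by (simp add: \<theta>_def)
  have part2: "(2 * real m + \<delta>) * Gamma (real l + \<delta>) * Gamma (real r + \<delta>) / (Gamma (real m + \<delta>))\<^sup>2 *
       (\<Sum>t1=m..l. \<Sum>t2=m..r. (-1) ^ (t1 + t2) *
          (?i t1 t2
             * (real t1 + 2 + \<delta> - real t1 / real m) * (real t2 + 2 + \<delta> - real t2 / real m))
          / ?d t1 t2)
     = (\<Sum>t1=m..l. \<Sum>t2=m..r. W t1 t2 * (?g2 t1 t2))"
    unfolding sum_distrib_left
  proof (intro sum.cong refl)
    fix t1 t2 assume t: "t1 \<in> {m..l}" "t2 \<in> {m..r}"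
    have e: "k * G * H / g * (s * (1 / mm * (1 / D) * y1 * y2) / (f1 * f2 * f3 * f4 * x1 * x2))
       = G * H / g * (s / (f1 * f2 * f3 * f4)) * (k / mm * (1 / D) * (y1 * y2 / (x1 * x2)))"
      for k G H g s mm D y1 y2 f1 f2 f3 f4 x1 x2 :: real by (simp add: mult_ac)
    show "(2 * real m + \<delta>) * Gamma (real l + \<delta>) * Gamma (real r + \<delta>) / (Gamma (real m + \<delta>))\<^sup>2 *
          ((-1) ^ (t1 + t2) * (?i t1 t2
             * (real t1 + 2 + \<delta> - real t1 / real m) * (real t2 + 2 + \<delta> - real t2 / real m))
          / ?d t1 t2)
        = W t1 t2 * (?g2 t1 t2)"
      unfolding I x e part[OF t] W_def c2_def by (simp add: mult_ac)
  qed
  have part3: "(2 * real m + \<delta>) * (real m - 1) * Gamma (real l + \<delta>) * Gamma (real r + \<delta>)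
         / ((real m)\<^sup>2 * (Gamma (real m + \<delta>))\<^sup>2) *
       (\<Sum>t1=m..l. \<Sum>t2=m..r. (-1) ^ (t1 + t2) *
          ((\<delta> + real t1) * (\<delta> + real t2) * ?i t1 t2)
          / ?d t1 t2)
     = (\<Sum>t1=m..l. \<Sum>t2=m..r. W t1 t2 * (?g3 t1 t2))"
    unfolding sum_distrib_left
  proof (intro sum.cong refl)
    fix t1 t2 assume t: "t1 \<in> {m..l}" "t2 \<in> {m..r}"
    have e: "k * k' * G * H / (mm\<^sup>2 * g) * (s * (u1 * u2 * (1 / mm * (1 / D))) / (f1 * f2 * f3 * f4 * x1 * x2))
       = G * H / g * (s / (f1 * f2 * f3 * f4)) * (k * k' / mm ^ 3 * (1 / D) * (u1 * u2 / (x1 * x2)))"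
      for k k' G H g s mm D u1 u2 f1 f2 f3 f4 x1 x2 :: real by (simp add: power2_eq_square power3_eq_cube mult_ac)
    show "(2 * real m + \<delta>) * (real m - 1) * Gamma (real l + \<delta>) * Gamma (real r + \<delta>)
         / ((real m)\<^sup>2 * (Gamma (real m + \<delta>))\<^sup>2) *
          ((-1) ^ (t1 + t2) * ((\<delta> + real t1) * (\<delta> + real t2)
            * ?i t1 t2)
          / ?d t1 t2)
        = W t1 t2 * (?g3 t1 t2)"
      unfolding I x e part[OF t] W_def c3_def by (simp add: mult_ac)
  qed
  have Gl: "real l + real r + 1 + 2 * (\<delta> + 1) + \<delta> / real m = real l + real r + 2 * \<delta> + \<theta> + 1"
    by (simp add: \<theta>_def)
  have "R_Z m \<delta> r l = pre * (\<Sum>\<^sub>\<infinity>q\<in>{m..}. (real q + \<delta>) * p q * E q)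
     - (\<Sum>t1=m..l. \<Sum>t2=m..r. W t1 t2 * (?g2 t1 t2))
     - (\<Sum>t1=m..l. \<Sum>t2=m..r. W t1 t2 * (?g3 t1 t2))"
    unfolding part2[symmetric] part3[symmetric] pre_def E_def Gl[symmetric] R_Z_def Let_def by simp
  also have "pre * (\<Sum>\<^sub>\<infinity>q\<in>{m..}. (real q + \<delta>) * p q * E q)
     = (\<Sum>t1=m..l. \<Sum>t2=m..r. W t1 t2 * (?F t1 t2))"
    unfolding infsum_cmult_right'[symmetric] by (rule infsumI[OF hs_sum])
  finally have "R_Z m \<delta> r l = (\<Sum>t1=m..l. \<Sum>t2=m..r. W t1 t2 * (
       ?F t1 t2
       - ?g2 t1 t2
       - ?g3 t1 t2))"
    by (simp only: sum_subtractf[symmetric] right_diff_distrib[symmetric])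
  also have "\<dots> = (\<Sum>t1=m..l. \<Sum>t2=m..r. W t1 t2 * ((2 * real m + \<delta>) * Q_lim t1 t2))"
    by (intro sum.cong refl) (simp only: c2_def c3_def covariance_term atLeastAtMost_iff)
  finally show ?thesis unfolding W_def cov_U_def by simp
qed

end

section \<open>Degrees along the attachment steps\<close>

context pa_params
begin

text \<open>
  The attachment steps are numbered consecutively: \<open>n = s * m + i\<close> with \<open>i < m\<close> stands for the graph
  after \<open>i\<close> edges of vertex \<open>s\<close>, and only the vertices \<open>{..<s}\<close> are taken into account.
\<close>

definition dg :: "(nat \<Rightarrow> nat \<Rightarrow> nat) \<Rightarrow> nat \<Rightarrow> nat \<Rightarrow> nat" where
  "dg W n v = vertex_degree (PA m W (n div m) (n mod m)) v"

text \<open>The target of the edge drawn between steps n and \<open>Suc n\<close>; hence the shift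
  in the second index.\<close>

definition tgt :: "(nat \<Rightarrow> nat \<Rightarrow> nat) \<Rightarrow> nat \<Rightarrow> nat" where
  "tgt W n = W (n div m) (Suc (n mod m))"

definition lin_stat :: "(nat \<Rightarrow> real) \<Rightarrow> (nat \<Rightarrow> nat \<Rightarrow> nat) \<Rightarrow> nat \<Rightarrow> real" where
  "lin_stat f W n = (\<Sum>v<n div m. f (dg W n v))"

text \<open>The normalising constant of the attachment rule for \<open>s = n div m\<close> and
  \<open>i - 1 = n mod m\<close> edges already drawn. Being deterministic, it makes the multipliers
  of all later recursions deterministic.\<close>

definition total_weight :: "nat \<Rightarrow> real" where
  "total_weight n = real (n div m) * (2 * real m + \<delta>) - 2 * real m + real (n mod m)"

text \<open>Satisfied by every outcome of the model, see \<open>valid_cfg\<close>, so the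
  combinatorial facts are proved path by path for a fixed array of targets.\<close>

definition valid_targets :: "(nat \<Rightarrow> nat \<Rightarrow> nat) \<Rightarrow> bool" where
  "valid_targets W \<longleftrightarrow> (\<forall>s\<ge>2. \<forall>j\<in>{1..m}. W s j < s)"

text \<open>In the case \<open>wrap\<close>, vertex \<open>n div m\<close> receives its last edge
  and is among the counted vertices from step \<open>Suc n\<close> on.\<close>

lemma step_cases:
  obtains (same) "Suc n mod m = Suc (n mod m)" "Suc n div m = n div m" "\<not> m dvd Suc n"
    | (wrap) "Suc n mod m = 0" "Suc n div m = Suc (n div m)" "Suc (n mod m) = m" "m dvd Suc n"
proof (cases "Suc (n mod m) = m")
  case True
  then have mod: "Suc n mod m = 0" by (simp add: mod_Suc)
  then have dvd: "m dvd Suc n" by auto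
  then have "Suc n div m = Suc (n div m)" using m_pos by (simp add: div_Suc)
  then show ?thesis using mod dvd True by (intro wrap)
next
  case False
  then have mod: "Suc n mod m = Suc (n mod m)" by (simp add: mod_Suc)
  then have dvd: "\<not> m dvd Suc n" by auto
  then have "Suc n div m = n div m" using mod by (simp add: div_Suc)
  then show ?thesis using mod dvd by (intro same)
qed

lemma div_m_ge: "2 * m \<le> n \<Longrightarrow> 2 \<le> n div m"
  using m_pos by (simp add: less_eq_div_iff_mult_less_eq)

lemma tgt_less: "valid_targets W \<Longrightarrow> 2 * m \<le> n \<Longrightarrow> tgt W n < n div m"
  using m_pos div_m_ge[of n] mod_less_divisor[of m n]
  unfolding valid_targets_def tgt_def by (auto simp: Suc_le_eq)

lemma vertex_degree_add_mset:
  "vertex_degree (add_mset (u, w) G) v = vertex_degree G v + (if v = u then 1 else 0) + (if v = w then 1 else 0)"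
  by (auto simp: vertex_degree_def)

text \<open>The point is the wrap: the multigraph with all m edges of a vertex is also the one
  before the first edge of its successor.\<close>

lemma dg_Suc:
  assumes "2 * m \<le> n"
  shows "dg W (Suc n) v = dg W n v + (if v = n div m then 1 else 0) + (if v = tgt W n then 1 else 0)"
proof -
  obtain s where s: "n div m = Suc (Suc s)"
    using div_m_ge[OF assms] by (metis add_2_eq_Suc le_Suc_ex)
  have PA: "PA m W (n div m) (Suc (n mod m)) = add_mset (n div m, tgt W n) (PA m W (n div m) (n mod m))"
    by (simp add: s tgt_def)
  have "PA m W (Suc n div m) (Suc n mod m) = PA m W (n div m) (Suc (n mod m))"
    by (cases n rule: step_cases) (simp_all add: s)
  then show ?thesis unfolding dg_def by (simp only: PA vertex_degree_add_mset)
qed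

lemma dg_init: "n < 2 * m \<Longrightarrow> dg W n v = (if n div m = 1 \<and> v < 2 then m else 0)"
proof -
  assume "n < 2 * m"
  then have "n div m < 2" by (simp add: less_mult_imp_div_less)
  then consider "n div m = 0" | "n div m = Suc 0" by linarith
  then show ?thesis
  proof cases
    case 2
    have "filter_mset P (replicate_mset k x) = (if P x then replicate_mset k x else {#})" for P k and x :: "nat \<times> nat"
      by (induction k) auto
    with 2 show ?thesis by (auto simp: dg_def vertex_degree_def less_2_cases_iff)
  qed (simp add: dg_def vertex_degree_def)
qed

lemma dg_2m: "dg W (2 * m) v = (if v < 2 then m else 0)"
proof -
  have "dg W (2 * m) v = vertex_degree (PA m W (Suc 0) m) v"
    using m_pos by (simp add: dg_def numeral_2_eq_2)
  also have "\<dots> = dg W m v" using m_pos by (simp add: dg_def)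
  also have "\<dots> = (if v < 2 then m else 0)" using m_pos by (subst dg_init) auto
  finally show ?thesis .
qed

lemma dg_new_vertices:
  assumes "valid_targets W" "2 * m \<le> n" "n div m \<le> v"
  shows "dg W n v = (if v = n div m then n mod m else 0)"
  using assms(2,3)
proof (induction n arbitrary: v rule: dec_induct)
  case base
  then show ?case using m_pos by (simp add: dg_2m)
next
  case (step n)
  have t: "tgt W n < n div m" by (rule tgt_less[OF assms(1) step.hyps(1)])
  show ?case
    using step.prems t by (cases n rule: step_cases) (simp_all add: dg_Suc[OF step.hyps(1)] step.IH)
qed

text \<open>A vertex is counted only after its m edges have been drawn. This confines all sums over
  degrees to the range where \<open>k + \<delta>\<close> is positive and \<open>b_inversion\<close>
  applies.\<close>

lemma dg_ge_m:
  assumes "valid_targets W" "2 * m \<le> n" "v < n div m"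
  shows "m \<le> dg W n v"
  using assms(2,3)
proof (induction n arbitrary: v rule: dec_induct)
  case base
  then show ?case using m_pos by (simp add: dg_2m)
next
  case (step n)
  show ?case
  proof (cases "v < n div m")
    case True
    then show ?thesis using step.IH[OF True] by (simp add: dg_Suc[OF step.hyps(1)])
  next
    case False
    with step.prems have "v = n div m" "Suc (n mod m) = m"
      by (cases n rule: step_cases; simp)+
    then show ?thesis
      using dg_new_vertices[OF assms(1) step.hyps(1), of v] by (simp add: dg_Suc[OF step.hyps(1)])
  qed
qed

text \<open>Among the counted vertices only the target changes its degree, by one; at a wrap the
  completed vertex joins with degree exactly m.\<close>

lemma lin_stat_Suc:
  assumes W: "valid_targets W" and n: "2 * m \<le> n"
  shows "lin_stat f W (Suc n) = lin_stat f W n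
     + (f (Suc (dg W n (tgt W n))) - f (dg W n (tgt W n))) + (if m dvd Suc n then f m else 0)"
proof -
  have t: "tgt W n < n div m" by (rule tgt_less[OF W n])
  have "f (dg W (Suc n) v) = f (dg W n v)
      + (if v = tgt W n then f (Suc (dg W n (tgt W n))) - f (dg W n (tgt W n)) else 0)" if "v < n div m" for v
    using that by (simp add: dg_Suc[OF n])
  then have old: "(\<Sum>v<n div m. f (dg W (Suc n) v)) = lin_stat f W n + (f (Suc (dg W n (tgt W n))) - f (dg W n (tgt W n)))"
    using t by (simp add: lin_stat_def sum.distrib)
  show ?thesis
  proof (cases n rule: step_cases)
    case same
    then show ?thesis using old by (simp add: lin_stat_def)
  next
    case wrap
    have "dg W (Suc n) (n div m) = m"
      using wrap t dg_new_vertices[OF W n, of "n div m"] by (simp add: dg_Suc[OF n])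
    then show ?thesis using old wrap by (simp add: lin_stat_def)
  qed
qed

lemma total_weight_Suc:
  "total_weight (Suc n) = total_weight n + 1 + (if m dvd Suc n then real m + \<delta> else 0)"
proof (cases n rule: step_cases)
  case wrap
  have "real (n mod m) = real m - 1" using wrap(3) by (metis add_diff_cancel_right' of_nat_Suc add.commute)
  then show ?thesis using wrap by (simp add: total_weight_def algebra_simps)
qed (simp add: total_weight_def)

text \<open>Apply \<open>lin_stat_Suc\<close> to \<open>f d = d + \<delta>\<close>: an edge adds 1
  and a completed vertex \<open>m + \<delta>\<close>, which is the recursion of
  \<open>total_weight\<close>.\<close>

lemma sum_weights:
  assumes "valid_targets W" "2 * m \<le> n"
  shows "(\<Sum>v<n div m. real (dg W n v) + \<delta>) = total_weight n"
proof -
  have "lin_stat (\<lambda>d. real d + \<delta>) W n = total_weight n"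
    using assms(2)
  proof (induction n rule: dec_induct)
    case base
    then show ?case using m_pos by (simp add: lin_stat_def dg_2m total_weight_def)
  next
    case (step n)
    then show ?case by (simp add: lin_stat_Suc[OF assms(1) step.hyps(1)] total_weight_Suc)
  qed
  then show ?thesis by (simp add: lin_stat_def)
qed

lemma total_weight_eq: "total_weight n = \<theta> * real n - (\<theta> - 1) * real (n mod m) - 2 * real m"
proof -
  have "real n = real (n div m) * real m + real (n mod m)"
    by (metis div_mult_mod_eq of_nat_add of_nat_mult)
  then have "\<theta> * real n = real (n div m) * (real m * \<theta>) + \<theta> * real (n mod m)"
    by (simp add: algebra_simps)
  then show ?thesis unfolding total_weight_def m_theta by (simp add: algebra_simps)
qed

lemma total_weight_pos: "2 * m \<le> n \<Longrightarrow> 0 < total_weight n"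
proof (induction n rule: dec_induct)
  case base
  have "total_weight (2 * m) = 2 * (real m + \<delta>)" using m_pos by (simp add: total_weight_def algebra_simps)
  then show ?case using plus_delta_pos[of m] by simp
next
  case (step n)
  then show ?case using plus_delta_pos[of m] by (simp add: total_weight_Suc)
qed

lemma total_weight_asymp: "(\<lambda>n. total_weight n / real n) \<longlonglongrightarrow> \<theta>"
proof -
  define C where "C = (\<theta> - 1) * real m + 2 * real m"
  have "(\<lambda>n. total_weight n / real n - \<theta>) \<longlonglongrightarrow> 0"
  proof (rule Lim_null_comparison)
    show "\<forall>\<^sub>F n in sequentially. norm (total_weight n / real n - \<theta>) \<le> C / real n"
      using eventually_gt_at_top[of 0]
    proof eventually_elim
      case (elim n)
      have "0 \<le> (\<theta> - 1) * real (n mod m)" using theta_gt_1 by simp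
      moreover have "(\<theta> - 1) * real (n mod m) \<le> (\<theta> - 1) * real m"
        using theta_gt_1 m_pos by (intro mult_left_mono) (auto intro: less_imp_le)
      ultimately have "\<bar>total_weight n - \<theta> * real n\<bar> \<le> C"
        unfolding total_weight_eq C_def by auto
      moreover have "total_weight n / real n - \<theta> = (total_weight n - \<theta> * real n) / real n"
        using elim by (simp add: field_simps)
      ultimately show ?case by (simp add: divide_right_mono)
    qed
    show "(\<lambda>n. C / real n) \<longlonglongrightarrow> 0" by (rule lim_const_over_n)
  qed
  then show ?thesis by (simp add: Lim_null[symmetric])
qed

lemma inverse_total_weight_asymp: "(\<lambda>n. real n / total_weight n) \<longlonglongrightarrow> 1 / \<theta>"
  using tendsto_inverse[OF total_weight_asymp] theta_gt_1 by (simp add: inverse_eq_divide)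

text \<open>For \<open>i = m\<close> the step number is \<open>Suc s * m\<close>, where vertex s is
  counted too; this agrees with the case distinction in \<open>deg_count\<close>.\<close>

lemma deg_count_eq:
  assumes "2 \<le> s" "i \<le> m"
  shows "real (deg_count m W k s i) = lin_stat (\<lambda>d. of_bool (d = k)) W (s * m + i)"
proof -
  have G: "PA m W ((s * m + i) div m) ((s * m + i) mod m) = PA m W s i"
    and V: "{..<(s * m + i) div m} = (if i = m then {..s} else {..<s})"
  proof -
    obtain s' where s': "s = Suc (Suc s')" using assms(1) by (metis add_2_eq_Suc le_Suc_ex)
    show "PA m W ((s * m + i) div m) ((s * m + i) mod m) = PA m W s i"
    proof (cases "i = m")
      case True
      have e: "s * m + m = Suc s * m" by simp
      show ?thesis unfolding True e using m_pos by (simp add: s')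
    next
      case False
      then show ?thesis using assms m_pos by simp
    qed
    show "{..<(s * m + i) div m} = (if i = m then {..s} else {..<s})"
    proof (cases "i = m")
      case True
      have e: "s * m + m = Suc s * m" by simp
      show ?thesis unfolding True e using m_pos by (simp add: lessThan_Suc_atMost)
    next
      case False
      then show ?thesis using assms m_pos by simp
    qed
  qed
  have fin: "finite (if i = m then {..s} else {..<s})" by simp
  show ?thesis
    unfolding lin_stat_def dg_def G V deg_count_def of_bool_def
    using fin by (simp add: sum.If_cases Int_def)
qed

section \<open>Linear statistics in the eigenbasis\<close>

definition U_stat :: "nat \<Rightarrow> (nat \<Rightarrow> nat \<Rightarrow> nat) \<Rightarrow> nat \<Rightarrow> real" where
  "U_stat t = lin_stat (\<lambda>d. b d t)"

text \<open>\<open>b_inversion\<close> is applied at every counted vertex, which is possible because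
  its degree is at least m.\<close>

lemma lin_stat_indicator_eq:
  assumes W: "valid_targets W" and n: "2 * m \<le> n"
  shows "lin_stat (\<lambda>d. of_bool (d = k)) W n = (\<Sum>t=m..k. b_abs t k * U_stat t W n)"
proof -
  have "(\<Sum>t=m..k. b_abs t k * U_stat t W n) = (\<Sum>v<n div m. \<Sum>t=m..k. b_abs t k * b (dg W n v) t)"
    unfolding U_stat_def lin_stat_def sum_distrib_left by (rule sum.swap)
  also have "\<dots> = (\<Sum>v<n div m. of_bool (dg W n v = k))"
    using dg_ge_m[OF W n] by (intro sum.cong refl) (simp add: b_inversion)
  finally show ?thesis by (simp add: lin_stat_def)
qed

lemma lin_stat_bound:
  assumes "\<And>d. \<bar>f d\<bar> \<le> B"
  shows "\<bar>lin_stat f W n\<bar> \<le> B * real n"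
proof -
  have "B \<ge> 0" using assms[of 0] by linarith
  have "\<bar>lin_stat f W n\<bar> \<le> (\<Sum>v<n div m. B)"
    unfolding lin_stat_def by (rule order_trans[OF sum_abs]) (intro sum_mono assms)
  also have "\<dots> \<le> B * real n"
    using \<open>B \<ge> 0\<close> div_le_dividend[of n m] by (simp add: mult.commute mult_left_mono)
  finally show ?thesis .
qed

text \<open>Combined with \<open>lin_stat_indicator_eq\<close> this reduces statistics of finite
  support to the \<open>U_t\<close>; the conditional covariances are treated in this way.\<close>

lemma lin_stat_finite_support:
  assumes "valid_targets W" "2 * m \<le> n" and f: "\<And>d. K < d \<Longrightarrow> f d = 0"
  shows "lin_stat f W n = (\<Sum>k=m..K. f k * lin_stat (\<lambda>d. of_bool (d = k)) W n)"
proof -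
  have "(\<Sum>k=m..K. f k * lin_stat (\<lambda>d. of_bool (d = k)) W n) = (\<Sum>v<n div m. \<Sum>k=m..K. f k * of_bool (dg W n v = k))"
    unfolding lin_stat_def sum_distrib_left by (rule sum.swap)
  also have "\<dots> = (\<Sum>v<n div m. f (dg W n v))"
  proof (intro sum.cong refl)
    fix v assume "v \<in> {..<n div m}"
    then have "m \<le> dg W n v" using dg_ge_m[OF assms(1,2)] by simp
    then show "(\<Sum>k=m..K. f k * of_bool (dg W n v = k)) = f (dg W n v)"
      using f[of "dg W n v"] by (cases "dg W n v \<le> K") (auto simp: of_bool_def if_distrib cong: if_cong)
  qed
  finally show ?thesis by (simp add: lin_stat_def)
qed

end

section \<open>Conditional expectations\<close>

locale pa_model = preferential_attachment M m \<delta> V + pa_params m \<delta>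
  for M :: "'a measure" and m :: nat and \<delta> :: real and V :: "nat \<Rightarrow> nat \<Rightarrow> 'a \<Rightarrow> nat"
begin

definition cfg :: "'a \<Rightarrow> nat \<Rightarrow> nat \<Rightarrow> nat" where
  "cfg \<omega> = (\<lambda>t j. V t j \<omega>)"

text \<open>The information available before the edge of step n is drawn, that is
  \<open>F_{s,i-1}\<close> for \<open>n = s * m + (i - 1)\<close>.\<close>

definition past :: "nat \<Rightarrow> 'a measure" where
  "past n = history M m V (n div m) (n mod m)"

lemma valid_cfg: "\<omega> \<in> space M \<Longrightarrow> valid_targets (cfg \<omega>)"
  unfolding valid_targets_def cfg_def
  using measurable_space[OF target_measurable] by auto

text \<open>\<open>history\<close> is generated by preimages of arbitrary sets of naturals, whereas
  measurability is given into \<open>{..<s}\<close>; values outside do not occur.\<close>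

lemma target_vimage_sets:
  assumes "2 \<le> s" "i \<in> {1..m}"
  shows "V s i -` A \<inter> space M \<in> sets M"
proof -
  have "V s i -` A \<inter> space M = V s i -` (A \<inter> {..<s}) \<inter> space M"
    using measurable_space[OF target_measurable[OF assms]] by auto
  also have "\<dots> \<in> sets M"
    by (rule measurable_sets[OF target_measurable[OF assms]]) auto
  finally show ?thesis .
qed

lemma edges_upto_Suc:
  assumes "2 * m \<le> n"
  shows "edges_upto m (Suc n div m) (Suc n mod m)
    = insert (n div m, Suc (n mod m)) (edges_upto m (n div m) (n mod m))"
proof (cases n rule: step_cases)
  case same
  then show ?thesis by (auto simp: edges_upto_def)
next
  case wrap
  have "{2..<Suc (n div m)} = insert (n div m) {2..<n div m}"
    using div_m_ge[OF assms] by auto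
  moreover have "{1..m} = insert m {1..n mod m}" using wrap(3) m_pos by auto
  ultimately show ?thesis using wrap by (auto simp: edges_upto_def)
qed

lemma edges_upto_bounds: "2 * m \<le> n \<Longrightarrow> (t, j) \<in> edges_upto m (n div m) (n mod m) \<Longrightarrow> 2 \<le> t \<and> j \<in> {1..m}"
  using div_m_ge[of n] m_pos mod_le_divisor[of m n] by (auto simp: edges_upto_def simp del: mod_le_divisor)

lemma space_past [simp]: "space (past n) = space M"
  by (simp add: past_def history_def space_measure_of_conv)

lemma sets_past:
  "sets (past n) = sigma_sets (space M)
     (\<Union>(t, j)\<in>edges_upto m (n div m) (n mod m). {V t j -` A \<inter> space M | A. True})"
  unfolding past_def history_def by (rule sets_measure_of) auto

lemma subalgebra_past: "2 * m \<le> n \<Longrightarrow> subalgebra M (past n)"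
  unfolding subalgebra_def sets_past space_past
  by (intro conjI refl sets.sigma_sets_subset) (auto dest!: edges_upto_bounds intro: target_vimage_sets)

lemma sets_past_mono: "2 * m \<le> n \<Longrightarrow> sets (past n) \<subseteq> sets (past (Suc n))"
  unfolding sets_past by (rule sigma_sets_mono') (auto simp: edges_upto_Suc)

lemma measurable_past_Suc: "2 * m \<le> n \<Longrightarrow> f \<in> measurable (past n) N \<Longrightarrow> f \<in> measurable (past (Suc n)) N"
  using sets_past_mono by (auto simp: measurable_def)

lemma measurable_past: "2 * m \<le> n \<Longrightarrow> f \<in> measurable (past n) N \<Longrightarrow> f \<in> measurable M N"
  using measurable_from_subalg[OF subalgebra_past] .

lemma tgt_measurable_past:
  assumes "2 * m \<le> n"
  shows "(\<lambda>\<omega>. tgt (cfg \<omega>) n) \<in> measurable (past (Suc n)) (count_space UNIV)"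
  unfolding measurable_def space_past
proof (intro CollectI conjI ballI)
  fix A :: "nat set"
  have "V (n div m) (Suc (n mod m)) -` A \<inter> space M \<in> sets (past (Suc n))"
    unfolding sets_past edges_upto_Suc[OF assms] by (rule sigma_sets.Basic) auto
  then show "(\<lambda>\<omega>. tgt (cfg \<omega>) n) -` A \<inter> space M \<in> sets (past (Suc n))"
    by (simp add: tgt_def cfg_def vimage_def)
qed auto

lemma dg_measurable_past:
  assumes "2 * m \<le> n"
  shows "(\<lambda>\<omega>. dg (cfg \<omega>) n v) \<in> measurable (past n) (count_space UNIV)"
  using assms
proof (induction n rule: dec_induct)
  case base
  then show ?case by (simp add: dg_2m)
next
  case (step n)
  note [measurable] = measurable_past_Suc[OF step.hyps(1) step.IH] tgt_measurable_past[OF step.hyps(1)]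
  show ?case unfolding dg_Suc[OF step.hyps(1)] by measurable
qed

lemma lin_stat_measurable_past:
  assumes "2 * m \<le> n"
  shows "(\<lambda>\<omega>. lin_stat f (cfg \<omega>) n) \<in> borel_measurable (past n)"
proof -
  note [measurable] = dg_measurable_past[OF assms]
  show ?thesis unfolding lin_stat_def by measurable
qed

lemma lin_stat_measurable [measurable]: "(\<lambda>\<omega>. lin_stat f (cfg \<omega>) n) \<in> borel_measurable M"
proof (cases "2 * m \<le> n")
  case True
  then show ?thesis using lin_stat_measurable_past measurable_past by blast
next
  case False
  then show ?thesis by (simp add: lin_stat_def dg_init)
qed

lemma lin_stat_integrable:
  assumes "\<And>d. \<bar>f d\<bar> \<le> B"
  shows "integrable M (\<lambda>\<omega>. lin_stat f (cfg \<omega>) n)"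
  by (rule integrable_const_bound[of _ "B * real n"]) (use lin_stat_bound[OF assms] in auto)

definition weight :: "nat \<Rightarrow> 'a \<Rightarrow> nat \<Rightarrow> real" where
  "weight n \<omega> v = (real (dg (cfg \<omega>) n v) + \<delta>) / total_weight n"

lemma weight_nonneg: "\<omega> \<in> space M \<Longrightarrow> 2 * m \<le> n \<Longrightarrow> v < n div m \<Longrightarrow> 0 \<le> weight n \<omega> v"
  unfolding weight_def
  using dg_ge_m[OF valid_cfg] plus_delta_pos total_weight_pos by (intro divide_nonneg_pos) (auto intro: less_imp_le)

lemma sum_weight: "\<omega> \<in> space M \<Longrightarrow> 2 * m \<le> n \<Longrightarrow> (\<Sum>v<n div m. weight n \<omega> v) = 1"
  unfolding weight_def sum_divide_distrib[symmetric]
  using sum_weights[OF valid_cfg] total_weight_pos[of n] by simp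

lemma weight_measurable_past:
  assumes "2 * m \<le> n"
  shows "(\<lambda>\<omega>. weight n \<omega> v) \<in> borel_measurable (past n)"
proof -
  note [measurable] = dg_measurable_past[OF assms]
  show ?thesis unfolding weight_def by measurable
qed

text \<open>Here the attachment rule enters: the conditional probability is tested against a bounded
  variable of the past, and \<open>sum_weights\<close> replaces its denominator by
  \<open>total_weight\<close>.\<close>

lemma attachment_integral_indicator:
  assumes n: "2 * m \<le> n" and v: "v < n div m"
    and X: "X \<in> borel_measurable (past n)" and bound: "\<And>\<omega>. \<omega> \<in> space M \<Longrightarrow> \<bar>X \<omega>\<bar> \<le> B"
  shows "(\<integral>\<omega>. X \<omega> * of_bool (tgt (cfg \<omega>) n = v) \<partial>M) = (\<integral>\<omega>. X \<omega> * weight n \<omega> v \<partial>M)"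
proof -
  define A where "A = {\<omega> \<in> space M. V (n div m) (Suc (n mod m)) \<omega> = v}"
  have i: "Suc (n mod m) \<in> {1..m}" using m_pos by (simp add: Suc_leI)
  have "A = V (n div m) (Suc (n mod m)) -` {v} \<inter> space M" by (auto simp: A_def)
  then have A [measurable]: "A \<in> sets M" using target_vimage_sets[OF div_m_ge[OF n] i] by simp
  interpret F: finite_measure_subalgebra M "past n"
    by unfold_locales (rule subalgebra_past[OF n])
  have XM [measurable]: "X \<in> borel_measurable M" by (rule measurable_past[OF n X])
  have int: "integrable M (\<lambda>\<omega>. X \<omega> * indicator A \<omega>)"
    by (rule integrable_const_bound[of _ "\<bar>B\<bar>"]) (use bound in \<open>auto simp: indicator_def intro: order_trans[OF _ abs_ge_self]\<close>)
  have "(\<integral>\<omega>. X \<omega> * of_bool (tgt (cfg \<omega>) n = v) \<partial>M) = (\<integral>\<omega>. X \<omega> * indicator A \<omega> \<partial>M)"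
    by (intro Bochner_Integration.integral_cong refl) (auto simp: A_def tgt_def cfg_def indicator_def)
  also have "\<dots> = (\<integral>\<omega>. X \<omega> * real_cond_exp M (past n) (indicator A) \<omega> \<partial>M)"
    by (rule F.real_cond_exp_intg(2)[symmetric, OF int X]) auto
  also have "\<dots> = (\<integral>\<omega>. X \<omega> * weight n \<omega> v \<partial>M)"
  proof (rule integral_cong_AE)
    have "AE \<omega> in M. real_cond_exp M (past n) (indicator A) \<omega> =
        (let G = PA m (cfg \<omega>) (n div m) (n mod m)
            in (real (vertex_degree G v) + \<delta>) / (\<Sum>u<n div m. real (vertex_degree G u) + \<delta>))"
      using attachment_rule[OF div_m_ge[OF n] i v] by (simp add: past_def A_def cfg_def)
    then show "AE \<omega> in M. X \<omega> * real_cond_exp M (past n) (indicator A) \<omega> = X \<omega> * weight n \<omega> v"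
    proof (rule AE_mp, intro AE_I2 impI)
      fix \<omega> assume "\<omega> \<in> space M"
        and e: "real_cond_exp M (past n) (indicator A) \<omega> =
        (let G = PA m (cfg \<omega>) (n div m) (n mod m)
            in (real (vertex_degree G v) + \<delta>) / (\<Sum>u<n div m. real (vertex_degree G u) + \<delta>))"
      show "X \<omega> * real_cond_exp M (past n) (indicator A) \<omega> = X \<omega> * weight n \<omega> v"
        unfolding e Let_def weight_def dg_def[symmetric] sum_weights[OF valid_cfg[OF \<open>\<omega> \<in> space M\<close>] n] ..
    qed
    show "(\<lambda>\<omega>. X \<omega> * weight n \<omega> v) \<in> borel_measurable M"
      using measurable_past[OF n weight_measurable_past[OF n]] by measurable
  qed measurable
  finally show ?thesis .
qed

lemma weight_le_1:
  assumes "\<omega> \<in> space M" "2 * m \<le> n" "v < n div m"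
  shows "weight n \<omega> v \<le> 1"
proof -
  have "weight n \<omega> v \<le> (\<Sum>v<n div m. weight n \<omega> v)"
    by (rule member_le_sum) (use assms weight_nonneg in auto)
  then show ?thesis using sum_weight assms by simp
qed

text \<open>Split according to the target v. Each \<open>X v\<close> belongs to the past, so
  \<open>attachment_integral_indicator\<close> applies to its real and imaginary parts.\<close>

lemma attachment_integral_complex:
  fixes X :: "nat \<Rightarrow> 'a \<Rightarrow> complex"
  assumes n: "2 * m \<le> n"
    and X: "\<And>v. v < n div m \<Longrightarrow> X v \<in> borel_measurable (past n)"
    and bound: "\<And>v \<omega>. v < n div m \<Longrightarrow> \<omega> \<in> space M \<Longrightarrow> norm (X v \<omega>) \<le> B"
  shows "(\<integral>\<omega>. X (tgt (cfg \<omega>) n) \<omega> \<partial>M) = (\<integral>\<omega>. (\<Sum>v<n div m. of_real (weight n \<omega> v) * X v \<omega>) \<partial>M)"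
proof -
  let ?I = "\<lambda>v \<omega>. of_bool (tgt (cfg \<omega>) n = v) :: real"
  have [measurable]: "(\<lambda>\<omega>. tgt (cfg \<omega>) n) \<in> measurable M (count_space UNIV)"
    using measurable_past[OF _ tgt_measurable_past[OF n]] n by simp
  have wm [measurable]: "(\<lambda>\<omega>. weight n \<omega> v) \<in> borel_measurable M" for v
    using measurable_past[OF n weight_measurable_past[OF n]] .
  have int: "integrable M (\<lambda>\<omega>. of_real (g \<omega>) * X v \<omega>)"
    if v: "v < n div m" and [measurable]: "g \<in> borel_measurable M"
      and g: "\<And>\<omega>. \<omega> \<in> space M \<Longrightarrow> \<bar>g \<omega>\<bar> \<le> 1" for g v
  proof (rule integrable_const_bound[of _ "1 * B"])
    show "AE \<omega> in M. norm (of_real (g \<omega>) * X v \<omega>) \<le> 1 * B"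
      unfolding norm_mult norm_of_real by (intro AE_I2 mult_mono g bound v) auto
  qed (use measurable_past[OF n X[OF v]] in measurable)
  have int_I: "integrable M (\<lambda>\<omega>. of_real (?I v \<omega>) * X v \<omega>)"
    and int_w: "integrable M (\<lambda>\<omega>. of_real (weight n \<omega> v) * X v \<omega>)" if "v < n div m" for v
    by (rule int[OF that]; use weight_nonneg weight_le_1 n that in simp)+
  have eq: "(\<integral>\<omega>. of_real (?I v \<omega>) * X v \<omega> \<partial>M) = (\<integral>\<omega>. of_real (weight n \<omega> v) * X v \<omega> \<partial>M)" if v: "v < n div m" for v
  proof (rule complex_eqI)
    have [measurable]: "X v \<in> borel_measurable (past n)" by (rule X[OF v])
    have Re: "\<bar>Re (X v \<omega>)\<bar> \<le> B" and Im: "\<bar>Im (X v \<omega>)\<bar> \<le> B" if "\<omega> \<in> space M" for \<omega>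
      using bound[OF v that] abs_Re_le_cmod[of "X v \<omega>"] abs_Im_le_cmod[of "X v \<omega>"] by linarith+
    show "Re (\<integral>\<omega>. of_real (?I v \<omega>) * X v \<omega> \<partial>M) = Re (\<integral>\<omega>. of_real (weight n \<omega> v) * X v \<omega> \<partial>M)"
      unfolding integral_Re[OF int_I[OF v], symmetric] integral_Re[OF int_w[OF v], symmetric]
      using attachment_integral_indicator[OF n v _ Re] by (simp add: mult.commute)
    show "Im (\<integral>\<omega>. of_real (?I v \<omega>) * X v \<omega> \<partial>M) = Im (\<integral>\<omega>. of_real (weight n \<omega> v) * X v \<omega> \<partial>M)"
      unfolding integral_Im[OF int_I[OF v], symmetric] integral_Im[OF int_w[OF v], symmetric]
      using attachment_integral_indicator[OF n v _ Im] by (simp add: mult.commute)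
  qed
  have "(\<integral>\<omega>. X (tgt (cfg \<omega>) n) \<omega> \<partial>M) = (\<integral>\<omega>. (\<Sum>v<n div m. of_real (?I v \<omega>) * X v \<omega>) \<partial>M)"
    using tgt_less[OF valid_cfg n]
    by (intro Bochner_Integration.integral_cong refl)
       (simp add: of_bool_def if_distrib[of of_real] if_distrib[of "\<lambda>x. x * _"] cong: if_cong)
  also have "\<dots> = (\<integral>\<omega>. (\<Sum>v<n div m. of_real (weight n \<omega> v) * X v \<omega>) \<partial>M)"
    using int_I int_w eq by (simp add: Bochner_Integration.integral_sum)
  finally show ?thesis .
qed

lemma attachment_integral:
  assumes n: "2 * m \<le> n"
    and X: "\<And>v. v < n div m \<Longrightarrow> X v \<in> borel_measurable (past n)"
    and bound: "\<And>v \<omega>. v < n div m \<Longrightarrow> \<omega> \<in> space M \<Longrightarrow> \<bar>X v \<omega>\<bar> \<le> B"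
  shows "(\<integral>\<omega>. X (tgt (cfg \<omega>) n) \<omega> \<partial>M) = (\<integral>\<omega>. (\<Sum>v<n div m. weight n \<omega> v * X v \<omega>) \<partial>M)"
proof -
  have "complex_of_real (\<integral>\<omega>. X (tgt (cfg \<omega>) n) \<omega> \<partial>M) = (\<integral>\<omega>. of_real (X (tgt (cfg \<omega>) n) \<omega>) \<partial>M)" by simp
  also have "\<dots> = (\<integral>\<omega>. (\<Sum>v<n div m. of_real (weight n \<omega> v) * of_real (X v \<omega>)) \<partial>M)"
    by (rule attachment_integral_complex[OF n, where X = "\<lambda>v \<omega>. of_real (X v \<omega>)" and B = B])
       (use X bound in auto)
  also have "\<dots> = of_real (\<integral>\<omega>. (\<Sum>v<n div m. weight n \<omega> v * X v \<omega>) \<partial>M)"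
    by (simp flip: of_real_mult of_real_sum)
  finally show ?thesis by (simp only: of_real_eq_iff)
qed

end

section \<open>Means and variances of the eigenfunction statistics\<close>

context pa_params
begin

definition lam :: "nat \<Rightarrow> nat \<Rightarrow> real" where
  "lam t n = 1 - (real t + \<delta>) / total_weight n"

text \<open>A finite sum suffices because \<open>b d t\<close> vanishes for \<open>d > t\<close>.
  The bound is uniform in the degree, so the increments of \<open>U_t\<close> are bounded.\<close>

definition b_bound :: "nat \<Rightarrow> real" where
  "b_bound t = (\<Sum>d\<le>t. \<bar>b d t\<bar>)"

lemma b_bound: "\<bar>b d t\<bar> \<le> b_bound t"
proof (cases "d \<le> t")
  case True
  then show ?thesis unfolding b_bound_def by (intro member_le_sum) auto
qed (simp add: b_coeff_eq_0 b_bound_def sum_nonneg)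

lemma b_bound_nonneg: "0 \<le> b_bound t"
  by (simp add: b_bound_def sum_nonneg)

lemma b_diff_bound: "\<bar>b_diff d t\<bar> \<le> 2 * b_bound t"
  using b_bound[of d t] b_bound[of "Suc d" t] unfolding b_diff_def by linarith

lemma lam_asymp: "(\<lambda>n. real n * (1 - lam t n)) \<longlonglongrightarrow> (real t + \<delta>) / \<theta>"
  using tendsto_mult_left[OF inverse_total_weight_asymp, of "real t + \<delta>"]
  by (simp add: lam_def mult.commute)

lemma eventually_lam: "m \<le> t \<Longrightarrow> \<forall>\<^sub>F n in sequentially. 0 \<le> lam t n \<and> lam t n \<le> 1"
  using eventually_contraction[OF lam_asymp, of t] plus_delta_pos[of t] theta_gt_1 by simp

text \<open>Use \<open>1 - x y = (1 - x) + (1 - y) - (1 - x) (1 - y)\<close>; the last product is of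
  order \<open>1 / n^2\<close>.\<close>

lemma lam_mult_asymp:
  "(\<lambda>n. real n * (1 - lam t1 n * lam t2 n)) \<longlonglongrightarrow> (real t1 + real t2 + 2 * \<delta>) / \<theta>"
proof -
  have "(\<lambda>n. real n * (1 - lam t1 n) + real n * (1 - lam t2 n)
        - (real n * (1 - lam t1 n)) * (real n * (1 - lam t2 n)) * inverse (real n))
      \<longlonglongrightarrow> (real t1 + \<delta>) / \<theta> + (real t2 + \<delta>) / \<theta> - (real t1 + \<delta>) / \<theta> * ((real t2 + \<delta>) / \<theta>) * 0"
    by (intro tendsto_intros lam_asymp lim_inverse_n)
  also have "(real t1 + \<delta>) / \<theta> + (real t2 + \<delta>) / \<theta> - (real t1 + \<delta>) / \<theta> * ((real t2 + \<delta>) / \<theta>) * 0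
      = (real t1 + real t2 + 2 * \<delta>) / \<theta>" by (simp add: add_divide_distrib[symmetric])
  finally show ?thesis
  proof (rule Lim_transform_eventually)
    show "\<forall>\<^sub>F n in sequentially. real n * (1 - lam t1 n) + real n * (1 - lam t2 n)
        - (real n * (1 - lam t1 n)) * (real n * (1 - lam t2 n)) * inverse (real n)
        = real n * (1 - lam t1 n * lam t2 n)"
      using eventually_gt_at_top[of 0] by eventually_elim (simp add: field_simps)
  qed
qed

end

context pa_model
begin

definition U :: "nat \<Rightarrow> nat \<Rightarrow> 'a \<Rightarrow> real" where
  "U t n \<omega> = U_stat t (cfg \<omega>) n"

definition mean_U :: "nat \<Rightarrow> nat \<Rightarrow> real" where
  "mean_U t n = (\<integral>\<omega>. U t n \<omega> \<partial>M)"

lemma U_measurable [measurable]: "U t n \<in> borel_measurable M"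
  unfolding U_def[abs_def] U_stat_def by measurable

lemma U_measurable_past: "2 * m \<le> n \<Longrightarrow> U t n \<in> borel_measurable (past n)"
  unfolding U_def[abs_def] U_stat_def by (rule lin_stat_measurable_past)

lemma U_bound: "\<bar>U t n \<omega>\<bar> \<le> b_bound t * real n"
  unfolding U_def U_stat_def by (rule lin_stat_bound) (rule b_bound)

lemma U_integrable [simp]: "integrable M (U t n)"
  unfolding U_def[abs_def] U_stat_def by (rule lin_stat_integrable) (rule b_bound)

lemma mean_U_bound: "\<bar>mean_U t n\<bar> \<le> b_bound t * real n"
proof -
  have "\<bar>mean_U t n\<bar> \<le> (\<integral>\<omega>. \<bar>U t n \<omega>\<bar> \<partial>M)" unfolding mean_U_def by (rule integral_abs_bound)
  also have "\<dots> \<le> (\<integral>\<omega>. b_bound t * real n \<partial>M)"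
    by (intro integral_mono) (auto simp: U_bound)
  also have "\<dots> = b_bound t * real n" by (simp add: prob_space)
  finally show ?thesis .
qed

lemma U_Suc:
  assumes "\<omega> \<in> space M" "2 * m \<le> n"
  shows "U t (Suc n) \<omega> = U t n \<omega> + b_diff (dg (cfg \<omega>) n (tgt (cfg \<omega>) n)) t + (if m dvd Suc n then b m t else 0)"
  unfolding U_def U_stat_def lin_stat_Suc[OF valid_cfg[OF assms(1)] assms(2)] b_diff_def ..

lemma weighted_degree_sum:
  "(\<Sum>v<n div m. weight n \<omega> v * g (dg (cfg \<omega>) n v)) = lin_stat (\<lambda>d. (real d + \<delta>) * g d) (cfg \<omega>) n / total_weight n"
  by (simp add: weight_def lin_stat_def sum_divide_distrib)

text \<open>\<open>degree_b_diff\<close> summed over the vertices: because of the eigenfunction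
  relation the conditional drift of \<open>U_t\<close> involves no other statistic.\<close>

lemma weighted_b_diff:
  "(\<Sum>v<n div m. weight n \<omega> v * b_diff (dg (cfg \<omega>) n v) t) = - (real t + \<delta>) / total_weight n * U t n \<omega>"
  unfolding weighted_degree_sum[of n \<omega> "\<lambda>d. b_diff d t"] degree_b_diff
  by (simp add: U_def U_stat_def lin_stat_def sum_distrib_left sum_divide_distrib)

lemma weighted_b_diff_lam:
  "U t n \<omega> + (\<Sum>v<n div m. weight n \<omega> v * b_diff (dg (cfg \<omega>) n v) t) = lam t n * U t n \<omega>"
proof -
  have "u + - a / w * u = (1 - a / w) * u" for u a w :: real by (simp add: left_diff_distrib)
  then show ?thesis unfolding weighted_b_diff lam_def .
qed

lemma b_diff_dg_measurable_past:
  "2 * m \<le> n \<Longrightarrow> (\<lambda>\<omega>. b_diff (dg (cfg \<omega>) n v) t) \<in> borel_measurable (past n)"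
proof -
  assume "2 * m \<le> n"
  note [measurable] = dg_measurable_past[OF this]
  show ?thesis by measurable
qed

lemma mean_U_Suc:
  assumes n: "2 * m \<le> n"
  shows "mean_U t (Suc n) = lam t n * mean_U t n + (if m dvd Suc n then b m t else 0)"
proof -
  define c where "c = (if m dvd Suc n then b m t else 0)"
  note [measurable] = b_diff_dg_measurable_past[OF n] U_measurable_past[OF n]
  have "mean_U t (Suc n) = (\<integral>\<omega>. (U t n \<omega> + b_diff (dg (cfg \<omega>) n (tgt (cfg \<omega>) n)) t + c) \<partial>M)"
    unfolding mean_U_def c_def by (intro Bochner_Integration.integral_cong refl U_Suc n)
  also have "\<dots> = (\<integral>\<omega>. (\<Sum>v<n div m. weight n \<omega> v * (U t n \<omega> + b_diff (dg (cfg \<omega>) n v) t + c)) \<partial>M)"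
  proof (rule attachment_integral[OF n, where B = "b_bound t * real n + 2 * b_bound t + \<bar>c\<bar>"])
    show "\<bar>U t n \<omega> + b_diff (dg (cfg \<omega>) n v) t + c\<bar> \<le> b_bound t * real n + 2 * b_bound t + \<bar>c\<bar>" for v \<omega>
      using U_bound[of t n \<omega>] b_diff_bound[of "dg (cfg \<omega>) n v" t] by linarith
  qed measurable
  also have "\<dots> = (\<integral>\<omega>. lam t n * U t n \<omega> + c \<partial>M)"
  proof (rule Bochner_Integration.integral_cong[OF refl])
    fix \<omega> assume \<omega>: "\<omega> \<in> space M"
    have "(\<Sum>v<n div m. weight n \<omega> v * (U t n \<omega> + b_diff (dg (cfg \<omega>) n v) t + c))
       = (U t n \<omega> + c) * (\<Sum>v<n div m. weight n \<omega> v) + (\<Sum>v<n div m. weight n \<omega> v * b_diff (dg (cfg \<omega>) n v) t)"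
      by (simp add: sum_distrib_left sum.distrib[symmetric] algebra_simps)
    then show "(\<Sum>v<n div m. weight n \<omega> v * (U t n \<omega> + b_diff (dg (cfg \<omega>) n v) t + c)) = lam t n * U t n \<omega> + c"
      using weighted_b_diff_lam[where t = t and n = n and \<omega> = \<omega>] sum_weight[OF \<omega> n] by simp
  qed
  also have "\<dots> = lam t n * mean_U t n + c" by (simp add: mean_U_def prob_space)
  finally show ?thesis by (simp add: c_def)
qed

text \<open>The limiting drift of \<open>U_t\<close> per edge: insert
  \<open>U_t ~ c_lim t * s\<close> and \<open>total_weight ~ (2 m + \<delta>) s\<close> into
  \<open>weighted_b_diff\<close>.\<close>

definition mean_step :: "nat \<Rightarrow> real" where
  "mean_step t = - (real t + \<delta>) * c_lim t / (2 * real m + \<delta>)"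

text \<open>The drift of \<open>U\<^sub>t\<close> is periodic in the step number; this is its discrete primitive.\<close>

definition center :: "nat \<Rightarrow> nat \<Rightarrow> real" where
  "center t n = real (n div m) * c_lim t + real (n mod m) * mean_step t"

text \<open>The drift over the m edges of a vertex plus the contribution \<open>b m t\<close> of the
  finished vertex must equal the growth \<open>c_lim t\<close> per vertex. This is what makes
  \<open>center\<close> follow the periodic recursion.\<close>

lemma b_m_eq:
  assumes "m \<le> t" shows "b m t = c_lim t - real m * mean_step t"
proof -
  have "real t + \<delta> + \<theta> > 0" using plus_delta_pos[OF assms] theta_gt_1 by linarith
  then have b: "b m t = c_lim t * (real t + \<delta> + \<theta>) / \<theta>"
    using theta_gt_1 by (simp add: c_lim_def)
  have "real m * mean_step t = - (real t + \<delta>) * c_lim t / \<theta>"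
    unfolding mean_step_def m_theta[symmetric] using m_pos by simp
  then show ?thesis unfolding b using theta_gt_1 by (simp add: field_simps)
qed

text \<open>The difference obeys the recursion of the mean with a source \<open>e\<close> of order
  \<open>1 / n\<close>, because in
  \<open>c_lim t * total_weight n - (2 m + \<delta>) * center t n\<close> the terms growing with n
  cancel. Then \<open>linear_recursion_sqrt\<close> gives the precision that the scaling
  demands.\<close>

lemma mean_U_center:
  assumes t: "m \<le> t"
  shows "(\<lambda>n. (mean_U t n - center t n) / sqrt (real n)) \<longlonglongrightarrow> 0"
proof -
  define e where "e n = - (real t + \<delta>) / total_weight n * center t n - mean_step t" for n
  define C where "C = \<bar>(real t + \<delta>) / (2 * real m + \<delta>)\<bar> * (\<bar>c_lim t\<bar> * (2 * real m) + \<bar>2 * real m + \<delta>\<bar> * real m * \<bar>mean_step t\<bar>)"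
  have mdelta: "2 * real m + \<delta> > 0" using plus_delta_pos[of m] by simp
  have "C \<ge> 0" unfolding C_def by simp
  show ?thesis
  proof (rule linear_recursion_sqrt[where lam = "lam t" and e = e and C = "C * 2"])
    show "\<forall>\<^sub>F n in sequentially. 0 \<le> lam t n \<and> lam t n \<le> 1" by (rule eventually_lam[OF t])
    show "\<forall>\<^sub>F n in sequentially. mean_U t (Suc n) - center t (Suc n) = lam t n * (mean_U t n - center t n) + e n"
      using eventually_ge_at_top[of "2 * m"]
    proof eventually_elim
      case (elim n)
      have center: "center t (Suc n) = center t n + (if m dvd Suc n then b m t else 0) + mean_step t"
      proof (cases n rule: step_cases)
        case wrap
        have "real (n mod m) = real m - 1" using wrap(3) by (metis add_diff_cancel_right' of_nat_Suc add.commute)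
        then have "real (n mod m) * mean_step t = real m * mean_step t - mean_step t" by (simp add: left_diff_distrib)
        then show ?thesis using wrap b_m_eq[OF t] by (simp add: center_def distrib_right)
      qed (simp add: center_def algebra_simps)
      have "(1 - a / w) * u + d - (c + d + y) = (1 - a / w) * (u - c) + (- a / w * c - y)"
        for a w u c d y :: real by (simp add: algebra_simps diff_divide_distrib)
      then show ?case unfolding mean_U_Suc[OF elim] e_def lam_def center .
    qed
    \<comment> \<open>A lower bound below the limit \<theta>, available since \<theta> exceeds 1; it
      causes the factor 2 in \<open>C * 2\<close>.\<close>
    have ev: "\<forall>\<^sub>F n in sequentially. total_weight n / real n > 1 / 2"
      using total_weight_asymp theta_gt_1 by (intro order_tendstoD) auto
    show "\<forall>\<^sub>F n in sequentially. \<bar>e n\<bar> \<le> C * 2 / real n"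
      using eventually_ge_at_top[of "2 * m"] ev
    proof eventually_elim
      case (elim n)
      define s i where "s = real (n div m)" and "i = real (n mod m)"
      have i: "0 \<le> i" "i \<le> real m" using m_pos by (auto simp: i_def intro: less_imp_le)
      have tw: "total_weight n > 0" by (rule total_weight_pos[OF elim(1)])
      have npos: "real n > 0" using elim(1) m_pos by simp
      have "e n = (real t + \<delta>) / (2 * real m + \<delta>) * ((c_lim t * total_weight n - (2 * real m + \<delta>) * center t n) / total_weight n)"
        unfolding e_def mean_step_def using tw mdelta by (simp add: field_simps)
      also have "c_lim t * total_weight n - (2 * real m + \<delta>) * center t n
          = c_lim t * (i - 2 * real m) - (2 * real m + \<delta>) * i * mean_step t"
        unfolding total_weight_def center_def s_def[symmetric] i_def[symmetric] by (simp add: algebra_simps)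
      finally have e: "\<bar>e n\<bar> = \<bar>(real t + \<delta>) / (2 * real m + \<delta>)\<bar> * (\<bar>c_lim t * (i - 2 * real m) - (2 * real m + \<delta>) * i * mean_step t\<bar> / total_weight n)"
        using tw by (simp add: abs_mult)
      have "\<bar>c_lim t * (i - 2 * real m) - (2 * real m + \<delta>) * i * mean_step t\<bar>
          \<le> \<bar>c_lim t * (i - 2 * real m)\<bar> + \<bar>(2 * real m + \<delta>) * i * mean_step t\<bar>" by linarith
      also have "\<dots> \<le> \<bar>c_lim t\<bar> * (2 * real m) + \<bar>2 * real m + \<delta>\<bar> * real m * \<bar>mean_step t\<bar>"
        unfolding abs_mult using i by (intro add_mono mult_mono) auto
      finally have "\<bar>e n\<bar> \<le> \<bar>(real t + \<delta>) / (2 * real m + \<delta>)\<bar> *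
          ((\<bar>c_lim t\<bar> * (2 * real m) + \<bar>2 * real m + \<delta>\<bar> * real m * \<bar>mean_step t\<bar>) / total_weight n)"
        unfolding e using tw by (intro mult_left_mono divide_right_mono) auto
      also have "\<dots> = C / total_weight n" by (simp add: C_def)
      also have "\<dots> \<le> C / (real n / 2)"
        using elim(2) npos tw \<open>C \<ge> 0\<close> by (intro divide_left_mono) (auto simp: field_simps)
      finally show ?case by simp
    qed
  qed
qed

lemma div_mod_bounds:
  assumes "n > 0"
  shows "\<bar>real (n div m) / real n - 1 / real m\<bar> \<le> 1 / real n"
proof -
  have "real n = real (n div m) * real m + real (n mod m)"
    by (metis div_mult_mod_eq of_nat_add of_nat_mult)
  then have e: "real (n div m) / real n - 1 / real m = - (real (n mod m) / real m) / real n"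
    using assms m_pos by (simp add: field_simps)
  have "real (n mod m) / real m \<le> 1" using m_pos by (simp add: less_imp_le)
  moreover have "\<bar>- y / real n\<bar> \<le> 1 / real n" if "0 \<le> y" "y \<le> 1" for y
    using that assms by (simp add: divide_right_mono)
  ultimately show ?thesis unfolding e by (metis divide_nonneg_nonneg of_nat_0_le_iff)
qed

lemma center_asymp: "(\<lambda>n. center t n / real n) \<longlonglongrightarrow> c_lim t / real m"
proof -
  have "(\<lambda>n. real (n div m) / real n - 1 / real m) \<longlonglongrightarrow> 0"
    by (rule Lim_null_comparison[OF eventually_mono[OF eventually_gt_at_top[of 0]] lim_const_over_n[of 1]])
       (use div_mod_bounds in simp)
  then have 1: "(\<lambda>n. real (n div m) / real n) \<longlonglongrightarrow> 1 / real m" by (simp add: Lim_null[symmetric])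
  have 2: "(\<lambda>n. real (n mod m) / real n) \<longlonglongrightarrow> 0"
    by (rule Lim_null_comparison[OF _ lim_const_over_n[of "real m"]])
       (use m_pos in \<open>auto intro!: always_eventually divide_right_mono mod_le_divisor\<close>)
  have "(\<lambda>n. c_lim t * (real (n div m) / real n) + mean_step t * (real (n mod m) / real n))
     \<longlonglongrightarrow> c_lim t * (1 / real m) + mean_step t * 0"
    by (intro tendsto_intros 1 2)
  then show ?thesis by (simp add: center_def add_divide_distrib mult.commute)
qed

lemma mean_U_asymp:
  assumes "m \<le> t" shows "(\<lambda>n. mean_U t n / real n) \<longlonglongrightarrow> c_lim t / real m"
proof -
  have "(\<lambda>n. 1 / real n) \<longlonglongrightarrow> 0" by (rule lim_const_over_n)
  then have "(\<lambda>n. sqrt (1 / real n)) \<longlonglongrightarrow> sqrt 0" by (intro tendsto_intros)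
  then have "(\<lambda>n. (mean_U t n - center t n) / sqrt (real n) * sqrt (1 / real n) + center t n / real n)
      \<longlonglongrightarrow> 0 * sqrt 0 + c_lim t / real m"
    by (intro tendsto_intros mean_U_center[OF assms] center_asymp)
  moreover have "(mean_U t n - center t n) / sqrt (real n) * sqrt (1 / real n) + center t n / real n = mean_U t n / real n" for n
  proof -
    have "sqrt (real n) * sqrt (real n) = real n" by simp
    then show ?thesis by (simp add: real_sqrt_divide diff_divide_distrib)
  qed
  ultimately show ?thesis by simp
qed

definition var_U :: "nat \<Rightarrow> nat \<Rightarrow> real" where
  "var_U t n = (\<integral>\<omega>. (U t n \<omega> - mean_U t n)\<^sup>2 \<partial>M)"

lemma U_square_integrable: "integrable M (\<lambda>\<omega>. (U t n \<omega> - mean_U t n)\<^sup>2)"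
proof (rule integrable_const_bound[of _ "(b_bound t * real n + b_bound t * real n)\<^sup>2"])
  show "AE \<omega> in M. norm ((U t n \<omega> - mean_U t n)\<^sup>2) \<le> (b_bound t * real n + b_bound t * real n)\<^sup>2"
  proof (rule AE_I2)
    fix \<omega>
    have "\<bar>U t n \<omega> - mean_U t n\<bar> \<le> b_bound t * real n + b_bound t * real n"
      using U_bound[of t n \<omega>] mean_U_bound[of t n] by linarith
    then show "norm ((U t n \<omega> - mean_U t n)\<^sup>2) \<le> (b_bound t * real n + b_bound t * real n)\<^sup>2"
      using b_bound_nonneg[of t] power2_le_iff_abs_le[of "b_bound t * real n + b_bound t * real n" "U t n \<omega> - mean_U t n"]
      by simp
  qed
qed measurable

text \<open>Given the past, the second moment is the squared conditional mean plus the conditional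
  variance. The first is contracted by \<open>lam\<close>, the second is bounded because the
  increments are.\<close>

lemma var_U_Suc:
  assumes n: "2 * m \<le> n" and lam: "0 \<le> lam t n" "lam t n \<le> 1"
  shows "var_U t (Suc n) \<le> var_U t n + (2 * b_bound t)\<^sup>2"
proof -
  let ?y = "\<lambda>v \<omega>. (U t n \<omega> + b_diff (dg (cfg \<omega>) n v) t - lam t n * mean_U t n)\<^sup>2"
  note [measurable] = b_diff_dg_measurable_past[OF n] U_measurable_past[OF n]
  define B where "B = b_bound t * real n + 2 * b_bound t + b_bound t * real n"
  have "var_U t (Suc n) = (\<integral>\<omega>. (U t n \<omega> + b_diff (dg (cfg \<omega>) n (tgt (cfg \<omega>) n)) t - lam t n * mean_U t n)\<^sup>2 \<partial>M)"
    unfolding var_U_def by (intro Bochner_Integration.integral_cong refl) (simp add: U_Suc mean_U_Suc n)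
  also have "\<dots> = (\<integral>\<omega>. (\<Sum>v<n div m. weight n \<omega> v * ?y v \<omega>) \<partial>M)"
  proof (rule attachment_integral[OF n, where B = "B\<^sup>2"])
    fix v \<omega>
    have "\<bar>lam t n * mean_U t n\<bar> \<le> 1 * (b_bound t * real n)"
      unfolding abs_mult using lam mean_U_bound by (intro mult_mono) auto
    then have "\<bar>U t n \<omega> + b_diff (dg (cfg \<omega>) n v) t - lam t n * mean_U t n\<bar> \<le> B"
      using U_bound[of t n \<omega>] b_diff_bound[of "dg (cfg \<omega>) n v" t] unfolding B_def by linarith
    then show "\<bar>?y v \<omega>\<bar> \<le> B\<^sup>2"
      using power_mono[of "\<bar>U t n \<omega> + b_diff (dg (cfg \<omega>) n v) t - lam t n * mean_U t n\<bar>" B 2] by simp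
  qed measurable
  also have "\<dots> \<le> (\<integral>\<omega>. (U t n \<omega> - mean_U t n)\<^sup>2 + (2 * b_bound t)\<^sup>2 \<partial>M)"
  proof (rule integral_mono_AE')
    note U_square_integrable[of t n]
    then show "integrable M (\<lambda>\<omega>. (U t n \<omega> - mean_U t n)\<^sup>2 + (2 * b_bound t)\<^sup>2)" by simp
    show "AE \<omega> in M. (\<Sum>v<n div m. weight n \<omega> v * ?y v \<omega>)
        \<le> (U t n \<omega> - mean_U t n)\<^sup>2 + (2 * b_bound t)\<^sup>2"
    proof (rule AE_I2)
      fix \<omega> assume \<omega>: "\<omega> \<in> space M"
      define P where "P = weight n \<omega>"
      define z where "z v = b_diff (dg (cfg \<omega>) n v) t" for v
      define y where "y = U t n \<omega> - lam t n * mean_U t n"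
      define \<mu> where "\<mu> = (\<Sum>v<n div m. P v * z v)"
      have P1: "(\<Sum>v<n div m. P v) = 1" using sum_weight[OF \<omega> n] by (simp add: P_def)
      have "(\<Sum>v<n div m. weight n \<omega> v * ?y v \<omega>)
          = (\<Sum>v<n div m. y\<^sup>2 * P v + 2 * y * (P v * z v) + P v * (z v)\<^sup>2)"
        by (intro sum.cong refl) (simp add: P_def z_def y_def power2_eq_square algebra_simps)
      also have "\<dots> = y\<^sup>2 + 2 * y * \<mu> + (\<Sum>v<n div m. P v * (z v)\<^sup>2)"
        by (simp add: sum.distrib sum_distrib_left[symmetric] P1 \<mu>_def)
      \<comment> \<open>Adding the square of \<mu> completes the square; \<open>y + \<mu>\<close> is
        the conditional mean of the centred value at the next step.\<close>
      also have "\<dots> \<le> (y + \<mu>)\<^sup>2 + (\<Sum>v<n div m. P v * (z v)\<^sup>2)" by (simp add: power2_sum)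
      also have "y + \<mu> = lam t n * (U t n \<omega> - mean_U t n)"
        using weighted_b_diff_lam[where t = t and n = n and \<omega> = \<omega>] by (simp add: y_def \<mu>_def P_def z_def algebra_simps)
      also have "(lam t n * (U t n \<omega> - mean_U t n))\<^sup>2 \<le> 1 * (U t n \<omega> - mean_U t n)\<^sup>2"
        unfolding power_mult_distrib using lam by (intro mult_right_mono) (auto simp: power_le_one)
      also have "(\<Sum>v<n div m. P v * (z v)\<^sup>2) \<le> (\<Sum>v<n div m. P v * (2 * b_bound t)\<^sup>2)"
      proof (intro sum_mono mult_left_mono)
        fix v assume "v \<in> {..<n div m}"
        then show "0 \<le> P v" using weight_nonneg[OF \<omega> n] by (simp add: P_def)
        show "(z v)\<^sup>2 \<le> (2 * b_bound t)\<^sup>2"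
          unfolding z_def using b_diff_bound by (intro power2_le_iff_abs_le[THEN iffD2]) (auto simp: b_bound_nonneg)
      qed
      also have "\<dots> = (2 * b_bound t)\<^sup>2" by (simp add: sum_distrib_right[symmetric] P1)
      finally show "(\<Sum>v<n div m. weight n \<omega> v * ?y v \<omega>)
        \<le> (U t n \<omega> - mean_U t n)\<^sup>2 + (2 * b_bound t)\<^sup>2" by simp
    qed
    show "AE \<omega> in M. 0 \<le> (U t n \<omega> - mean_U t n)\<^sup>2 + (2 * b_bound t)\<^sup>2" by simp
  qed
  also have "\<dots> = var_U t n + (2 * b_bound t)\<^sup>2"
  proof -
    note U_square_integrable[of t n]
    then show ?thesis by (simp add: var_U_def prob_space)
  qed
  finally show ?thesis .
qed

end

section \<open>Law of large numbers\<close>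

context prob_space
begin

text \<open>The uniform bound is part of the notion in order that products of convergent sequences
  converge again.\<close>

definition L1_conv :: "(nat \<Rightarrow> 'a \<Rightarrow> real) \<Rightarrow> real \<Rightarrow> bool" where
  "L1_conv X x \<longleftrightarrow> (\<forall>n. X n \<in> borel_measurable M) \<and> (\<exists>B. \<forall>n. \<forall>\<omega>\<in>space M. \<bar>X n \<omega>\<bar> \<le> B) \<and>
     (\<lambda>n. \<integral>\<omega>. \<bar>X n \<omega> - x\<bar> \<partial>M) \<longlonglongrightarrow> 0"

lemma L1_conv_integrable:
  assumes "L1_conv X x"
  shows "integrable M (X n)" "integrable M (\<lambda>\<omega>. \<bar>X n \<omega> - x\<bar>)"
proof -
  from assms obtain B where "X n \<in> borel_measurable M" "\<And>\<omega>. \<omega> \<in> space M \<Longrightarrow> \<bar>X n \<omega>\<bar> \<le> B"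
    unfolding L1_conv_def by blast
  then show "integrable M (X n)" by (intro integrable_const_bound[of _ B]) auto
  then show "integrable M (\<lambda>\<omega>. \<bar>X n \<omega> - x\<bar>)" by simp
qed

lemma L1_conv_dominated:
  assumes "\<And>n. X n \<in> borel_measurable M" "\<And>n \<omega>. \<omega> \<in> space M \<Longrightarrow> \<bar>X n \<omega>\<bar> \<le> B"
    and "\<And>n. integrable M (D n)" "\<And>n \<omega>. \<omega> \<in> space M \<Longrightarrow> \<bar>X n \<omega> - x\<bar> \<le> D n \<omega>"
    and "(\<lambda>n. \<integral>\<omega>. D n \<omega> \<partial>M) \<longlonglongrightarrow> 0"
  shows "L1_conv X x"
proof -
  have "(\<lambda>n. \<integral>\<omega>. \<bar>X n \<omega> - x\<bar> \<partial>M) \<longlonglongrightarrow> 0"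
  proof (rule Lim_null_comparison[OF _ assms(5)], intro always_eventually allI)
    fix n
    have "integrable M (X n)" using assms(1,2) by (intro integrable_const_bound[of _ B]) auto
    then have "(\<integral>\<omega>. \<bar>X n \<omega> - x\<bar> \<partial>M) \<le> (\<integral>\<omega>. D n \<omega> \<partial>M)"
      using assms(3,4) by (intro integral_mono) auto
    then show "norm (\<integral>\<omega>. \<bar>X n \<omega> - x\<bar> \<partial>M) \<le> (\<integral>\<omega>. D n \<omega> \<partial>M)" by simp
  qed
  then show ?thesis unfolding L1_conv_def using assms(1,2) by blast
qed

lemma L1_conv_const:
  assumes "a \<longlonglongrightarrow> x" shows "L1_conv (\<lambda>n \<omega>. a n) x"
proof -
  have "Bseq a" using assms by (intro convergent_imp_Bseq convergentI)
  then obtain B where "\<And>n. \<bar>a n\<bar> \<le> B" unfolding Bseq_def by auto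
  moreover have "(\<lambda>n. \<bar>a n - x\<bar>) \<longlonglongrightarrow> 0"
    using assms by (intro tendsto_rabs_zero) (simp add: Lim_null[symmetric])
  ultimately show ?thesis unfolding L1_conv_def by (auto simp: prob_space)
qed

lemma L1_conv_add:
  assumes X: "L1_conv X x" and Y: "L1_conv Y y"
  shows "L1_conv (\<lambda>n \<omega>. X n \<omega> + Y n \<omega>) (x + y)"
proof -
  obtain B where B: "\<And>n \<omega>. \<omega> \<in> space M \<Longrightarrow> \<bar>X n \<omega>\<bar> \<le> B" using X unfolding L1_conv_def by blast
  obtain C where C: "\<And>n \<omega>. \<omega> \<in> space M \<Longrightarrow> \<bar>Y n \<omega>\<bar> \<le> C" using Y unfolding L1_conv_def by blast
  have [measurable]: "X n \<in> borel_measurable M" "Y n \<in> borel_measurable M" for n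
    using X Y by (auto simp: L1_conv_def)
  show ?thesis
  proof (rule L1_conv_dominated[where D = "\<lambda>n \<omega>. \<bar>X n \<omega> - x\<bar> + \<bar>Y n \<omega> - y\<bar>" and B = "B + C"])
    show "\<bar>X n \<omega> + Y n \<omega>\<bar> \<le> B + C" if "\<omega> \<in> space M" for n \<omega>
      using B[OF that, of n] C[OF that, of n] by linarith
    show "(\<lambda>n. \<integral>\<omega>. \<bar>X n \<omega> - x\<bar> + \<bar>Y n \<omega> - y\<bar> \<partial>M) \<longlonglongrightarrow> 0"
      using X Y tendsto_add[of "\<lambda>n. \<integral>\<omega>. \<bar>X n \<omega> - x\<bar> \<partial>M" 0 sequentially "\<lambda>n. \<integral>\<omega>. \<bar>Y n \<omega> - y\<bar> \<partial>M" 0]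
      by (simp add: L1_conv_integrable[OF X] L1_conv_integrable[OF Y] L1_conv_def)
  qed (auto intro!: Bochner_Integration.integrable_add L1_conv_integrable[OF X] L1_conv_integrable[OF Y])
qed

lemma L1_conv_mult:
  assumes X: "L1_conv X x" and Y: "L1_conv Y y"
  shows "L1_conv (\<lambda>n \<omega>. X n \<omega> * Y n \<omega>) (x * y)"
proof -
  obtain B where B: "\<And>n \<omega>. \<omega> \<in> space M \<Longrightarrow> \<bar>X n \<omega>\<bar> \<le> B" using X unfolding L1_conv_def by blast
  obtain C where C: "\<And>n \<omega>. \<omega> \<in> space M \<Longrightarrow> \<bar>Y n \<omega>\<bar> \<le> C" using Y unfolding L1_conv_def by blast
  have [measurable]: "X n \<in> borel_measurable M" "Y n \<in> borel_measurable M" for n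
    using X Y by (auto simp: L1_conv_def)
  show ?thesis
  proof (rule L1_conv_dominated[where D = "\<lambda>n \<omega>. \<bar>X n \<omega> - x\<bar> * \<bar>C\<bar> + \<bar>x\<bar> * \<bar>Y n \<omega> - y\<bar>" and B = "\<bar>B\<bar> * \<bar>C\<bar>"])
    fix n \<omega> assume \<omega>: "\<omega> \<in> space M"
    show "\<bar>X n \<omega> * Y n \<omega>\<bar> \<le> \<bar>B\<bar> * \<bar>C\<bar>"
      unfolding abs_mult using B[OF \<omega>, of n] C[OF \<omega>, of n] by (intro mult_mono) auto
    have "X n \<omega> * Y n \<omega> - x * y = (X n \<omega> - x) * Y n \<omega> + x * (Y n \<omega> - y)" by (simp add: algebra_simps)
    then have "\<bar>X n \<omega> * Y n \<omega> - x * y\<bar> \<le> \<bar>X n \<omega> - x\<bar> * \<bar>Y n \<omega>\<bar> + \<bar>x\<bar> * \<bar>Y n \<omega> - y\<bar>"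
      unfolding abs_mult[symmetric] by simp
    also have "\<bar>X n \<omega> - x\<bar> * \<bar>Y n \<omega>\<bar> \<le> \<bar>X n \<omega> - x\<bar> * \<bar>C\<bar>"
      using C[OF \<omega>, of n] by (intro mult_left_mono) auto
    finally show "\<bar>X n \<omega> * Y n \<omega> - x * y\<bar> \<le> \<bar>X n \<omega> - x\<bar> * \<bar>C\<bar> + \<bar>x\<bar> * \<bar>Y n \<omega> - y\<bar>" by simp
  next
    have "(\<lambda>n. (\<integral>\<omega>. \<bar>X n \<omega> - x\<bar> \<partial>M) * \<bar>C\<bar> + \<bar>x\<bar> * (\<integral>\<omega>. \<bar>Y n \<omega> - y\<bar> \<partial>M)) \<longlonglongrightarrow> 0 * \<bar>C\<bar> + \<bar>x\<bar> * 0"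
      using X Y unfolding L1_conv_def by (intro tendsto_intros) auto
    then show "(\<lambda>n. \<integral>\<omega>. \<bar>X n \<omega> - x\<bar> * \<bar>C\<bar> + \<bar>x\<bar> * \<bar>Y n \<omega> - y\<bar> \<partial>M) \<longlonglongrightarrow> 0"
      by (simp add: L1_conv_integrable[OF X] L1_conv_integrable[OF Y])
  qed (auto intro!: Bochner_Integration.integrable_add integrable_mult_left integrable_mult_right
        L1_conv_integrable[OF X] L1_conv_integrable[OF Y])
qed

lemma L1_conv_cmult: "L1_conv X x \<Longrightarrow> L1_conv (\<lambda>n \<omega>. c * X n \<omega>) (c * x)"
  by (rule L1_conv_mult[OF L1_conv_const]) simp

lemma L1_conv_sum:
  "finite A \<Longrightarrow> (\<And>i. i \<in> A \<Longrightarrow> L1_conv (X i) (x i)) \<Longrightarrow> L1_conv (\<lambda>n \<omega>. \<Sum>i\<in>A. X i n \<omega>) (\<Sum>i\<in>A. x i)"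
  by (induction A rule: finite_induct) (auto intro: L1_conv_add L1_conv_const)

end

section \<open>Convergence of the \<open>U_t\<close> and of the conditional covariances\<close>

context pa_model
begin

text \<open>The variance grows at most linearly, so the mean absolute deviation is
  \<open>o(n)\<close>; the mean itself is covered by \<open>mean_U_asymp\<close>.\<close>

lemma U_L1_conv:
  assumes t: "m \<le> t"
  shows "L1_conv (\<lambda>n \<omega>. U t n \<omega> / real n) (c_lim t / real m)"
proof (rule L1_conv_dominated[where B = "b_bound t"
      and D = "\<lambda>n \<omega>. \<bar>U t n \<omega> - mean_U t n\<bar> / real n + \<bar>mean_U t n / real n - c_lim t / real m\<bar>"])
  show "\<bar>U t n \<omega> / real n\<bar> \<le> b_bound t" for n \<omega>
    using U_bound[of t n \<omega>] b_bound_nonneg[of t] by (cases "n = 0") (auto simp: field_simps)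
  show "\<bar>U t n \<omega> / real n - c_lim t / real m\<bar>
      \<le> \<bar>U t n \<omega> - mean_U t n\<bar> / real n + \<bar>mean_U t n / real n - c_lim t / real m\<bar>" for n \<omega>
  proof -
    have "\<bar>U t n \<omega> - mean_U t n\<bar> / real n = \<bar>U t n \<omega> / real n - mean_U t n / real n\<bar>"
      by (simp add: diff_divide_distrib[symmetric] abs_divide)
    then show ?thesis by linarith
  qed
  have ev: "\<forall>\<^sub>F n in sequentially. var_U t (Suc n) \<le> var_U t n + (2 * b_bound t)\<^sup>2"
    using eventually_lam[OF t] eventually_ge_at_top[of "2 * m"]
    by eventually_elim (rule var_U_Suc; simp)
  have var: "(\<lambda>n. var_U t n / (real n)\<^sup>2) \<longlonglongrightarrow> 0"
    using ev by (rule linear_growth_div_square) (simp add: var_U_def)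
  have "(\<lambda>n. (\<integral>\<omega>. \<bar>U t n \<omega> - mean_U t n\<bar> \<partial>M) / real n) \<longlonglongrightarrow> 0"
  proof (rule Lim_null_comparison)
    show "(\<lambda>n. sqrt (var_U t n / (real n)\<^sup>2)) \<longlonglongrightarrow> 0" using tendsto_real_sqrt[OF var] by simp
    show "\<forall>\<^sub>F n in sequentially. norm ((\<integral>\<omega>. \<bar>U t n \<omega> - mean_U t n\<bar> \<partial>M) / real n) \<le> sqrt (var_U t n / (real n)\<^sup>2)"
    proof (intro always_eventually allI)
      fix n
      define X where "X \<omega> = \<bar>U t n \<omega> - mean_U t n\<bar>" for \<omega>
      have int: "integrable M X" unfolding X_def by simp
      have int2: "integrable M (\<lambda>\<omega>. (X \<omega>)\<^sup>2)" unfolding X_def using U_square_integrable by simp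
      \<comment> \<open>Nonnegativity of the variance of \<open>X\<close> is used as the inequality
        between its first and second moments.\<close>
      have "0 \<le> variance X" by (rule variance_positive)
      also have "variance X = expectation (\<lambda>\<omega>. (X \<omega>)\<^sup>2) - (expectation X)\<^sup>2" by (rule variance_eq[OF int int2])
      finally have "(expectation X)\<^sup>2 \<le> var_U t n" unfolding var_U_def X_def by simp
      then have "\<bar>expectation X\<bar> \<le> sqrt (var_U t n)" by (rule real_le_rsqrt[of "\<bar>expectation X\<bar>", simplified])
      then show "norm ((\<integral>\<omega>. \<bar>U t n \<omega> - mean_U t n\<bar> \<partial>M) / real n) \<le> sqrt (var_U t n / (real n)\<^sup>2)"
        unfolding X_def by (simp add: real_sqrt_divide divide_right_mono)
    qed
  qed
  moreover have "(\<lambda>n. \<bar>mean_U t n / real n - c_lim t / real m\<bar>) \<longlonglongrightarrow> 0"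
    using mean_U_asymp[OF t] by (intro tendsto_rabs_zero) (simp add: Lim_null[symmetric])
  ultimately have "(\<lambda>n. (\<integral>\<omega>. \<bar>U t n \<omega> - mean_U t n\<bar> \<partial>M) / real n + \<bar>mean_U t n / real n - c_lim t / real m\<bar>) \<longlonglongrightarrow> 0 + 0"
    by (rule tendsto_add)
  then show "(\<lambda>n. \<integral>\<omega>. \<bar>U t n \<omega> - mean_U t n\<bar> / real n + \<bar>mean_U t n / real n - c_lim t / real m\<bar> \<partial>M) \<longlonglongrightarrow> 0"
    by (simp add: prob_space)
qed auto

text \<open>The conditional covariance, given the past, of the increments of \<open>U_t1\<close> and
  \<open>U_t2\<close> at step n.\<close>

definition Q_step :: "nat \<Rightarrow> nat \<Rightarrow> nat \<Rightarrow> 'a \<Rightarrow> real" where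
  "Q_step t1 t2 n \<omega> = (\<Sum>v<n div m. weight n \<omega> v * (b_diff (dg (cfg \<omega>) n v) t1 * b_diff (dg (cfg \<omega>) n v) t2))
     - (\<Sum>v<n div m. weight n \<omega> v * b_diff (dg (cfg \<omega>) n v) t1) * (\<Sum>v<n div m. weight n \<omega> v * b_diff (dg (cfg \<omega>) n v) t2)"

lemma Q_step_measurable: "2 * m \<le> n \<Longrightarrow> Q_step t1 t2 n \<in> borel_measurable M"
proof -
  assume n: "2 * m \<le> n"
  note [measurable] = measurable_past[OF n b_diff_dg_measurable_past[OF n]] measurable_past[OF n weight_measurable_past[OF n]]
  show ?thesis unfolding Q_step_def[abs_def] by measurable
qed

lemma Q_step_bound:
  assumes \<omega>: "\<omega> \<in> space M" and n: "2 * m \<le> n"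
  shows "\<bar>Q_step t1 t2 n \<omega>\<bar> \<le> 8 * b_bound t1 * b_bound t2"
proof -
  have mean: "\<bar>\<Sum>v<n div m. weight n \<omega> v * z v\<bar> \<le> B" if "\<And>v. \<bar>z v\<bar> \<le> B" for z :: "nat \<Rightarrow> real" and B
  proof -
    have "\<bar>\<Sum>v<n div m. weight n \<omega> v * z v\<bar> \<le> (\<Sum>v<n div m. weight n \<omega> v * B)"
      using weight_nonneg[OF \<omega> n] that
      by (intro order_trans[OF sum_abs] sum_mono) (auto simp: abs_mult intro!: mult_left_mono)
    also have "\<dots> = B" by (simp add: sum_distrib_right[symmetric] sum_weight[OF \<omega> n])
    finally show ?thesis .
  qed
  have 1: "\<bar>\<Sum>v<n div m. weight n \<omega> v * (b_diff (dg (cfg \<omega>) n v) t1 * b_diff (dg (cfg \<omega>) n v) t2)\<bar> \<le> (2 * b_bound t1) * (2 * b_bound t2)"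
    by (rule mean, unfold abs_mult, intro mult_mono b_diff_bound) (simp_all add: b_bound_nonneg)
  have 2: "\<bar>(\<Sum>v<n div m. weight n \<omega> v * b_diff (dg (cfg \<omega>) n v) t1) * (\<Sum>v<n div m. weight n \<omega> v * b_diff (dg (cfg \<omega>) n v) t2)\<bar>
     \<le> (2 * b_bound t1) * (2 * b_bound t2)"
    unfolding abs_mult by (intro mult_mono mean b_diff_bound) (auto simp: b_bound_nonneg)
  show ?thesis unfolding Q_step_def
    by (rule order_trans[OF abs_triangle_ineq4 order_trans[OF add_mono[OF 1 2]]]) simp
qed

lemma Q_step_integrable: "2 * m \<le> n \<Longrightarrow> integrable M (Q_step t1 t2 n)"
  by (rule integrable_const_bound[of _ "8 * b_bound t1 * b_bound t2"])
     (auto intro: Q_step_bound Q_step_measurable)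

text \<open>The right side is a polynomial in \<open>U t n / n\<close> and
  \<open>n / total_weight n\<close>, whose limits are known. Since \<open>b_diff\<close> vanishes
  above \<open>t1\<close>, the first sum is a finite combination of degree counts, and
  \<open>weighted_b_diff\<close> handles the product of means.\<close>

lemma Q_step_eq:
  assumes \<omega>: "\<omega> \<in> space M" and n: "2 * m \<le> n"
  shows "Q_step t1 t2 n \<omega> = (\<Sum>k=m..t1. (real k + \<delta>) * (b_diff k t1 * b_diff k t2) *
       ((\<Sum>t=m..k. b_abs t k * (U t n \<omega> / real n)) * (real n / total_weight n)))
     + (- ((real t1 + \<delta>) * (real t2 + \<delta>))) * (((U t1 n \<omega> / real n) * (U t2 n \<omega> / real n)) * (real n / total_weight n)\<^sup>2)"
proof -
  let ?w = "\<lambda>k. (\<Sum>t=m..k. b_abs t k * (U t n \<omega> / real n))"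
  have pos: "real n > 0" "total_weight n > 0" using n m_pos total_weight_pos by auto
  have "(\<Sum>v<n div m. weight n \<omega> v * (b_diff (dg (cfg \<omega>) n v) t1 * b_diff (dg (cfg \<omega>) n v) t2))
      = lin_stat (\<lambda>d. (real d + \<delta>) * (b_diff d t1 * b_diff d t2)) (cfg \<omega>) n / total_weight n"
    by (rule weighted_degree_sum[of n \<omega> "\<lambda>d. b_diff d t1 * b_diff d t2"])
  also have "\<dots> = (\<Sum>k=m..t1. (real k + \<delta>) * (b_diff k t1 * b_diff k t2) * (\<Sum>t=m..k. b_abs t k * U t n \<omega>)) / total_weight n"
    by (subst lin_stat_finite_support[OF valid_cfg[OF \<omega>] n, of t1])
       (auto simp: b_diff_eq_0 lin_stat_indicator_eq[OF valid_cfg[OF \<omega>] n] U_def)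
  also have "\<dots> = (\<Sum>k=m..t1. (real k + \<delta>) * (b_diff k t1 * b_diff k t2) *
       (?w k * (real n / total_weight n)))"
    unfolding sum_divide_distrib
  proof (intro sum.cong refl)
    fix k
    have "?w k = (\<Sum>t=m..k. b_abs t k * U t n \<omega>) / real n"
      by (simp add: sum_divide_distrib)
    then show "(real k + \<delta>) * (b_diff k t1 * b_diff k t2) * (\<Sum>t=m..k. b_abs t k * U t n \<omega>) / total_weight n
        = (real k + \<delta>) * (b_diff k t1 * b_diff k t2) * (?w k * (real n / total_weight n))"
      using pos by simp
  qed
  finally have 1: "(\<Sum>v<n div m. weight n \<omega> v * (b_diff (dg (cfg \<omega>) n v) t1 * b_diff (dg (cfg \<omega>) n v) t2)) = \<dots>" .
  have 2: "- (- a1 / w * u1 * (- a2 / w * u2)) = - (a1 * a2) * (u1 / x * (u2 / x) * (x / w)\<^sup>2)" if "x > 0" "w > 0"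
    for a1 a2 u1 u2 x w :: real
    using that by (simp add: power2_eq_square)
  show ?thesis
    unfolding Q_step_def 1 weighted_b_diff diff_conv_add_uminus 2[OF pos] ..
qed

lemma Q_step_L1_conv:
  assumes t: "m \<le> t1" "m \<le> t2"
  shows "(\<lambda>n. \<integral>\<omega>. \<bar>Q_step t1 t2 n \<omega> - Q_lim t1 t2\<bar> \<partial>M) \<longlonglongrightarrow> 0"
proof -
  define X where "X n \<omega> = (\<Sum>k=m..t1. (real k + \<delta>) * (b_diff k t1 * b_diff k t2) *
       ((\<Sum>t=m..k. b_abs t k * (U t n \<omega> / real n)) * (real n / total_weight n)))
     + (- ((real t1 + \<delta>) * (real t2 + \<delta>))) * (((U t1 n \<omega> / real n) * (U t2 n \<omega> / real n)) * (real n / total_weight n)\<^sup>2)" for n \<omega>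
  define x where "x = (\<Sum>k=m..t1. (real k + \<delta>) * (b_diff k t1 * b_diff k t2) *
       ((\<Sum>t=m..k. b_abs t k * (c_lim t / real m)) * (1 / \<theta>)))
     + (- ((real t1 + \<delta>) * (real t2 + \<delta>))) * (((c_lim t1 / real m) * (c_lim t2 / real m)) * (1 / \<theta>)\<^sup>2)"
  have "L1_conv X x"
    unfolding X_def[abs_def] x_def
    by (intro L1_conv_add L1_conv_sum L1_conv_cmult L1_conv_mult L1_conv_const U_L1_conv t
        tendsto_power inverse_total_weight_asymp) auto
  then have "(\<lambda>n. \<integral>\<omega>. \<bar>X n \<omega> - x\<bar> \<partial>M) \<longlonglongrightarrow> 0" by (simp add: L1_conv_def)
  moreover have "x = Q_lim t1 t2"
  proof -
    have "(\<Sum>t=m..k. b_abs t k * (c_lim t / real m)) * (1 / \<theta>) = p k / (2 * real m + \<delta>)" if "m \<le> k" for k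
    proof -
      have "(\<Sum>t=m..k. b_abs t k * (c_lim t / real m)) = p k / real m"
        using sum_b_abs_c_lim[OF that] by (simp add: sum_divide_distrib[symmetric])
      then show ?thesis by (simp add: m_theta[symmetric])
    qed
    then have "x = (\<Sum>k=m..t1. (real k + \<delta>) * (b_diff k t1 * b_diff k t2) * (p k / (2 * real m + \<delta>)))
      + (- ((real t1 + \<delta>) * (real t2 + \<delta>))) * (((c_lim t1 / real m) * (c_lim t2 / real m)) * (1 / \<theta>)\<^sup>2)"
      unfolding x_def by simp
    then show ?thesis
      unfolding Q_lim_def m_theta[symmetric] by (simp add: sum_divide_distrib power2_eq_square mult_ac)
  qed
  moreover have "\<forall>\<^sub>F n in sequentially. (\<integral>\<omega>. \<bar>X n \<omega> - x\<bar> \<partial>M) = (\<integral>\<omega>. \<bar>Q_step t1 t2 n \<omega> - x\<bar> \<partial>M)"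
    using eventually_ge_at_top[of "2 * m"]
    by eventually_elim (intro Bochner_Integration.integral_cong refl, simp add: Q_step_eq X_def)
  ultimately show ?thesis using Lim_transform_eventually by auto
qed

end

section \<open>Characteristic functions\<close>

lemma norm_integral_le:
  fixes f :: "'a \<Rightarrow> 'b :: {banach, second_countable_topology}"
  assumes "integrable M f" "integrable M g" "\<And>x. x \<in> space M \<Longrightarrow> norm (f x) \<le> g x"
  shows "norm (\<integral>x. f x \<partial>M) \<le> (\<integral>x. g x \<partial>M)"
  by (rule order_trans[OF integral_norm_bound integral_mono]) (use assms in auto)

context pa_model
begin

definition quad :: "nat \<Rightarrow> (nat \<Rightarrow> real) \<Rightarrow> (nat \<Rightarrow> nat \<Rightarrow> real) \<Rightarrow> real" where
  "quad K \<alpha> Q = (\<Sum>t1=m..K. \<Sum>t2=m..K. \<alpha> t1 * \<alpha> t2 * Q t1 t2)"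

text \<open>It controls, in mean, how far the conditional variance of a linear combination with
  bounded coefficients is from its limit.\<close>

definition eta :: "nat \<Rightarrow> nat \<Rightarrow> real" where
  "eta K n = (\<Sum>t1=m..K. \<Sum>t2=m..K. \<integral>\<omega>. \<bar>Q_step t1 t2 n \<omega> - Q_lim t1 t2\<bar> \<partial>M)"

lemma eta_nonneg: "0 \<le> eta K n"
  unfolding eta_def by (intro sum_nonneg integral_nonneg) auto

lemma eta_tendsto: "eta K \<longlonglongrightarrow> 0"
proof -
  have "eta K \<longlonglongrightarrow> (\<Sum>t1=m..K. \<Sum>t2=m..K. 0)"
    unfolding eta_def[abs_def] by (intro tendsto_sum Q_step_L1_conv) auto
  then show ?thesis by simp
qed

lemma quad_bound:
  assumes A: "\<And>t. t \<in> {m..K} \<Longrightarrow> \<bar>\<alpha> t\<bar> \<le> A"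
  shows "\<bar>quad K \<alpha> Q\<bar> \<le> A\<^sup>2 * (\<Sum>t1=m..K. \<Sum>t2=m..K. \<bar>Q t1 t2\<bar>)"
proof -
  have "\<bar>quad K \<alpha> Q\<bar> \<le> (\<Sum>t1=m..K. \<Sum>t2=m..K. \<bar>\<alpha> t1 * \<alpha> t2 * Q t1 t2\<bar>)"
    unfolding quad_def by (intro order_trans[OF sum_abs] sum_mono sum_abs)
  also have "\<dots> \<le> (\<Sum>t1=m..K. \<Sum>t2=m..K. A\<^sup>2 * \<bar>Q t1 t2\<bar>)"
  proof (intro sum_mono)
    fix t1 t2 assume t: "t1 \<in> {m..K}" "t2 \<in> {m..K}"
    have "\<bar>\<alpha> t1\<bar> * \<bar>\<alpha> t2\<bar> \<le> A * A" using A[OF t(1)] A[OF t(2)] by (intro mult_mono) auto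
    then show "\<bar>\<alpha> t1 * \<alpha> t2 * Q t1 t2\<bar> \<le> A\<^sup>2 * \<bar>Q t1 t2\<bar>"
      unfolding abs_mult power2_eq_square by (rule mult_right_mono) simp
  qed
  finally show ?thesis by (simp add: sum_distrib_left)
qed

lemma quad_diff: "quad K \<alpha> Q - quad K \<alpha> Q' = quad K \<alpha> (\<lambda>t1 t2. Q t1 t2 - Q' t1 t2)"
  unfolding quad_def by (simp add: sum_subtractf right_diff_distrib)

definition increment :: "nat \<Rightarrow> (nat \<Rightarrow> real) \<Rightarrow> nat \<Rightarrow> 'a \<Rightarrow> nat \<Rightarrow> real" where
  "increment K \<alpha> n \<omega> v = (\<Sum>t=m..K. \<alpha> t * b_diff (dg (cfg \<omega>) n v) t)"

lemma increment_bound: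
  assumes A: "\<And>t. t \<in> {m..K} \<Longrightarrow> \<bar>\<alpha> t\<bar> \<le> A"
  shows "\<bar>increment K \<alpha> n \<omega> v\<bar> \<le> A * (\<Sum>t=m..K. 2 * b_bound t)"
proof -
  have "\<bar>increment K \<alpha> n \<omega> v\<bar> \<le> (\<Sum>t=m..K. A * (2 * b_bound t))"
    unfolding increment_def
    using A b_diff_bound
    by (intro order_trans[OF sum_abs] sum_mono, unfold abs_mult, intro mult_mono)
       (auto intro: order_trans[OF abs_ge_zero])
  then show ?thesis by (simp add: sum_distrib_left)
qed

lemma increment_measurable_past:
  "2 * m \<le> n \<Longrightarrow> (\<lambda>\<omega>. increment K \<alpha> n \<omega> v) \<in> borel_measurable (past n)"
proof -
  assume n: "2 * m \<le> n"
  note [measurable] = b_diff_dg_measurable_past[OF n]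
  show ?thesis unfolding increment_def by measurable
qed

lemma increment_mean:
  "(\<Sum>v<n div m. weight n \<omega> v * increment K \<alpha> n \<omega> v)
   = (\<Sum>t=m..K. \<alpha> t * (\<Sum>v<n div m. weight n \<omega> v * b_diff (dg (cfg \<omega>) n v) t))"
  unfolding increment_def sum_distrib_left by (subst sum.swap) (simp add: mult_ac)

lemma increment_variance:
  "(\<Sum>v<n div m. weight n \<omega> v * (increment K \<alpha> n \<omega> v)\<^sup>2) - (\<Sum>v<n div m. weight n \<omega> v * increment K \<alpha> n \<omega> v)\<^sup>2
   = quad K \<alpha> (\<lambda>t1 t2. Q_step t1 t2 n \<omega>)"
proof -
  let ?bb = "\<lambda>v t1 t2. (b_diff (dg (cfg \<omega>) n v) t1 * b_diff (dg (cfg \<omega>) n v) t2)"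
  have 1: "(\<Sum>v<n div m. weight n \<omega> v * (increment K \<alpha> n \<omega> v)\<^sup>2)
     = (\<Sum>t1=m..K. \<Sum>t2=m..K. \<alpha> t1 * \<alpha> t2 *
         (\<Sum>v<n div m. weight n \<omega> v * ?bb v t1 t2))"
  proof -
    have "(\<Sum>v<n div m. weight n \<omega> v * (increment K \<alpha> n \<omega> v)\<^sup>2)
       = (\<Sum>v<n div m. \<Sum>t1=m..K. \<Sum>t2=m..K. \<alpha> t1 * \<alpha> t2 *
         (weight n \<omega> v * ?bb v t1 t2))"
      unfolding increment_def power2_eq_square sum_product
      by (simp add: sum_distrib_left mult_ac)
    also have "\<dots> = (\<Sum>t1=m..K. \<Sum>v<n div m. \<Sum>t2=m..K. \<alpha> t1 * \<alpha> t2 *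
         (weight n \<omega> v * ?bb v t1 t2))"
      by (rule sum.swap)
    also have "\<dots> = (\<Sum>t1=m..K. \<Sum>t2=m..K. \<Sum>v<n div m. \<alpha> t1 * \<alpha> t2 *
         (weight n \<omega> v * ?bb v t1 t2))"
      by (intro sum.cong refl sum.swap)
    finally show ?thesis by (simp add: sum_distrib_left)
  qed
  define C where "C t1 t2 = (\<Sum>v<n div m. weight n \<omega> v * ?bb v t1 t2)" for t1 t2
  define B where "B t = (\<Sum>v<n div m. weight n \<omega> v * b_diff (dg (cfg \<omega>) n v) t)" for t
  have "(\<Sum>t=m..K. \<alpha> t * B t)\<^sup>2 = (\<Sum>t1=m..K. \<Sum>t2=m..K. \<alpha> t1 * \<alpha> t2 * (B t1 * B t2))"
    unfolding power2_eq_square sum_product by (simp add: mult_ac)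
  then show ?thesis
    unfolding increment_mean 1 quad_def Q_step_def C_def[symmetric] B_def[symmetric]
    by (simp add: sum_subtractf right_diff_distrib)
qed

lemma quad_Q_step_nonneg:
  assumes \<omega>: "\<omega> \<in> space M" and n: "2 * m \<le> n"
  shows "0 \<le> quad K \<alpha> (\<lambda>t1 t2. Q_step t1 t2 n \<omega>)"
proof -
  define P z where "P = weight n \<omega>" and "z = increment K \<alpha> n \<omega>"
  define \<mu> where "\<mu> = (\<Sum>v<n div m. P v * z v)"
  have P1: "(\<Sum>v<n div m. P v) = 1" using sum_weight[OF \<omega> n] by (simp add: P_def)
  have "0 \<le> (\<Sum>v<n div m. P v * (z v - \<mu>)\<^sup>2)"
    using weight_nonneg[OF \<omega> n] by (intro sum_nonneg mult_nonneg_nonneg) (auto simp: P_def)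
  also have "\<dots> = (\<Sum>v<n div m. P v * (z v)\<^sup>2 - 2 * \<mu> * (P v * z v) + \<mu>\<^sup>2 * P v)"
    by (intro sum.cong refl) (simp add: power2_eq_square algebra_simps)
  also have "\<dots> = (\<Sum>v<n div m. P v * (z v)\<^sup>2) - \<mu>\<^sup>2"
    by (simp add: sum.distrib sum_subtractf sum_distrib_left[symmetric] P1 \<mu>_def[symmetric] power2_eq_square)
  also have "\<dots> = quad K \<alpha> (\<lambda>t1 t2. Q_step t1 t2 n \<omega>)"
    unfolding increment_variance[symmetric] P_def z_def \<mu>_def ..
  finally show ?thesis .
qed

lemma quad_Q_step_diff:
  assumes "\<And>t. t \<in> {m..K} \<Longrightarrow> \<bar>\<alpha> t\<bar> \<le> A"
  shows "\<bar>quad K \<alpha> (\<lambda>t1 t2. Q_step t1 t2 n \<omega>) - quad K \<alpha> Q_lim\<bar>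
     \<le> A\<^sup>2 * (\<Sum>t1=m..K. \<Sum>t2=m..K. \<bar>Q_step t1 t2 n \<omega> - Q_lim t1 t2\<bar>)"
  unfolding quad_diff by (rule quad_bound[OF assms])

lemma integral_Q_step_diff:
  assumes "2 * m \<le> n"
  shows "integrable M (\<lambda>\<omega>. \<Sum>t1=m..K. \<Sum>t2=m..K. \<bar>Q_step t1 t2 n \<omega> - Q_lim t1 t2\<bar>)"
    and "(\<integral>\<omega>. (\<Sum>t1=m..K. \<Sum>t2=m..K. \<bar>Q_step t1 t2 n \<omega> - Q_lim t1 t2\<bar>) \<partial>M) = eta K n"
  unfolding eta_def using Q_step_integrable[OF assms] by simp_all

text \<open>\<open>Q_lim\<close> is a limit in mean of conditional covariance matrices.
  Nonnegativity is a hypothesis of \<open>iexp_mean_approx\<close> and keeps the Gaussian factors in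
  \<open>char_approx\<close> at most 1.\<close>

lemma quad_Q_lim_nonneg: "0 \<le> quad K \<alpha> Q_lim"
proof -
  define A where "A = (\<Sum>t=m..K. \<bar>\<alpha> t\<bar>)"
  have A: "\<bar>\<alpha> t\<bar> \<le> A" if "t \<in> {m..K}" for t
    unfolding A_def using that by (intro member_le_sum) auto
  have "- (A\<^sup>2 * eta K n) \<le> quad K \<alpha> Q_lim" if n: "2 * m \<le> n" for n
  proof -
    have "(\<integral>\<omega>. - (A\<^sup>2 * (\<Sum>t1=m..K. \<Sum>t2=m..K. \<bar>Q_step t1 t2 n \<omega> - Q_lim t1 t2\<bar>)) \<partial>M) \<le> (\<integral>\<omega>. quad K \<alpha> Q_lim \<partial>M)"
    proof (rule integral_mono)
      fix \<omega> assume "\<omega> \<in> space M"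
      with quad_Q_step_nonneg[OF this n, of K \<alpha>] quad_Q_step_diff[of K \<alpha> A n \<omega>, OF A]
      show "- (A\<^sup>2 * (\<Sum>t1=m..K. \<Sum>t2=m..K. \<bar>Q_step t1 t2 n \<omega> - Q_lim t1 t2\<bar>)) \<le> quad K \<alpha> Q_lim"
        by linarith
    qed (use integral_Q_step_diff[OF n] in auto)
    then show ?thesis using integral_Q_step_diff[OF n, of K] by (simp add: prob_space)
  qed
  moreover have "(\<lambda>n. - (A\<^sup>2 * eta K n)) \<longlonglongrightarrow> - (A\<^sup>2 * 0)" by (intro tendsto_intros eta_tendsto)
  ultimately show ?thesis using LIMSEQ_le_const2[of "\<lambda>n. - (A\<^sup>2 * eta K n)" 0] by auto
qed

definition phi :: "nat \<Rightarrow> (nat \<Rightarrow> real) \<Rightarrow> real \<Rightarrow> nat \<Rightarrow> complex" where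
  "phi K \<alpha> h n = (\<integral>\<omega>. iexp (h * (\<Sum>t=m..K. \<alpha> t * (U t n \<omega> - mean_U t n))) \<partial>M)"

text \<open>At step \<open>Suc n\<close> the statistic is \<open>Y\<close>, which belongs to the
  past and has coefficients \<open>lam t n * \<alpha> t\<close>, plus the increment minus its
  conditional mean. Conditioning factors out \<open>iexp (h * Y)\<close>, and
  \<open>iexp_mean_approx\<close> replaces the remaining factor \<open>S\<close> by a
  constant.\<close>

lemma char_step:
  assumes n: "2 * m \<le> n" and "0 \<le> h" and A: "\<And>t. t \<in> {m..K} \<Longrightarrow> \<bar>\<alpha> t\<bar> \<le> A"
  defines "B \<equiv> A * (\<Sum>t=m..K. 2 * b_bound t)"
  shows "norm (phi K \<alpha> h (Suc n) - of_real (exp (- (h\<^sup>2 * quad K \<alpha> Q_lim / 2))) * phi K (\<lambda>t. lam t n * \<alpha> t) h n)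
    \<le> (2 * h * B) ^ 3 / 6 + h\<^sup>2 / 2 * (A\<^sup>2 * eta K n) + (h\<^sup>2 * quad K \<alpha> Q_lim)\<^sup>2 / 8"
proof -
  let ?D = "\<lambda>\<omega>. (\<Sum>t1=m..K. \<Sum>t2=m..K. \<bar>Q_step t1 t2 n \<omega> - Q_lim t1 t2\<bar>)"
  define q where "q = quad K \<alpha> Q_lim"
  define Y where "Y \<omega> = (\<Sum>t=m..K. lam t n * \<alpha> t * (U t n \<omega> - mean_U t n))" for \<omega>
  define z where "z = increment K \<alpha> n"
  define \<mu> where "\<mu> \<omega> = (\<Sum>v<n div m. weight n \<omega> v * z \<omega> v)" for \<omega>
  define S where "S \<omega> = (\<Sum>v<n div m. of_real (weight n \<omega> v) * iexp (h * (z \<omega> v - \<mu> \<omega>)))" for \<omega>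
  have zm [measurable]: "(\<lambda>\<omega>. z \<omega> v) \<in> borel_measurable (past n)" for v
    unfolding z_def by (rule increment_measurable_past[OF n])
  note [measurable] = U_measurable_past[OF n] weight_measurable_past[OF n]
  have Ym [measurable]: "Y \<in> borel_measurable (past n)" and \<mu>m [measurable]: "\<mu> \<in> borel_measurable (past n)"
    unfolding Y_def[abs_def] \<mu>_def[abs_def] by measurable
  have Sm [measurable]: "S \<in> borel_measurable (past n)"
    unfolding S_def[abs_def] by measurable
  have "phi K \<alpha> h (Suc n) = (\<integral>\<omega>. iexp (h * (Y \<omega> + (z \<omega> (tgt (cfg \<omega>) n) - \<mu> \<omega>))) \<partial>M)"
    unfolding phi_def
  proof (intro Bochner_Integration.integral_cong refl arg_cong[of _ _ "\<lambda>x. iexp (h * x)"])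
    fix \<omega> assume \<omega>: "\<omega> \<in> space M"
    have e: "U t (Suc n) \<omega> - mean_U t (Suc n) = lam t n * (U t n \<omega> - mean_U t n)
        + (b_diff (dg (cfg \<omega>) n (tgt (cfg \<omega>) n)) t - (\<Sum>v<n div m. weight n \<omega> v * b_diff (dg (cfg \<omega>) n v) t))" for t
      using weighted_b_diff_lam[where t = t and n = n and \<omega> = \<omega>]
      unfolding U_Suc[OF \<omega> n] mean_U_Suc[OF n] by (simp add: algebra_simps)
    show "(\<Sum>t=m..K. \<alpha> t * (U t (Suc n) \<omega> - mean_U t (Suc n))) = Y \<omega> + (z \<omega> (tgt (cfg \<omega>) n) - \<mu> \<omega>)"
      unfolding e Y_def \<mu>_def z_def increment_mean unfolding increment_def
      by (simp add: sum.distrib sum_subtractf algebra_simps)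
  qed
  also have "\<dots> = (\<integral>\<omega>. (\<Sum>v<n div m. of_real (weight n \<omega> v) * iexp (h * (Y \<omega> + (z \<omega> v - \<mu> \<omega>)))) \<partial>M)"
    by (rule attachment_integral_complex[OF n, where B = 1]) auto
  also have "\<dots> = (\<integral>\<omega>. iexp (h * Y \<omega>) * S \<omega> \<partial>M)"
    unfolding S_def sum_distrib_left
    by (intro Bochner_Integration.integral_cong refl sum.cong) (simp add: distrib_left exp_add mult_ac)
  finally have phi_Suc: "phi K \<alpha> h (Suc n) = (\<integral>\<omega>. iexp (h * Y \<omega>) * S \<omega> \<partial>M)" .
  have YM [measurable]: "Y \<in> borel_measurable M" and SM [measurable]: "S \<in> borel_measurable M"
    using measurable_past[OF n Ym] measurable_past[OF n Sm] by auto
  have S_bound: "norm (S \<omega>) \<le> 1" if \<omega>: "\<omega> \<in> space M" for \<omega>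
  proof -
    have "norm (S \<omega>) \<le> (\<Sum>v<n div m. weight n \<omega> v)"
      unfolding S_def using weight_nonneg[OF \<omega> n] by (intro sum_norm_le) (simp add: norm_mult)
    then show ?thesis by (simp add: sum_weight[OF \<omega> n])
  qed
  have int1: "integrable M (\<lambda>\<omega>. iexp (h * Y \<omega>) * S \<omega>)"
    by (rule integrable_const_bound[of _ 1]) (auto simp: norm_mult S_bound)
  have int2: "integrable M (\<lambda>\<omega>. iexp (h * Y \<omega>))"
    by (rule integrable_iexp) auto
  have diff: "phi K \<alpha> h (Suc n) - of_real (exp (- (h\<^sup>2 * q / 2))) * phi K (\<lambda>t. lam t n * \<alpha> t) h n
     = (\<integral>\<omega>. iexp (h * Y \<omega>) * (S \<omega> - of_real (exp (- (h\<^sup>2 * q / 2)))) \<partial>M)"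
  proof -
    have "phi K (\<lambda>t. lam t n * \<alpha> t) h n = (\<integral>\<omega>. iexp (h * Y \<omega>) \<partial>M)" unfolding phi_def Y_def ..
    then show ?thesis unfolding phi_Suc using int1 int2 by (simp add: right_diff_distrib mult.commute)
  qed
  have "norm (\<integral>\<omega>. iexp (h * Y \<omega>) * (S \<omega> - of_real (exp (- (h\<^sup>2 * q / 2)))) \<partial>M)
      \<le> (\<integral>\<omega>. ((2 * h * B) ^ 3 / 6 + (h\<^sup>2 * q)\<^sup>2 / 8) + h\<^sup>2 / 2 * (A\<^sup>2 *
      ?D \<omega>) \<partial>M)"
  proof (rule norm_integral_le)
    show "integrable M (\<lambda>\<omega>. iexp (h * Y \<omega>) * (S \<omega> - of_real (exp (- (h\<^sup>2 * q / 2)))))"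
      using int1 int2 by (simp add: right_diff_distrib)
    show "integrable M (\<lambda>\<omega>. ((2 * h * B) ^ 3 / 6 + (h\<^sup>2 * q)\<^sup>2 / 8) + h\<^sup>2 / 2 * (A\<^sup>2 *
      ?D \<omega>))"
      using integral_Q_step_diff(1)[OF n] by simp
    fix \<omega> assume \<omega>: "\<omega> \<in> space M"
    have "norm (iexp (h * Y \<omega>) * (S \<omega> - of_real (exp (- (h\<^sup>2 * q / 2))))) = norm (S \<omega> - of_real (exp (- (h\<^sup>2 * q / 2))))"
      by (simp add: norm_mult)
    also have "\<dots> \<le> (2 * h * B) ^ 3 / 6 + h\<^sup>2 / 2 * \<bar>(\<Sum>v<n div m. weight n \<omega> v * (z \<omega> v)\<^sup>2) - (\<mu> \<omega>)\<^sup>2 - q\<bar> + (h\<^sup>2 * q)\<^sup>2 / 8"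
      unfolding S_def \<mu>_def
      by (rule iexp_mean_approx) (use weight_nonneg[OF \<omega> n] sum_weight[OF \<omega> n] increment_bound[OF A] \<open>0 \<le> h\<close>
            quad_Q_lim_nonneg in \<open>auto simp: z_def B_def q_def\<close>)
    also have "(\<Sum>v<n div m. weight n \<omega> v * (z \<omega> v)\<^sup>2) - (\<mu> \<omega>)\<^sup>2 = quad K \<alpha> (\<lambda>t1 t2. Q_step t1 t2 n \<omega>)"
      unfolding \<mu>_def z_def by (rule increment_variance)
    also have "h\<^sup>2 / 2 * \<bar>quad K \<alpha> (\<lambda>t1 t2. Q_step t1 t2 n \<omega>) - q\<bar>
        \<le> h\<^sup>2 / 2 * (A\<^sup>2 * ?D \<omega>)"
      unfolding q_def by (intro mult_left_mono quad_Q_step_diff A) auto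
    finally show "norm (iexp (h * Y \<omega>) * (S \<omega> - of_real (exp (- (h\<^sup>2 * q / 2)))))
       \<le> ((2 * h * B) ^ 3 / 6 + (h\<^sup>2 * q)\<^sup>2 / 8) + h\<^sup>2 / 2 * (A\<^sup>2 *
      ?D \<omega>)" by simp
  qed
  also have "\<dots> = (2 * h * B) ^ 3 / 6 + h\<^sup>2 / 2 * (A\<^sup>2 * eta K n) + (h\<^sup>2 * q)\<^sup>2 / 8"
    using integral_Q_step_diff[OF n, of K] by (simp add: prob_space)
  finally show ?thesis unfolding diff q_def[symmetric] .
qed

text \<open>The covariance of the Gaussian approximation accumulated since step \<open>n0\<close>.
  The start is a step from which on \<open>0 \<le> lam t n \<le> 1\<close>, and up to it the value
  is 0.\<close>

fun gram :: "nat \<Rightarrow> nat \<Rightarrow> nat \<Rightarrow> nat \<Rightarrow> real" where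
  "gram n0 t1 t2 0 = 0"
| "gram n0 t1 t2 (Suc n) = (if n0 \<le> n then lam t1 n * lam t2 n * gram n0 t1 t2 n + Q_lim t1 t2 else 0)"

lemma gram_start: "gram n0 t1 t2 n0 = 0"
  by (cases n0) auto

lemma quad_gram_Suc:
  "n0 \<le> n \<Longrightarrow> quad K \<alpha> (\<lambda>t1 t2. gram n0 t1 t2 (Suc n))
    = quad K (\<lambda>t. lam t n * \<alpha> t) (\<lambda>t1 t2. gram n0 t1 t2 n) + quad K \<alpha> Q_lim"
  unfolding quad_def by (simp add: sum.distrib distrib_left mult_ac)

text \<open>
  Going one step back turns the coefficients \<open>\<alpha>\<^sub>t\<close> into \<open>\<lambda>\<^sub>t \<alpha>\<^sub>t\<close>; hence the induction is over the
  number of steps with arbitrary coefficients of bounded size.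
\<close>

lemma char_approx:
  assumes n0: "2 * m \<le> n0" "\<And>n t. n0 \<le> n \<Longrightarrow> t \<in> {m..K} \<Longrightarrow> 0 \<le> lam t n \<and> lam t n \<le> 1"
    and "0 \<le> h" and "n0 \<le> n" and A: "\<And>t. t \<in> {m..K} \<Longrightarrow> \<bar>\<alpha> t\<bar> \<le> A"
  defines "B \<equiv> A * (\<Sum>t=m..K. 2 * b_bound t)"
  defines "C \<equiv> A\<^sup>2 * (\<Sum>t1=m..K. \<Sum>t2=m..K. \<bar>Q_lim t1 t2\<bar>)"
  shows "norm (phi K \<alpha> h n - of_real (exp (- (h\<^sup>2 * quad K \<alpha> (\<lambda>t1 t2. gram n0 t1 t2 n) / 2))))
    \<le> h * (B * real n0) + (\<Sum>j=n0..<n. (2 * h * B) ^ 3 / 6 + h\<^sup>2 / 2 * (A\<^sup>2 * eta K j) + (h\<^sup>2 * C)\<^sup>2 / 8)"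
  using \<open>n0 \<le> n\<close> A
proof (induction n arbitrary: \<alpha> rule: dec_induct)
  case base
  \<comment> \<open>At \<open>n0\<close> the Gaussian factor is 1. The error is at most
    \<open>|h Y|\<close>; with \<open>n0\<close> fixed it carries one power of h and so disappears
    in the limit.\<close>
  define Y where "Y \<omega> = (\<Sum>t=m..K. \<alpha> t * (U t n0 \<omega> - mean_U t n0))" for \<omega>
  have Y: "\<bar>Y \<omega>\<bar> \<le> B * real n0" for \<omega>
  proof -
    have "\<bar>Y \<omega>\<bar> \<le> (\<Sum>t=m..K. A * (2 * b_bound t * real n0))"
      unfolding Y_def
    proof (intro order_trans[OF sum_abs] sum_mono, unfold abs_mult, intro mult_mono)
      fix t assume t: "t \<in> {m..K}"
      show "\<bar>\<alpha> t\<bar> \<le> A" "0 \<le> A" using base(1)[OF t] by auto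
      show "\<bar>U t n0 \<omega> - mean_U t n0\<bar> \<le> 2 * b_bound t * real n0"
        using U_bound[of t n0 \<omega>] mean_U_bound[of t n0] by linarith
    qed auto
    then show ?thesis by (simp add: B_def sum_distrib_left sum_distrib_right mult_ac)
  qed
  have Ym [measurable]: "Y \<in> borel_measurable M" unfolding Y_def[abs_def] by measurable
  have int: "integrable M (\<lambda>\<omega>. iexp (h * Y \<omega>))" by (rule integrable_iexp) auto
  have "quad K \<alpha> (\<lambda>t1 t2. gram n0 t1 t2 n0) = 0" by (simp add: quad_def gram_start)
  then have diff: "phi K \<alpha> h n0 - of_real (exp (- (h\<^sup>2 * quad K \<alpha> (\<lambda>t1 t2. gram n0 t1 t2 n0) / 2)))
     = (\<integral>\<omega>. iexp (h * Y \<omega>) - 1 \<partial>M)"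
    unfolding phi_def Y_def[symmetric] using int by (simp add: prob_space)
  have "norm (\<integral>\<omega>. iexp (h * Y \<omega>) - 1 \<partial>M) \<le> (\<integral>\<omega>. h * (B * real n0) \<partial>M)"
  proof (rule norm_integral_le)
    show "integrable M (\<lambda>\<omega>. iexp (h * Y \<omega>) - 1)"
      by (rule Bochner_Integration.integrable_diff[OF int]) simp
    show "integrable M (\<lambda>\<omega>. h * (B * real n0))" by simp
    fix \<omega>
    have "norm (iexp (h * Y \<omega>) - 1) \<le> \<bar>h * Y \<omega>\<bar>"
      using iexp_approx1[of "h * Y \<omega>" 0] by simp
    also have "\<dots> \<le> h * (B * real n0)"
      unfolding abs_mult using Y[of \<omega>] \<open>0 \<le> h\<close> by (simp add: mult_left_mono)
    finally show "norm (iexp (h * Y \<omega>) - 1) \<le> h * (B * real n0)" .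
  qed
  then show ?case unfolding diff by (simp add: prob_space)
next
  case (step n)
  define \<alpha>' where "\<alpha>' t = lam t n * \<alpha> t" for t
  define e where "e = complex_of_real (exp (- (h\<^sup>2 * quad K \<alpha> Q_lim / 2)))"
  define g where "g = complex_of_real (exp (- (h\<^sup>2 * quad K \<alpha>' (\<lambda>t1 t2. gram n0 t1 t2 n) / 2)))"
  have \<alpha>': "\<bar>\<alpha>' t\<bar> \<le> A" if "t \<in> {m..K}" for t
  proof -
    have "\<bar>\<alpha>' t\<bar> \<le> 1 * \<bar>\<alpha> t\<bar>"
      unfolding \<alpha>'_def abs_mult using n0(2)[OF step.hyps(1) that] by (intro mult_right_mono) auto
    with step.prems[OF that] show ?thesis by simp
  qed
  have "norm e \<le> 1" unfolding e_def using quad_Q_lim_nonneg by simp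
  have n: "2 * m \<le> n" using n0(1) step.hyps(1) by simp
  have "of_real (exp (- (h\<^sup>2 * quad K \<alpha> (\<lambda>t1 t2. gram n0 t1 t2 (Suc n)) / 2))) = e * g"
    unfolding quad_gram_Suc[OF step.hyps(1)] e_def g_def \<alpha>'_def
    by (simp add: exp_add[symmetric] of_real_mult[symmetric] algebra_simps add_divide_distrib del: of_real_mult)
  then have diff: "phi K \<alpha> h (Suc n) - of_real (exp (- (h\<^sup>2 * quad K \<alpha> (\<lambda>t1 t2. gram n0 t1 t2 (Suc n)) / 2)))
      = (phi K \<alpha> h (Suc n) - e * phi K \<alpha>' h n) + e * (phi K \<alpha>' h n - g)"
    by (simp add: algebra_simps)
  have "norm ((phi K \<alpha> h (Suc n) - e * phi K \<alpha>' h n) + e * (phi K \<alpha>' h n - g))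
      \<le> norm (phi K \<alpha> h (Suc n) - e * phi K \<alpha>' h n) + norm e * norm (phi K \<alpha>' h n - g)"
    unfolding norm_mult[symmetric] by (rule norm_triangle_ineq)
  also have "norm (phi K \<alpha> h (Suc n) - e * phi K \<alpha>' h n)
      \<le> (2 * h * B) ^ 3 / 6 + h\<^sup>2 / 2 * (A\<^sup>2 * eta K n) + (h\<^sup>2 * quad K \<alpha> Q_lim)\<^sup>2 / 8"
    unfolding e_def \<alpha>'_def[abs_def] B_def by (rule char_step[OF n \<open>0 \<le> h\<close> step.prems])
  also have "(h\<^sup>2 * quad K \<alpha> Q_lim)\<^sup>2 / 8 \<le> (h\<^sup>2 * C)\<^sup>2 / 8"
    using quad_bound[of K \<alpha> A Q_lim, OF step.prems] quad_Q_lim_nonneg[of K \<alpha>] unfolding C_def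
    by (intro divide_right_mono power_mono mult_left_mono) auto
  also have "norm e * norm (phi K \<alpha>' h n - g) \<le> 1 * (h * (B * real n0) + (\<Sum>j=n0..<n. (2 * h * B) ^ 3 / 6 + h\<^sup>2 / 2 * (A\<^sup>2 * eta K j) + (h\<^sup>2 * C)\<^sup>2 / 8))"
    using \<open>norm e \<le> 1\<close> step.IH[OF \<alpha>'] unfolding g_def by (intro mult_mono) auto
  finally show ?case unfolding diff using step.hyps by (simp add: sum.atLeastLessThan_Suc)
qed

lemma gram_asymp:
  assumes t: "m \<le> t1" "m \<le> t2"
  shows "(\<lambda>n. gram n0 t1 t2 n / real n) \<longlonglongrightarrow> cov_U t1 t2 / real m"
proof -
  define \<beta> where "\<beta> = (real t1 + real t2 + 2 * \<delta>) / \<theta>"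
  have "\<theta> > 0" using theta_gt_1 by simp
  have "\<beta> > 0" unfolding \<beta>_def using plus_delta_pos[OF t(1)] plus_delta_pos[OF t(2)] \<open>\<theta> > 0\<close>
    by (intro divide_pos_pos) auto
  have "(\<lambda>n. gram n0 t1 t2 n / real n) \<longlonglongrightarrow> Q_lim t1 t2 / (1 + \<beta>)"
  proof (rule linear_recursion_limit[where c = "\<lambda>_. Q_lim t1 t2"])
    show "\<forall>\<^sub>F n in sequentially. gram n0 t1 t2 (Suc n) = lam t1 n * lam t2 n * gram n0 t1 t2 n + Q_lim t1 t2"
      using eventually_ge_at_top[of n0] by eventually_elim simp
    show "(\<lambda>n. real n * (1 - lam t1 n * lam t2 n)) \<longlonglongrightarrow> \<beta>" unfolding \<beta>_def by (rule lam_mult_asymp)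
  qed (use \<open>\<beta> > 0\<close> in auto)
  also have "Q_lim t1 t2 / (1 + \<beta>) = cov_U t1 t2 / real m"
  proof -
    have e: "\<theta> + real t1 + real t2 + 2 * \<delta> = \<theta> * (1 + \<beta>)" using \<open>\<theta> > 0\<close> by (simp add: \<beta>_def field_simps)
    show ?thesis unfolding cov_U_def m_theta[symmetric] e using m_pos \<open>\<theta> > 0\<close> \<open>\<beta> > 0\<close> by simp
  qed
  finally show ?thesis .
qed

text \<open>With \<open>N s = s * m + i\<close> steps and \<open>h s = 1 / sqrt s\<close>, the
  product \<open>h^2 N\<close> tends to m. The cubic and quartic errors vanish by their surplus
  powers of h, the covariance error by \<open>cesaro_zero\<close>, the start error because
  \<open>n0\<close> is fixed.\<close>

lemma char_limit:
  "(\<lambda>s. phi K \<alpha> (1 / sqrt (real s)) (s * m + i)) \<longlonglongrightarrow> of_real (exp (- (quad K \<alpha> cov_U / 2)))"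
proof -
  have "\<forall>\<^sub>F n in sequentially. \<forall>t\<in>{m..K}. 0 \<le> lam t n \<and> lam t n \<le> 1"
    by (intro eventually_ball_finite ballI eventually_lam) auto
  then obtain n1 where n1: "\<And>n t. n1 \<le> n \<Longrightarrow> t \<in> {m..K} \<Longrightarrow> 0 \<le> lam t n \<and> lam t n \<le> 1"
    unfolding eventually_sequentially by blast
  define n0 where "n0 = max n1 (2 * m)"
  have n0: "2 * m \<le> n0" "\<And>n t. n0 \<le> n \<Longrightarrow> t \<in> {m..K} \<Longrightarrow> 0 \<le> lam t n \<and> lam t n \<le> 1"
    using n1 by (auto simp: n0_def)
  define A where "A = (\<Sum>t=m..K. \<bar>\<alpha> t\<bar>)"
  have A: "\<bar>\<alpha> t\<bar> \<le> A" if "t \<in> {m..K}" for t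
    unfolding A_def using that by (intro member_le_sum) auto
  have "A \<ge> 0" by (simp add: A_def sum_nonneg)
  define B where "B = A * (\<Sum>t=m..K. 2 * b_bound t)"
  define C where "C = A\<^sup>2 * (\<Sum>t1=m..K. \<Sum>t2=m..K. \<bar>Q_lim t1 t2\<bar>)"
  have "B \<ge> 0" unfolding B_def using \<open>A \<ge> 0\<close> b_bound_nonneg by (intro mult_nonneg_nonneg sum_nonneg) auto
  define N where "N s = s * m + i" for s
  define h where "h s = 1 / sqrt (real s)" for s :: nat
  have N_ge: "s \<le> N s" for s using m_pos by (simp add: N_def trans_le_add1)
  have N_top: "filterlim N at_top sequentially"
    unfolding filterlim_at_top using N_ge by (auto intro: eventually_sequentiallyI order_trans)
  have h: "h \<longlonglongrightarrow> 0" unfolding h_def[abs_def]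
    by (intro tendsto_divide_0[OF tendsto_const] filterlim_at_top_imp_at_infinity filterlim_compose[OF sqrt_at_top] filterlim_real_sequentially)
  have Ns: "(\<lambda>s. real (N s) / real s) \<longlonglongrightarrow> real m"
  proof -
    have "(\<lambda>s. real m + real i / real s) \<longlonglongrightarrow> real m + 0"
      by (intro tendsto_intros lim_const_over_n)
    then have "(\<lambda>s. real m + real i / real s) \<longlonglongrightarrow> real m" by simp
    then show ?thesis
    proof (rule Lim_transform_eventually)
      show "\<forall>\<^sub>F s in sequentially. real m + real i / real s = real (N s) / real s"
        using eventually_gt_at_top[of 0] by eventually_elim (simp add: N_def field_simps)
    qed
  qed
  define err where "err s = h s * (B * real n0) + (real (N s) / real s * h s * ((2 * B) ^ 3 / 6)
     + A\<^sup>2 / 2 * (real (N s) / real s * ((\<Sum>j<N s. eta K j) / real (N s))) + real (N s) / real s * (h s)\<^sup>2 * (C\<^sup>2 / 8))" for s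
  have "err \<longlonglongrightarrow> 0 * (B * real n0) + (real m * 0 * ((2 * B) ^ 3 / 6) + A\<^sup>2 / 2 * (real m * 0) + real m * 0\<^sup>2 * (C\<^sup>2 / 8))"
    unfolding err_def[abs_def]
    by (intro tendsto_intros h Ns filterlim_compose[OF cesaro_zero[OF eta_tendsto eta_nonneg] N_top])
  then have err: "err \<longlonglongrightarrow> 0" by simp
  have bound: "\<forall>\<^sub>F s in sequentially. norm (phi K \<alpha> (h s) (N s)
      - of_real (exp (- ((h s)\<^sup>2 * quad K \<alpha> (\<lambda>t1 t2. gram n0 t1 t2 (N s)) / 2)))) \<le> err s"
    using eventually_ge_at_top[of "max n0 1"]
  proof eventually_elim
    case (elim s)
    have s: "s > 0" "n0 \<le> N s" using elim N_ge[of s] by auto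
    have Npos: "real (N s) > 0" using s(1) N_ge[of s] by simp
    have h2: "(h s)\<^sup>2 = 1 / real s" and h0: "h s \<ge> 0" by (simp_all add: h_def power_divide)
    have "norm (phi K \<alpha> (h s) (N s) - of_real (exp (- ((h s)\<^sup>2 * quad K \<alpha> (\<lambda>t1 t2. gram n0 t1 t2 (N s)) / 2))))
      \<le> h s * (B * real n0) + (\<Sum>j=n0..<N s. (2 * h s * B) ^ 3 / 6 + (h s)\<^sup>2 / 2 * (A\<^sup>2 * eta K j) + ((h s)\<^sup>2 * C)\<^sup>2 / 8)"
      unfolding B_def C_def by (rule char_approx[OF n0 h0 s(2) A])
    also have "(\<Sum>j=n0..<N s. (2 * h s * B) ^ 3 / 6 + (h s)\<^sup>2 / 2 * (A\<^sup>2 * eta K j) + ((h s)\<^sup>2 * C)\<^sup>2 / 8)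
       \<le> (\<Sum>j<N s. (2 * h s * B) ^ 3 / 6 + (h s)\<^sup>2 / 2 * (A\<^sup>2 * eta K j) + ((h s)\<^sup>2 * C)\<^sup>2 / 8)"
      using h0 \<open>B \<ge> 0\<close> eta_nonneg by (intro sum_mono2) auto
    also have "\<dots> = real (N s) * ((2 * h s * B) ^ 3 / 6) + (h s)\<^sup>2 / 2 * (A\<^sup>2 * (\<Sum>j<N s. eta K j)) + real (N s) * (((h s)\<^sup>2 * C)\<^sup>2 / 8)"
      by (simp add: sum.distrib sum_distrib_left)
    also have "\<dots> = real (N s) / real s * h s * ((2 * B) ^ 3 / 6)
     + A\<^sup>2 / 2 * (real (N s) / real s * ((\<Sum>j<N s. eta K j) / real (N s))) + real (N s) / real s * (h s)\<^sup>2 * (C\<^sup>2 / 8)"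
    proof -
      have "(2 * h s * B) ^ 3 / 6 = (h s)\<^sup>2 * h s * ((2 * B) ^ 3 / 6)"
        by (simp add: power_mult_distrib power2_eq_square power3_eq_cube)
      moreover have "((h s)\<^sup>2 * C)\<^sup>2 / 8 = (h s)\<^sup>2 * (h s)\<^sup>2 * (C\<^sup>2 / 8)"
        by (simp add: power_mult_distrib power2_eq_square)
      ultimately show ?thesis unfolding h2 using Npos by simp
    qed
    finally show ?case unfolding err_def by simp
  qed
  have "(\<lambda>s. phi K \<alpha> (h s) (N s)
      - of_real (exp (- ((h s)\<^sup>2 * quad K \<alpha> (\<lambda>t1 t2. gram n0 t1 t2 (N s)) / 2)))) \<longlonglongrightarrow> 0"
    by (rule Lim_null_comparison[OF bound err])
  moreover have "(\<lambda>s. complex_of_real (exp (- ((h s)\<^sup>2 * quad K \<alpha> (\<lambda>t1 t2. gram n0 t1 t2 (N s)) / 2))))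
      \<longlonglongrightarrow> of_real (exp (- (quad K \<alpha> cov_U / 2)))"
  proof -
    have "(\<lambda>s. quad K \<alpha> (\<lambda>t1 t2. gram n0 t1 t2 (N s) / real (N s) * (real (N s) / real s)))
      \<longlonglongrightarrow> quad K \<alpha> (\<lambda>t1 t2. cov_U t1 t2 / real m * real m)"
      unfolding quad_def
      by (intro tendsto_intros Ns filterlim_compose[OF gram_asymp N_top]) auto
    also have "(\<lambda>t1 t2. cov_U t1 t2 / real m * real m) = cov_U" using m_pos by simp
    finally have "(\<lambda>s. quad K \<alpha> (\<lambda>t1 t2. gram n0 t1 t2 (N s) / real (N s) * (real (N s) / real s))) \<longlonglongrightarrow> quad K \<alpha> cov_U" .
    moreover have "\<forall>\<^sub>F s in sequentially. quad K \<alpha> (\<lambda>t1 t2. gram n0 t1 t2 (N s) / real (N s) * (real (N s) / real s))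
        = (h s)\<^sup>2 * quad K \<alpha> (\<lambda>t1 t2. gram n0 t1 t2 (N s))"
      using eventually_gt_at_top[of 0]
    proof eventually_elim
      case (elim s)
      have Npos: "real (N s) > 0" using elim N_ge[of s] by simp
      have "(h s)\<^sup>2 = 1 / real s" by (simp add: h_def power_divide)
      then show ?case unfolding quad_def using Npos by (simp add: sum_distrib_left sum_divide_distrib)
    qed
    ultimately have "(\<lambda>s. (h s)\<^sup>2 * quad K \<alpha> (\<lambda>t1 t2. gram n0 t1 t2 (N s))) \<longlonglongrightarrow> quad K \<alpha> cov_U"
      by (rule Lim_transform_eventually)
    then show ?thesis by (intro tendsto_intros) auto
  qed
  ultimately have "(\<lambda>s. phi K \<alpha> (h s) (N s)) \<longlonglongrightarrow> 0 + of_real (exp (- (quad K \<alpha> cov_U / 2)))"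
    using tendsto_add by fastforce
  then show ?thesis by (simp add: h_def N_def)
qed

end

section \<open>Convergence of characteristic functions implies convergence in distribution\<close>

text \<open>Real trigonometric polynomials in the coordinates from \<open>J\<close>. The phase
  covers sines, and expectations of these functions are determined by the characteristic
  function.\<close>

inductive trig_poly :: "nat set \<Rightarrow> ((nat \<Rightarrow> real) \<Rightarrow> real) \<Rightarrow> bool" for J where
  cos: "trig_poly J (\<lambda>x. c * cos (\<phi> + (\<Sum>j\<in>J. a j * x j)))"
| add: "trig_poly J f \<Longrightarrow> trig_poly J g \<Longrightarrow> trig_poly J (\<lambda>x. f x + g x)"

lemma trig_poly_const: "trig_poly J (\<lambda>_. c)"
  using trig_poly.cos[of J c 0 "\<lambda>_. 0"] by simp

text \<open>Product-to-sum formula for the cosine; the Stone-Weierstrass theorem asks for an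
  algebra.\<close>

lemma trig_poly_mult:
  assumes "trig_poly J f" "trig_poly J g"
  shows "trig_poly J (\<lambda>x. f x * g x)"
  using assms(1)
proof induction
  case (cos c \<phi> a)
  show ?case using assms(2)
  proof induction
    case (cos c' \<phi>' a')
    have "trig_poly J (\<lambda>x. (c * c' / 2) * cos ((\<phi> - \<phi>') + (\<Sum>j\<in>J. (a j - a' j) * x j)) +
                           (c * c' / 2) * cos ((\<phi> + \<phi>') + (\<Sum>j\<in>J. (a j + a' j) * x j)))"
      by (intro trig_poly.intros)
    moreover have "(c * c' / 2) * cos ((\<phi> - \<phi>') + (\<Sum>j\<in>J. (a j - a' j) * x j)) +
                   (c * c' / 2) * cos ((\<phi> + \<phi>') + (\<Sum>j\<in>J. (a j + a' j) * x j)) =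
          c * cos (\<phi> + (\<Sum>j\<in>J. a j * x j)) * (c' * cos (\<phi>' + (\<Sum>j\<in>J. a' j * x j)))" for x
    proof -
      define A B where "A = \<phi> + (\<Sum>j\<in>J. a j * x j)" and "B = \<phi>' + (\<Sum>j\<in>J. a' j * x j)"
      have e1: "(\<phi> - \<phi>') + (\<Sum>j\<in>J. (a j - a' j) * x j) = A - B"
        and e2: "(\<phi> + \<phi>') + (\<Sum>j\<in>J. (a j + a' j) * x j) = A + B"
        by (simp_all add: A_def B_def sum.distrib sum_subtractf algebra_simps)
      show ?thesis
        unfolding e1 e2 A_def[symmetric] B_def[symmetric] by (simp add: cos_add cos_diff algebra_simps)
    qed
    ultimately show ?case by simp
  next
    case (add f g)
    then show ?case using trig_poly.add[OF add.IH] by (simp add: algebra_simps)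
  qed
next
  case (add f g)
  then show ?case using trig_poly.add[OF add.IH] by (simp add: algebra_simps)
qed

lemma trig_poly_power: "trig_poly J f \<Longrightarrow> trig_poly J (\<lambda>x. f x ^ n)"
  by (induction n) (auto intro: trig_poly_mult trig_poly_const)

lemma trig_poly_sum: "finite A \<Longrightarrow> (\<And>i. i \<in> A \<Longrightarrow> trig_poly J (f i)) \<Longrightarrow> trig_poly J (\<lambda>x. \<Sum>i\<in>A. f i x)"
  by (induction A rule: finite_induct) (auto intro: trig_poly.add trig_poly_const)

lemma trig_poly_compose_polynomial:
  assumes "real_polynomial_function p" "trig_poly J f"
  shows "trig_poly J (\<lambda>x. p (f x))"
proof -
  obtain a n where p: "p = (\<lambda>x. \<Sum>i\<le>n. a i * x ^ i)"
    using assms(1) unfolding real_polynomial_function_iff_sum by blast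
  show ?thesis unfolding p
    by (intro trig_poly_sum trig_poly_mult trig_poly_const trig_poly_power assms) auto
qed

lemma trig_poly_bounded:
  assumes "trig_poly J f"
  obtains B where "\<And>x. \<bar>f x\<bar> \<le> B"
proof -
  have "\<exists>B. \<forall>x. \<bar>f x\<bar> \<le> B" using assms
  proof induction
    case (cos c \<phi> a)
    show ?case
      by (rule exI[of _ "\<bar>c\<bar>"]) (auto simp: abs_mult intro!: mult_left_le)
  next
    case (add f g)
    then obtain B C where "\<And>x. \<bar>f x\<bar> \<le> B" "\<And>x. \<bar>g x\<bar> \<le> C" by blast
    then have "\<bar>f x + g x\<bar> \<le> B + C" for x
      using abs_triangle_ineq[of "f x" "g x"] add_mono order_trans by meson
    then show ?case by blast
  qed
  with that show ?thesis by blast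
qed

lemma trig_poly_continuous:
  assumes "trig_poly J f" shows "continuous_on UNIV f"
  using assms
  by induction (auto intro!: continuous_intros)

text \<open>Coordinates outside \<open>J\<close> are pinned to 0, so that the cube is compact in
  \<open>nat \<Rightarrow> real\<close> and its points are separated by coordinates from
  \<open>J\<close>.\<close>

definition cube :: "nat set \<Rightarrow> real \<Rightarrow> (nat \<Rightarrow> real) set" where
  "cube J T = (\<Pi>\<^sub>E j\<in>UNIV. if j \<in> J then {-T..T} else {0})"

lemma mem_cube: "x \<in> cube J T \<longleftrightarrow> (\<forall>j\<in>J. \<bar>x j\<bar> \<le> T) \<and> (\<forall>j. j \<notin> J \<longrightarrow> x j = 0)"
  unfolding cube_def PiE_iff by (auto split: if_splits simp: abs_le_iff)

lemma compact_cube: "compact (cube J T)"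
proof -
  have "compactin (product_topology (\<lambda>_. euclidean) UNIV) (cube J T)"
    unfolding cube_def compactin_PiE by auto
  then show ?thesis by (simp add: euclidean_product_topology)
qed

lemma trig_poly_dense_cube:
  assumes g: "continuous_on (cube J T) g" and "finite J" and "e > 0"
  obtains u where "trig_poly J u" "\<And>x. x \<in> cube J T \<Longrightarrow> \<bar>g x - u x\<bar> < e"
proof -
  interpret function_ring_on "Collect (trig_poly J)" "cube J T"
  proof unfold_locales
    show "compact (cube J T)" by (rule compact_cube)
    show "continuous_on (cube J T) f" if "f \<in> Collect (trig_poly J)" for f
      using that continuous_on_subset[OF trig_poly_continuous] by blast
    show "\<exists>f\<in>Collect (trig_poly J). f x \<noteq> f y" if "x \<in> cube J T" "y \<in> cube J T" "x \<noteq> y" for x y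
    proof -
      from \<open>x \<noteq> y\<close> obtain j where j: "x j \<noteq> y j" by blast
      with that have J: "j \<in> J" unfolding mem_cube by metis
      \<comment> \<open>The frequency scales \<open>w j - y j\<close> to 0 at y and to pi at x,
        where the cosine takes the values 1 and -1.\<close>
      define a where "a i = (if i = j then pi / (x j - y j) else 0)" for i
      define f where "f w = 1 * cos (- (pi / (x j - y j) * y j) + (\<Sum>i\<in>J. a i * w i))" for w
      have lin: "(\<Sum>i\<in>J. a i * w i) = pi / (x j - y j) * w j" for w
      proof -
        have "(\<Sum>i\<in>J. a i * w i) = (\<Sum>i\<in>J. if i = j then pi / (x j - y j) * w j else 0)"
          by (intro sum.cong) (auto simp: a_def)
        then show ?thesis using J \<open>finite J\<close> by simp
      qed
      have f: "f w = cos (pi / (x j - y j) * (w j - y j))" for w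
        unfolding f_def lin by (simp add: right_diff_distrib)
      have "f x = -1" "f y = 1" using j by (simp_all add: f)
      moreover have "trig_poly J f" unfolding f_def by (rule trig_poly.cos)
      ultimately show ?thesis by (intro bexI[of _ f]) auto
    qed
  qed (auto intro: trig_poly.add trig_poly_mult trig_poly_const)
  from Stone_Weierstrass_basic[OF g \<open>e > 0\<close>] that show ?thesis by blast
qed

text \<open>
  Composing a trigonometric polynomial with a polynomial close to a truncation keeps it bounded
  outside the cube by a constant that does not depend on the cube.
\<close>

lemma trig_poly_dense_cube_bounded:
  assumes g: "continuous_on UNIV g" and B: "\<And>x. \<bar>g x\<bar> \<le> B" and "finite J" and "e > 0" "e < 1"
  obtains u where "trig_poly J u" "\<And>x. x \<in> cube J T \<Longrightarrow> \<bar>g x - u x\<bar> < e" "\<And>x. \<bar>u x\<bar> \<le> B + 2"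
proof -
  obtain u where u: "trig_poly J u" "\<And>x. x \<in> cube J T \<Longrightarrow> \<bar>g x - u x\<bar> < e / 2"
    using trig_poly_dense_cube[OF continuous_on_subset[OF g], of J T "e / 2"] assms by auto
  obtain C where C: "\<And>x. \<bar>u x\<bar> \<le> C" using trig_poly_bounded[OF u(1)] by blast
  \<comment> \<open>On the cube \<open>|u x| \<le> B + 1\<close>, so clamping changes nothing there.
    Elsewhere it yields at most \<open>B + 1\<close>, and \<open>p\<close> deviates from it by less
    than 1 on the range of \<open>u\<close>.\<close>
  define clamp where "clamp y = max (- (B + 1)) (min (B + 1) y)" for y :: real
  have "continuous_on {-C..C} clamp" unfolding clamp_def by (intro continuous_intros)
  then obtain p where p: "real_polynomial_function p" "\<And>y. y \<in> {-C..C} \<Longrightarrow> \<bar>clamp y - p y\<bar> < e / 2"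
    using Stone_Weierstrass_real_polynomial_function[of "{-C..C}" clamp "e/2"] \<open>e > 0\<close> by auto
  have "B \<ge> 0" using B[of undefined] by linarith
  show ?thesis
  proof (rule that)
    show "trig_poly J (\<lambda>x. p (u x))" by (rule trig_poly_compose_polynomial[OF p(1) u(1)])
    show "\<bar>g x - p (u x)\<bar> < e" if "x \<in> cube J T" for x
    proof -
      have "\<bar>u x\<bar> \<le> B + 1" using u(2)[OF that] B[of x] \<open>e < 1\<close> by linarith
      then have "clamp (u x) = u x" unfolding clamp_def by (auto simp: max_def min_def)
      moreover have "\<bar>clamp (u x) - p (u x)\<bar> < e / 2"
        using C[of x] by (intro p(2)) (auto simp: abs_le_iff)
      ultimately show ?thesis using u(2)[OF that] by linarith
    qed
    show "\<bar>p (u x)\<bar> \<le> B + 2" for x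
    proof -
      have "\<bar>clamp (u x)\<bar> \<le> B + 1" using \<open>B \<ge> 0\<close> unfolding clamp_def by (auto simp: max_def min_def)
      moreover have "\<bar>clamp (u x) - p (u x)\<bar> < e / 2"
        using C[of x] by (intro p(2)) (auto simp: abs_le_iff)
      ultimately show ?thesis using \<open>e < 1\<close> by linarith
    qed
  qed
qed

text \<open>A continuous substitute for the indicator of \<open>|x| > T\<close>, so that weak
  convergence of the coordinates controls the mass outside a cube.\<close>

definition ramp :: "real \<Rightarrow> real \<Rightarrow> real" where
  "ramp T x = max 0 (min 1 (\<bar>x\<bar> - T))"

lemma ramp_bounds: "0 \<le> ramp T x" "ramp T x \<le> 1"
  by (auto simp: ramp_def)

lemma ramp_eq_1: "\<bar>x\<bar> \<ge> T + 1 \<Longrightarrow> ramp T x = 1"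
  by (auto simp: ramp_def)

lemma ramp_measurable [measurable]: "ramp T \<in> borel_measurable borel"
  unfolding ramp_def by measurable

lemma (in prob_space) ramp_integrable [simp]:
  assumes [measurable]: "X \<in> borel_measurable M"
  shows "integrable M (\<lambda>x. ramp T (X x))"
  by (rule integrable_const_bound[of _ 1]) (auto simp: ramp_bounds)

lemma (in prob_space) ramp_tendsto_0:
  assumes [measurable]: "X \<in> borel_measurable M"
  shows "(\<lambda>n. \<integral>x. ramp (real n) (X x) \<partial>M) \<longlonglongrightarrow> 0"
proof -
  have "(\<lambda>n. \<integral>x. ramp (real n) (X x) \<partial>M) \<longlonglongrightarrow> (\<integral>x. 0 \<partial>M)"
  proof (rule integral_dominated_convergence[where w = "\<lambda>_. 1"])
    show "AE x in M. (\<lambda>n. ramp (real n) (X x)) \<longlonglongrightarrow> 0"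
    proof (rule AE_I2)
      fix x
      obtain n0 :: nat where "\<bar>X x\<bar> \<le> real n0" using real_arch_simple by blast
      then have "ramp (real n) (X x) = 0" if "n \<ge> n0" for n
        using that by (auto simp: ramp_def)
      then show "(\<lambda>n. ramp (real n) (X x)) \<longlonglongrightarrow> 0"
        by (intro tendsto_eventually) (auto simp: eventually_sequentially)
    qed
  qed (auto simp: ramp_bounds)
  then show ?thesis by simp
qed

lemma (in prob_space) integral_diff_ramp_bound:
  fixes g u :: "(nat \<Rightarrow> real) \<Rightarrow> real"
  assumes [measurable]: "g \<in> borel_measurable borel" "u \<in> borel_measurable borel"
    and B: "\<And>x. \<bar>g x\<bar> \<le> B" "\<And>x. \<bar>u x\<bar> \<le> B'"
    and bound: "\<And>x. (\<And>j. j \<notin> J \<Longrightarrow> x j = 0) \<Longrightarrow> \<bar>g x - u x\<bar> \<le> e + C * (\<Sum>j\<in>J. ramp T (x j))"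
    and W [measurable]: "W \<in> borel_measurable M" and W0: "\<And>\<omega> j. j \<notin> J \<Longrightarrow> W \<omega> j = 0"
  shows "\<bar>(\<integral>\<omega>. g (W \<omega>) \<partial>M) - (\<integral>\<omega>. u (W \<omega>) \<partial>M)\<bar> \<le> e + C * (\<Sum>j\<in>J. \<integral>\<omega>. ramp T (W \<omega> j) \<partial>M)"
proof -
  have Wj [measurable]: "(\<lambda>\<omega>. W \<omega> j) \<in> borel_measurable M" for j
    using W by (rule measurable_product_then_coordinatewise)
  have ints: "integrable M (\<lambda>\<omega>. g (W \<omega>))" "integrable M (\<lambda>\<omega>. u (W \<omega>))"
    by (rule integrable_const_bound[of _ B], use B in simp, simp)
       (rule integrable_const_bound[of _ B'], use B in simp, simp)
  have "\<bar>(\<integral>\<omega>. g (W \<omega>) \<partial>M) - (\<integral>\<omega>. u (W \<omega>) \<partial>M)\<bar> = \<bar>\<integral>\<omega>. g (W \<omega>) - u (W \<omega>) \<partial>M\<bar>"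
    using ints by simp
  also have "\<dots> \<le> (\<integral>\<omega>. \<bar>g (W \<omega>) - u (W \<omega>)\<bar> \<partial>M)"
    by (rule integral_abs_bound)
  also have "\<dots> \<le> (\<integral>\<omega>. e + C * (\<Sum>j\<in>J. ramp T (W \<omega> j)) \<partial>M)"
    using ints by (intro integral_mono bound W0) auto
  also have "\<dots> = e + C * (\<Sum>j\<in>J. \<integral>\<omega>. ramp T (W \<omega> j) \<partial>M)"
    by (simp add: prob_space)
  finally show ?thesis .
qed

text \<open>Expectations of trigonometric polynomials converge by hypothesis. A bounded continuous
  function is close to such a polynomial on a large cube; the mass outside is bounded by the ramps
  of the single coordinates, whose integrals converge by the one-dimensional continuity
  theorem.\<close>

lemma vector_conv_distr_char:
  fixes X :: "nat \<Rightarrow> nat \<Rightarrow> 'a \<Rightarrow> real" and Y :: "nat \<Rightarrow> 'b \<Rightarrow> real"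
  assumes "prob_space M" "prob_space N" and "finite J"
    and X [measurable]: "\<And>s j. j \<in> J \<Longrightarrow> X s j \<in> borel_measurable M"
    and Y [measurable]: "\<And>j. j \<in> J \<Longrightarrow> Y j \<in> borel_measurable N"
    and char: "\<And>a. (\<lambda>s. \<integral>\<omega>. iexp (\<Sum>j\<in>J. a j * X s j \<omega>) \<partial>M)
                  \<longlonglongrightarrow> (\<integral>\<omega>. iexp (\<Sum>j\<in>J. a j * Y j \<omega>) \<partial>N)"
  shows "vector_conv_distr J M X N Y"
proof -
  let ?rX = "\<lambda>T s. (\<Sum>j\<in>J. \<integral>\<omega>. ramp T (X s j \<omega>) \<partial>M)"
  let ?rY = "\<lambda>T. (\<Sum>j\<in>J. \<integral>\<omega>. ramp T (Y j \<omega>) \<partial>N)"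
  interpret M: prob_space M by fact
  interpret N: prob_space N by fact
  define X' where "X' s \<omega> = (\<lambda>j. if j \<in> J then X s j \<omega> else 0)" for s \<omega>
  define Y' where "Y' \<omega> = (\<lambda>j. if j \<in> J then Y j \<omega> else 0)" for \<omega>
  have X'_meas: "X' s \<in> borel_measurable M" for s
  proof (rule measurable_coordinatewise_then_product)
    show "(\<lambda>x. X' s x i) \<in> borel_measurable M" for i
      unfolding X'_def by (cases "i \<in> J") auto
  qed
  have Y'_meas: "Y' \<in> borel_measurable N"
  proof (rule measurable_coordinatewise_then_product)
    show "(\<lambda>x. Y' x i) \<in> borel_measurable N" for i
      unfolding Y'_def by (cases "i \<in> J") auto
  qed
  note [measurable] = X'_meas Y'_meas
  have trig_meas [measurable]: "u \<in> borel_measurable borel" if "trig_poly J u" for u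
    using trig_poly_continuous[OF that] by (rule borel_measurable_continuous_onI)
  have trig: "(\<lambda>s. \<integral>\<omega>. u (X' s \<omega>) \<partial>M) \<longlonglongrightarrow> (\<integral>\<omega>. u (Y' \<omega>) \<partial>N)" if "trig_poly J u" for u
    using that
  proof induction
    case (cos c \<phi> a)
    have sums: "(\<Sum>j\<in>J. a j * X' s \<omega> j) = (\<Sum>j\<in>J. a j * X s j \<omega>)"
               "(\<Sum>j\<in>J. a j * Y' \<omega>' j) = (\<Sum>j\<in>J. a j * Y j \<omega>')" for s \<omega> \<omega>'
      by (simp_all add: X'_def Y'_def)
    have cosRe: "c * cos (\<phi> + y) = Re (of_real c * iexp \<phi> * iexp y)" for y
      by (simp add: cis_conv_exp[symmetric] cis_mult mult.assoc)
    have *: "(\<integral>\<omega>. c * cos (\<phi> + (\<Sum>j\<in>J. a j * X' s \<omega> j)) \<partial>M)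
           = Re (of_real c * iexp \<phi> * (\<integral>\<omega>. iexp (\<Sum>j\<in>J. a j * X s j \<omega>) \<partial>M))" for s
    proof -
      have "integrable M (\<lambda>\<omega>. iexp (\<Sum>j\<in>J. a j * X s j \<omega>))"
        by (rule M.integrable_iexp) auto
      then show ?thesis unfolding sums cosRe
        by (subst integral_Re) auto
    qed
    have **: "(\<integral>\<omega>. c * cos (\<phi> + (\<Sum>j\<in>J. a j * Y' \<omega> j)) \<partial>N)
           = Re (of_real c * iexp \<phi> * (\<integral>\<omega>. iexp (\<Sum>j\<in>J. a j * Y j \<omega>) \<partial>N))"
    proof -
      have "integrable N (\<lambda>\<omega>. iexp (\<Sum>j\<in>J. a j * Y j \<omega>))"
        by (rule N.integrable_iexp) auto
      then show ?thesis unfolding sums cosRe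
        by (subst integral_Re) auto
    qed
    show ?case unfolding * ** by (intro tendsto_intros char)
  next
    case (add f g)
    have int: "integrable M (\<lambda>\<omega>. u (X' s \<omega>))" "integrable N (\<lambda>\<omega>. u (Y' \<omega>))" if tu: "trig_poly J u" for u s
    proof -
      obtain B where B: "\<And>x. \<bar>u x\<bar> \<le> B" using trig_poly_bounded[OF tu] by blast
      note [measurable] = trig_meas[OF tu]
      show "integrable M (\<lambda>\<omega>. u (X' s \<omega>))"
        by (rule M.integrable_const_bound[of _ B]) (use B in auto)
      show "integrable N (\<lambda>\<omega>. u (Y' \<omega>))"
        by (rule N.integrable_const_bound[of _ B]) (use B in auto)
    qed
    show ?case
      using tendsto_add[OF add.IH] by (simp add: int add.hyps)
  qed
  have ramp_conv: "(\<lambda>s. \<integral>\<omega>. ramp T (X s j \<omega>) \<partial>M) \<longlonglongrightarrow> (\<integral>\<omega>. ramp T (Y j \<omega>) \<partial>N)" if j: "j \<in> J" for j T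
  proof -
    note [measurable] = X[OF j] Y[OF j]
    have "weak_conv_m (\<lambda>s. distr M borel (X s j)) (distr N borel (Y j))"
    proof (rule levy_continuity)
      fix t
      \<comment> \<open>A coefficient vector supported at j reduces the hypothesis to the
        characteristic function of one coordinate.\<close>
      define a :: "nat \<Rightarrow> real" where "a i = (if i = j then t else 0)" for i
      have "(\<Sum>i\<in>J. a i * w i) = t * w j" for w
      proof -
        have "(\<Sum>i\<in>J. a i * w i) = (\<Sum>i\<in>J. if i = j then t * w j else 0)"
          by (intro sum.cong) (auto simp: a_def)
        then show ?thesis using j \<open>finite J\<close> by simp
      qed
      with char[of a] show "(\<lambda>n. char (distr M borel (X n j)) t) \<longlonglongrightarrow> char (distr N borel (Y j)) t"
        unfolding char_def by (simp add: integral_distr)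
    qed (auto simp: M.real_distribution_distr N.real_distribution_distr)
    then have "(\<lambda>s. integral\<^sup>L (distr M borel (X s j)) (ramp T)) \<longlonglongrightarrow> integral\<^sup>L (distr N borel (Y j)) (ramp T)"
    proof (intro weak_conv_imp_integral_bdd_continuous_conv[where B = 1])
      have "continuous_on UNIV (ramp T)" unfolding ramp_def[abs_def] by (intro continuous_intros)
      then show "isCont (ramp T) x" for x by (simp add: continuous_on_eq_continuous_at)
    qed (auto simp: M.real_distribution_distr N.real_distribution_distr ramp_bounds)
    then show ?thesis by (simp add: integral_distr)
  qed
  show ?thesis
    unfolding vector_conv_distr_def
  proof (intro allI impI, elim conjE)
    fix f :: "(nat \<Rightarrow> real) \<Rightarrow> real"
    assume cont: "continuous_map (product_topology (\<lambda>_. euclideanreal) J) euclideanreal f"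
      and bdd: "bounded (f ` (\<Pi>\<^sub>E j\<in>J. UNIV))"
    define g where "g x = f (restrict x J)" for x
    have "continuous_map euclidean (product_topology (\<lambda>_. euclideanreal) J) (\<lambda>x. restrict x J)"
      unfolding continuous_map_componentwise by auto
    from continuous_map_compose[OF this cont]
    have g_cont: "continuous_on UNIV g" unfolding g_def by (simp add: o_def)
    obtain B where B: "\<And>x. \<bar>g x\<bar> \<le> B"
    proof -
      from bdd obtain B where "\<And>x. x \<in> (\<Pi>\<^sub>E j\<in>J. UNIV) \<Longrightarrow> \<bar>f x\<bar> \<le> B"
        unfolding bounded_iff by auto
      then have "\<bar>g x\<bar> \<le> B" for x unfolding g_def by auto
      then show ?thesis using that by blast
    qed
    have "B \<ge> 0" using B[of undefined] by linarith
    have g_meas [measurable]: "g \<in> borel_measurable borel"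
      using g_cont by (rule borel_measurable_continuous_onI)
    have fX: "f (\<lambda>j\<in>J. X s j \<omega>) = g (X' s \<omega>)" for s \<omega>
      unfolding g_def X'_def by (rule arg_cong[of _ _ f]) auto
    have fY: "f (\<lambda>j\<in>J. Y j \<omega>) = g (Y' \<omega>)" for \<omega>
      unfolding g_def Y'_def by (rule arg_cong[of _ _ f]) auto
    show "(\<lambda>s. \<integral>\<omega>. f (\<lambda>j\<in>J. X s j \<omega>) \<partial>M) \<longlonglongrightarrow> (\<integral>x. f (\<lambda>j\<in>J. Y j x) \<partial>N)"
      unfolding fX fY
    proof (rule LIMSEQ_I)
      fix r :: real assume "r > 0"
      \<comment> \<open>\<open>D * e\<close> is the total of the errors:
        \<open>e + (2 * B + 2) * e\<close> for each of the two measures and e for the polynomial.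
        The bound \<open>1 / 2\<close> ensures \<open>e < 1\<close>.\<close>
      define e where "e = min (1/2) (r / (3 + 2 * (2 * B + 2)) / 2)"
      define D where "D = 3 + 2 * (2 * B + 2)"
      have "D > 0" using \<open>B \<ge> 0\<close> by (simp add: D_def)
      have e: "e > 0" "e < 1" using \<open>r > 0\<close> \<open>D > 0\<close> by (auto simp: e_def D_def)
      have "e \<le> r / D / 2" unfolding e_def D_def by simp
      then have eD: "D * e < r" using \<open>r > 0\<close> \<open>D > 0\<close> by (simp add: field_simps)
      have "(\<lambda>n. \<Sum>j\<in>J. \<integral>x. ramp (real n) (Y j x) \<partial>N) \<longlonglongrightarrow> (\<Sum>j\<in>J. 0)"
        by (intro tendsto_sum N.ramp_tendsto_0 Y)
      then have "\<forall>\<^sub>F n in sequentially. (\<Sum>j\<in>J. \<integral>x. ramp (real n) (Y j x) \<partial>N) < e"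
        using e(1) by (intro order_tendstoD) auto
      then obtain n where n: "(\<Sum>j\<in>J. \<integral>x. ramp (real n) (Y j x) \<partial>N) < e"
        using eventually_happens trivial_limit_sequentially by blast
      define T where "T = real n"
      obtain u where u: "trig_poly J u" "\<And>x. x \<in> cube J (T + 1) \<Longrightarrow> \<bar>g x - u x\<bar> < e" "\<And>x. \<bar>u x\<bar> \<le> B + 2"
        using trig_poly_dense_cube_bounded[OF g_cont B \<open>finite J\<close> e] by blast
      note [measurable] = trig_meas[OF u(1)]
      have bound: "\<bar>g x - u x\<bar> \<le> e + (2 * B + 2) * (\<Sum>j\<in>J. ramp T (x j))" if x: "\<And>j. j \<notin> J \<Longrightarrow> x j = 0" for x
      proof (cases "x \<in> cube J (T + 1)")
        case True
        have "0 \<le> (2 * B + 2) * (\<Sum>j\<in>J. ramp T (x j))"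
          using \<open>B \<ge> 0\<close> by (intro mult_nonneg_nonneg sum_nonneg) (auto simp: ramp_bounds)
        with u(2)[OF True] show ?thesis by linarith
      next
        case False
        with x obtain j where j: "j \<in> J" "\<bar>x j\<bar> > T + 1" unfolding mem_cube by force
        have "1 = ramp T (x j)" using j by (simp add: ramp_eq_1)
        also have "\<dots> \<le> (\<Sum>j\<in>J. ramp T (x j))"
          by (rule member_le_sum) (use j \<open>finite J\<close> in \<open>auto simp: ramp_bounds\<close>)
        finally have "(2 * B + 2) * 1 \<le> (2 * B + 2) * (\<Sum>j\<in>J. ramp T (x j))"
          using \<open>B \<ge> 0\<close> by (intro mult_left_mono) auto
        then have "2 * B + 2 \<le> (2 * B + 2) * (\<Sum>j\<in>J. ramp T (x j))" by (simp only: mult_1_right)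
        moreover have "\<bar>g x - u x\<bar> \<le> 2 * B + 2"
          using abs_triangle_ineq4[of "g x" "u x"] B[of x] u(3)[of x] by linarith
        ultimately have "\<bar>g x - u x\<bar> \<le> (2 * B + 2) * (\<Sum>j\<in>J. ramp T (x j))"
          by (rule order_trans[rotated])
        with e(1) show ?thesis by simp
      qed
      have Xs: "(\<Sum>j\<in>J. \<integral>\<omega>. ramp T (X' s \<omega> j) \<partial>M) = ?rX T s" for s
        by (simp add: X'_def)
      have Ys: "(\<Sum>j\<in>J. \<integral>\<omega>. ramp T (Y' \<omega> j) \<partial>N) = ?rY T"
        by (simp add: Y'_def)
      have "(\<lambda>s. \<Sum>j\<in>J. \<integral>\<omega>. ramp T (X s j \<omega>) \<partial>M) \<longlonglongrightarrow> ?rY T"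
        by (intro tendsto_sum ramp_conv)
      then have ev1: "\<forall>\<^sub>F s in sequentially. ?rX T s < e"
        using n unfolding T_def by (intro order_tendstoD) auto
      have ev2: "\<forall>\<^sub>F s in sequentially. \<bar>(\<integral>\<omega>. u (X' s \<omega>) \<partial>M) - (\<integral>\<omega>. u (Y' \<omega>) \<partial>N)\<bar> < e"
        using tendstoD[OF trig[OF u(1)] e(1)] by (simp add: dist_real_def)
      have "\<forall>\<^sub>F s in sequentially. norm ((\<integral>\<omega>. g (X' s \<omega>) \<partial>M) - (\<integral>x. g (Y' x) \<partial>N)) < r"
        using ev1 ev2
      proof eventually_elim
        case (elim s)
        have "\<bar>(\<integral>\<omega>. g (X' s \<omega>) \<partial>M) - (\<integral>\<omega>. u (X' s \<omega>) \<partial>M)\<bar> \<le> e + (2 * B + 2) * e"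
        proof -
          have "(2 * B + 2) * ?rX T s \<le> (2 * B + 2) * e"
            using elim(1) \<open>B \<ge> 0\<close> by (intro mult_left_mono) auto
          with M.integral_diff_ramp_bound[OF g_meas trig_meas[OF u(1)] B u(3) bound X'_meas[of s]]
          show ?thesis unfolding Xs by (force simp: X'_def)
        qed
        moreover have "\<bar>(\<integral>\<omega>. g (Y' \<omega>) \<partial>N) - (\<integral>\<omega>. u (Y' \<omega>) \<partial>N)\<bar> \<le> e + (2 * B + 2) * e"
        proof -
          have "(2 * B + 2) * ?rY T \<le> (2 * B + 2) * e"
            using n \<open>B \<ge> 0\<close> unfolding T_def by (intro mult_left_mono) auto
          with N.integral_diff_ramp_bound[OF g_meas trig_meas[OF u(1)] B u(3) bound Y'_meas]
          show ?thesis unfolding Ys by (force simp: Y'_def)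
        qed
        moreover have "D * e = (e + (2 * B + 2) * e) + (e + (2 * B + 2) * e) + e"
          unfolding D_def by (simp add: algebra_simps)
        ultimately show ?case using elim(2) eD unfolding real_norm_def by linarith
      qed
      then show "\<exists>no. \<forall>n\<ge>no. norm ((\<integral>\<omega>. g (X' n \<omega>) \<partial>M) - (\<integral>x. g (Y' x) \<partial>N)) < r"
        by (simp add: eventually_sequentially)
    qed
  qed
qed

section \<open>Gaussian processes with a given covariance\<close>

definition positive_semidefinite :: "('i \<Rightarrow> 'i \<Rightarrow> real) \<Rightarrow> bool" where
  "positive_semidefinite K \<longleftrightarrow> (\<forall>i j. K i j = K j i) \<and>
     (\<forall>I a. finite I \<longrightarrow> 0 \<le> (\<Sum>i\<in>I. \<Sum>j\<in>I. a i * a j * K i j))"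

lemma positive_semidefinite_sym: "positive_semidefinite K \<Longrightarrow> K i j = K j i"
  by (simp add: positive_semidefinite_def)

lemma positive_semidefinite_diag: "positive_semidefinite K \<Longrightarrow> 0 \<le> K i i"
  unfolding positive_semidefinite_def
  by (elim conjE allE[of _ "{i}"] allE[of _ "\<lambda>_. 1"]) simp

text \<open>A perturbation in coordinate n makes the form a quadratic polynomial in t. It is used
  once with t producing a negative value and once with the minimising t.\<close>

lemma quadratic_form_add:
  fixes K :: "'i \<Rightarrow> 'i \<Rightarrow> real"
  assumes "finite I" "n \<in> I" and sym: "\<And>i j. K i j = K j i"
  shows "(\<Sum>i\<in>I. \<Sum>j\<in>I. (a i + (if i = n then t else 0)) * (a j + (if j = n then t else 0)) * K i j)
       = (\<Sum>i\<in>I. \<Sum>j\<in>I. a i * a j * K i j) + 2 * t * (\<Sum>i\<in>I. a i * K i n) + t\<^sup>2 * K n n"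
proof -
  have "(\<Sum>j\<in>I. (a i + (if i = n then t else 0)) * (a j + (if j = n then t else 0)) * K i j)
      = (\<Sum>j\<in>I. a i * a j * K i j) + (if i = n then t * (\<Sum>j\<in>I. a j * K n j) else 0)
        + a i * t * K i n + (if i = n then t\<^sup>2 * K n n else 0)" for i
  proof -
    have "(a i + (if i = n then t else 0)) * (a j + (if j = n then t else 0)) * K i j =
        a i * a j * K i j + (if i = n then t * (a j * K n j) else 0)
        + (if j = n then a i * t * K i n else 0)
        + (if j = n then if i = n then t\<^sup>2 * K n n else 0 else 0)" for j
      by (auto simp: algebra_simps power2_eq_square)
    then show ?thesis
      using assms by (cases "i = n") (simp_all add: sum.distrib sum_distrib_left)
  qed
  then have "(\<Sum>i\<in>I. \<Sum>j\<in>I. (a i + (if i = n then t else 0)) * (a j + (if j = n then t else 0)) * K i j)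
      = (\<Sum>i\<in>I. \<Sum>j\<in>I. a i * a j * K i j) + t * (\<Sum>j\<in>I. a j * K n j)
        + (\<Sum>i\<in>I. a i * t * K i n) + t\<^sup>2 * K n n"
    using assms by (simp add: sum.distrib)
  also have "(\<Sum>j\<in>I. a j * K n j) = (\<Sum>j\<in>I. a j * K j n)"
    by (intro sum.cong refl) (simp add: sym[of n])
  also have "(\<Sum>i\<in>I. a i * t * K i n) = t * (\<Sum>j\<in>I. a j * K j n)"
    by (simp add: sum_distrib_left mult_ac)
  finally show ?thesis by simp
qed

lemma positive_semidefinite_zero_diag:
  assumes K: "positive_semidefinite K" and 0: "K n n = 0"
  shows "K j n = 0"
proof (rule ccontr)
  assume nz: "K j n \<noteq> 0"
  then have "j \<noteq> n" using 0 by auto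
  define a where "a i = (if i = j then 1 else 0::real)" for i
  \<comment> \<open>With a vanishing diagonal entry the form is affine in t, and this t makes it
    -1.\<close>
  define t where "t = - (K j j + 1) / (2 * K j n)"
  have nonneg: "0 \<le> (\<Sum>i\<in>I. \<Sum>j\<in>I. b i * b j * K i j)" if "finite I" for I and b :: "'a \<Rightarrow> real"
    using K that unfolding positive_semidefinite_def by blast
  have "0 \<le> (\<Sum>i\<in>{j,n}. \<Sum>k\<in>{j,n}. (a i + (if i = n then t else 0)) * (a k + (if k = n then t else 0)) * K i k)"
    by (rule nonneg) simp
  also have "\<dots> = (\<Sum>i\<in>{j,n}. \<Sum>k\<in>{j,n}. a i * a k * K i k) + 2 * t * (\<Sum>i\<in>{j,n}. a i * K i n) + t\<^sup>2 * K n n"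
    by (rule quadratic_form_add) (auto intro: positive_semidefinite_sym[OF K])
  also have "\<dots> = K j j + 2 * t * K j n"
    using \<open>j \<noteq> n\<close> 0 by (simp add: a_def)
  also have "\<dots> = -1" using nz by (simp add: t_def field_simps)
  finally show False by simp
qed

text \<open>Where the pivot vanishes, so does its row, and division by zero makes the step the identity.\<close>

fun cholesky_rest :: "(nat \<Rightarrow> nat \<Rightarrow> real) \<Rightarrow> nat \<Rightarrow> nat \<Rightarrow> nat \<Rightarrow> real" where
  "cholesky_rest K 0 = K"
| "cholesky_rest K (Suc n) = (\<lambda>i j. cholesky_rest K n i j
     - cholesky_rest K n i n * cholesky_rest K n j n / cholesky_rest K n n n)"

text \<open>One step is a Schur complement: its form is that of \<open>C\<close> minimised over
  coordinate n, the minimum being attained at \<open>t = - s / C n n\<close> and lowering the value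
  by \<open>s^2 / C n n\<close>.\<close>

lemma positive_semidefinite_cholesky_rest:
  "positive_semidefinite K \<Longrightarrow> positive_semidefinite (cholesky_rest K n)"
proof (induction n)
  case (Suc n)
  define C where "C = cholesky_rest K n"
  have C: "positive_semidefinite C" using Suc by (simp add: C_def)
  have nonneg: "0 \<le> (\<Sum>i\<in>I. \<Sum>j\<in>I. b i * b j * C i j)" if "finite I" for I and b :: "nat \<Rightarrow> real"
    using C that unfolding positive_semidefinite_def by blast
  show ?case
    unfolding positive_semidefinite_def
  proof (intro conjI allI impI)
    show "cholesky_rest K (Suc n) i j = cholesky_rest K (Suc n) j i" for i j
      using positive_semidefinite_sym[OF C, of i j] by (simp add: C_def)
  next
    fix I :: "nat set" and a0 :: "nat \<Rightarrow> real" assume "finite I"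
    \<comment> \<open>Extension by 0, so that the pivot index n can be added to the index
      set.\<close>
    define a where "a i = (if i \<in> I then a0 i else 0)" for i
    define I' where "I' = insert n I"
    define s where "s = (\<Sum>i\<in>I'. a i * C i n)"
    have fin: "finite I'" "n \<in> I'" "I \<subseteq> I'" using \<open>finite I\<close> by (auto simp: I'_def)
    have "(\<Sum>i\<in>I. \<Sum>j\<in>I. a0 i * a0 j * cholesky_rest K (Suc n) i j)
        = (\<Sum>i\<in>I. \<Sum>j\<in>I. a i * a j * cholesky_rest K (Suc n) i j)"
      by (intro sum.cong refl) (simp add: a_def)
    also have "\<dots> = (\<Sum>i\<in>I'. \<Sum>j\<in>I'. a i * a j * cholesky_rest K (Suc n) i j)"
    proof -
      have "(\<Sum>j\<in>I. a i * a j * cholesky_rest K (Suc n) i j) = (\<Sum>j\<in>I'. a i * a j * cholesky_rest K (Suc n) i j)" for i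
        using fin by (intro sum.mono_neutral_left) (auto simp: a_def)
      moreover have "(\<Sum>i\<in>I. \<Sum>j\<in>I'. a i * a j * cholesky_rest K (Suc n) i j)
           = (\<Sum>i\<in>I'. \<Sum>j\<in>I'. a i * a j * cholesky_rest K (Suc n) i j)"
        using fin by (intro sum.mono_neutral_left) (auto simp: a_def)
      ultimately show ?thesis by simp
    qed
    also have "\<dots> = (\<Sum>i\<in>I'. \<Sum>j\<in>I'. a i * a j * C i j) - s\<^sup>2 / C n n"
    proof -
      have "s\<^sup>2 / C n n = (\<Sum>i\<in>I'. \<Sum>j\<in>I'. a i * a j * (C i n * C j n / C n n))"
        unfolding power2_eq_square s_def
        by (simp add: sum_product sum_divide_distrib mult_ac)
      then show ?thesis
        by (simp add: C_def[symmetric] right_diff_distrib sum_subtractf)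
    qed
    also have "\<dots> \<ge> 0"
    proof (cases "C n n = 0")
      case True
      then show ?thesis using nonneg[OF fin(1)] by simp
    next
      case False
      define t where "t = - s / C n n"
      have t: "2 * t * s + t\<^sup>2 * C n n = - (s\<^sup>2 / C n n)"
        using False by (simp add: t_def field_simps power2_eq_square)
      have "0 \<le> (\<Sum>i\<in>I'. \<Sum>k\<in>I'. (a i + (if i = n then t else 0)) * (a k + (if k = n then t else 0)) * C i k)"
        by (rule nonneg[OF fin(1)])
      also have "\<dots> = (\<Sum>i\<in>I'. \<Sum>k\<in>I'. a i * a k * C i k) + 2 * t * s + t\<^sup>2 * C n n"
        unfolding s_def using fin by (intro quadratic_form_add positive_semidefinite_sym[OF C])
      finally show ?thesis using t by linarith
    qed
    finally show "0 \<le> (\<Sum>i\<in>I. \<Sum>j\<in>I. a0 i * a0 j * cholesky_rest K (Suc n) i j)" .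
  qed
qed simp

text \<open>Step n clears row n and leaves the earlier rows cleared; this makes the factor lower
  triangular.\<close>

lemma cholesky_rest_zero:
  assumes K: "positive_semidefinite K"
  shows "i < n \<Longrightarrow> cholesky_rest K n i j = 0"
proof (induction n arbitrary: i j)
  case (Suc n)
  define C where "C = cholesky_rest K n"
  have C: "positive_semidefinite C" using positive_semidefinite_cholesky_rest[OF K] by (simp add: C_def)
  show ?case
  proof (cases "i < n")
    case True
    then show ?thesis using Suc.IH by simp
  next
    case False
    then have [simp]: "i = n" using Suc.prems by simp
    have "C n j = C n n * C j n / C n n"
      using positive_semidefinite_zero_diag[OF C, of n j] positive_semidefinite_sym[OF C, of n j]
      by (cases "C n n = 0") auto
    then show ?thesis by (simp add: C_def[symmetric])
  qed
qed simp

definition cholesky :: "(nat \<Rightarrow> nat \<Rightarrow> real) \<Rightarrow> nat \<Rightarrow> nat \<Rightarrow> real" where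
  "cholesky K i n = cholesky_rest K n i n / sqrt (cholesky_rest K n n n)"

lemma cholesky_eq_0: "positive_semidefinite K \<Longrightarrow> i < n \<Longrightarrow> cholesky K i n = 0"
  by (simp add: cholesky_def cholesky_rest_zero)

text \<open>The remainder plus the rank one terms split off so far always equals \<open>K\<close>;
  for \<open>i < n\<close> the remainder has disappeared.\<close>

lemma cholesky_decomposition:
  assumes K: "positive_semidefinite K" and "i < n"
  shows "K i j = (\<Sum>k<n. cholesky K i k * cholesky K j k)"
proof -
  have "K i j = cholesky_rest K N i j + (\<Sum>k<N. cholesky K i k * cholesky K j k)" for N
  proof (induction N)
    case (Suc N)
    have "cholesky K i N * cholesky K j N
        = cholesky_rest K N i N * cholesky_rest K N j N / cholesky_rest K N N N"
      using positive_semidefinite_diag[OF positive_semidefinite_cholesky_rest[OF K], of N N]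
      by (simp add: cholesky_def)
    then show ?case using Suc by simp
  qed simp
  from this[of n] show ?thesis using cholesky_rest_zero[OF K \<open>i < n\<close>] by simp
qed

section \<open>Gaussian vectors from independent standard normal variables\<close>

definition iid_normal :: "(nat \<Rightarrow> real) measure" where
  "iid_normal = PiM UNIV (\<lambda>_. std_normal_distribution)"

lemma prob_space_std_normal: "prob_space std_normal_distribution"
  by (rule prob_space_normal_density) simp

interpretation iid_normal: prob_space iid_normal
  unfolding iid_normal_def by (intro prob_space_PiM prob_space_std_normal)

lemma sets_iid_normal [measurable_cong]: "sets iid_normal = sets (PiM UNIV (\<lambda>_. borel))"
  unfolding iid_normal_def by (intro sets_PiM_cong) auto

lemma iid_normal_coordinate_measurable [measurable]: "(\<lambda>x. x i) \<in> borel_measurable iid_normal"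
  by measurable

lemma distr_iid_normal: "distr iid_normal borel (\<lambda>x. x i) = std_normal_distribution"
proof -
  have "distr iid_normal std_normal_distribution (\<lambda>x. x i) = std_normal_distribution"
    unfolding iid_normal_def by (rule distr_PiM_component) (auto intro: prob_space_std_normal)
  also have "distr iid_normal std_normal_distribution (\<lambda>x. x i) = distr iid_normal borel (\<lambda>x. x i)"
    by (rule distr_cong) auto
  finally show ?thesis .
qed

lemma distributed_iid_normal: "distributed iid_normal lborel (\<lambda>x. x i) std_normal_density"
  unfolding distributed_def using distr_iid_normal[of i]
  by (auto cong: distr_cong)

lemma indep_vars_iid_normal: "iid_normal.indep_vars (\<lambda>_. borel) (\<lambda>i x. x i) UNIV"
proof (subst iid_normal.indep_vars_iff_distr_eq_PiM')
  have "distr iid_normal (PiM UNIV (\<lambda>_. borel)) (\<lambda>x. \<lambda>i\<in>UNIV. x i) = distr iid_normal iid_normal (\<lambda>x. x)"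
    by (rule distr_cong) (auto simp: sets_iid_normal)
  also have "\<dots> = iid_normal" by (rule distr_id)
  finally show "distr iid_normal (PiM UNIV (\<lambda>_. borel)) (\<lambda>x. \<lambda>i\<in>UNIV. x i) =
      PiM UNIV (\<lambda>i. distr iid_normal borel (\<lambda>x. x i))"
    by (simp add: distr_iid_normal) (simp add: iid_normal_def)
qed auto

lemma char_iid_normal_sum:
  "(\<integral>x. iexp (\<Sum>j<n. c j * x j) \<partial>iid_normal) = complex_of_real (exp (- (\<Sum>j<n. (c j)\<^sup>2) / 2))"
proof -
  have char1: "char (distr iid_normal borel (\<lambda>x. c j * x j)) 1 = complex_of_real (exp (- (c j)\<^sup>2 / 2))" for j
  proof -
    have "char (distr iid_normal borel (\<lambda>x. c j * x j)) 1 = char (distr iid_normal borel (\<lambda>x. x j)) (c j)"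
      by (simp add: char_def integral_distr)
    then show ?thesis by (simp add: distr_iid_normal char_std_normal_distribution)
  qed
  have "iid_normal.indep_vars (\<lambda>_. borel) (\<lambda>i x. c i * x i) {..<n}"
    by (rule iid_normal.indep_vars_compose2[where X = "\<lambda>i x. x i" and Y = "\<lambda>i y. c i * y"])
       (auto intro: iid_normal.indep_vars_subset[OF indep_vars_iid_normal])
  then have "char (distr iid_normal borel (\<lambda>x. \<Sum>j<n. c j * x j)) 1
      = (\<Prod>j<n. char (distr iid_normal borel (\<lambda>x. c j * x j)) 1)"
    by (rule iid_normal.char_distr_sum)
  also have "\<dots> = (\<Prod>j<n. complex_of_real (exp (- (c j)\<^sup>2 / 2)))" by (simp only: char1)
  also have "\<dots> = complex_of_real (exp (- (\<Sum>j<n. (c j)\<^sup>2) / 2))"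
    by (simp add: exp_sum[symmetric] sum_negf sum_divide_distrib flip: of_real_prod)
  finally show ?thesis by (simp add: char_def integral_distr)
qed

text \<open>Zero coefficients are discarded first because \<open>sum_indep_normal\<close> asks for
  positive variances; if none is left, the degenerate clause of \<open>normal_rv\<close>
  applies.\<close>

lemma normal_rv_iid_normal_sum: "normal_rv iid_normal (\<lambda>x. \<Sum>j<n. c j * x j)"
proof (cases "\<forall>j<n. c j = 0")
  case True
  then have "(\<lambda>x. \<Sum>j<n. c j * x j) = (\<lambda>_. 0)" by auto
  then show ?thesis unfolding normal_rv_def
    using True by (intro conjI exI[of _ "0::real"] disjI2 AE_I2) simp_all
next
  case False
  define I where "I = {j. j < n \<and> c j \<noteq> 0}"
  have I: "finite I" "I \<noteq> {}" using False by (auto simp: I_def)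
  have "distributed iid_normal lborel (\<lambda>x. \<Sum>j\<in>I. c j * x j)
      (normal_density (\<Sum>j\<in>I. 0) (sqrt (\<Sum>j\<in>I. \<bar>c j\<bar>\<^sup>2)))"
  proof (rule iid_normal.sum_indep_normal[OF I])
    show "iid_normal.indep_vars (\<lambda>_. borel) (\<lambda>i x. c i * x i) I"
      by (rule iid_normal.indep_vars_compose2[where X = "\<lambda>i x. x i" and Y = "\<lambda>i y. c i * y"])
         (auto intro: iid_normal.indep_vars_subset[OF indep_vars_iid_normal])
    show "distributed iid_normal lborel (\<lambda>x. c i * x i) (normal_density 0 \<bar>c i\<bar>)" if "i \<in> I" for i
      using iid_normal.normal_density_affine[OF distributed_iid_normal, of "c i" 0 i] that by (simp add: I_def)
  qed (simp add: I_def)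
  moreover have "sqrt (\<Sum>j\<in>I. \<bar>c j\<bar>\<^sup>2) > 0"
    using I by (auto intro!: sum_pos simp: I_def)
  moreover have "(\<Sum>j\<in>I. c j * x j) = (\<Sum>j<n. c j * x j)" for x
    unfolding I_def by (intro sum.mono_neutral_left) auto
  ultimately show ?thesis unfolding normal_rv_def
    by (intro conjI exI[of _ 0] exI[of _ "sqrt (\<Sum>j\<in>I. \<bar>c j\<bar>\<^sup>2)"] disjI1) simp_all
qed

lemma iid_normal_moments:
  shows "(\<integral>x. x i \<partial>iid_normal) = 0" "integrable iid_normal (\<lambda>x. x i)"
    and "integrable iid_normal (\<lambda>x. x i * x j)"
    and "(\<integral>x. x i * x j \<partial>iid_normal) = (if i = j then 1 else 0)"
proof -
  show mean: "(\<integral>x. x i \<partial>iid_normal) = 0" for i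
    by (rule iid_normal.standard_normal_distributed_expectation[OF distributed_iid_normal])
  have mom: "integrable iid_normal (\<lambda>x. x i ^ k)" for i k
  proof -
    have "integrable (distr iid_normal borel (\<lambda>x. x i)) (\<lambda>y. y ^ k)"
      unfolding distr_iid_normal by (rule integrable_std_normal_distribution_moment)
    then show ?thesis by (simp add: integrable_distr_eq)
  qed
  show int: "integrable iid_normal (\<lambda>x. x i)" for i
    using mom[of i 1] by simp
  have "integrable iid_normal (\<lambda>x. x i * x j) \<and> (\<integral>x. x i * x j \<partial>iid_normal) = (if i = j then 1 else 0)"
  proof (cases "i = j")
    case True
    then show ?thesis
      using mom[of i 2] iid_normal.standard_normal_distributed_variance[OF distributed_iid_normal, of i] mean
      by (simp add: power2_eq_square)
  next
    case False
    have "iid_normal.indep_vars (\<lambda>_. borel) (\<lambda>i x. x i) {i, j}"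
      by (rule iid_normal.indep_vars_subset[OF indep_vars_iid_normal]) simp
    from iid_normal.indep_vars_lebesgue_integral[OF _ this] iid_normal.indep_vars_integrable[OF _ this]
    show ?thesis using False int mean by simp
  qed
  then show "integrable iid_normal (\<lambda>x. x i * x j)"
    and "(\<integral>x. x i * x j \<partial>iid_normal) = (if i = j then 1 else 0)" by auto
qed

text \<open>\<open>Z k\<close> is row k of the Cholesky factor applied to independent standard
  normals. Rows are finite by triangularity, so every finite combination is a finite sum of
  independent normal variables.\<close>

lemma gaussian_process_exists:
  fixes K :: "nat \<Rightarrow> nat \<Rightarrow> real"
  assumes K: "positive_semidefinite K"
  obtains Z :: "nat \<Rightarrow> (nat \<Rightarrow> real) \<Rightarrow> real"
  where "gaussian_process iid_normal UNIV Z"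
    and "\<And>k. Z k \<in> borel_measurable iid_normal"
    and "\<And>k. (\<integral>x. Z k x \<partial>iid_normal) = 0"
    and "\<And>k l. cov iid_normal (Z k) (Z l) = K k l"
    and "\<And>J a. finite J \<Longrightarrow> (\<integral>x. iexp (\<Sum>j\<in>J. a j * Z j x) \<partial>iid_normal)
           = complex_of_real (exp (- (\<Sum>j\<in>J. \<Sum>l\<in>J. a j * a l * K j l) / 2))"
proof -
  let ?q = "\<lambda>J a. (\<Sum>j\<in>J. \<Sum>l\<in>J. a j * a l * K j l)"
  define Z :: "nat \<Rightarrow> (nat \<Rightarrow> real) \<Rightarrow> real" where "Z k x = (\<Sum>j<Suc k. cholesky K k j * x j)" for k x
  \<comment> \<open>Triangularity allows one common upper limit n for all indices of a finite
    set.\<close>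
  have Z: "Z k x = (\<Sum>j<n. cholesky K k j * x j)" if "k < n" for k n x
    unfolding Z_def by (rule sum.mono_neutral_left) (use that cholesky_eq_0[OF K] in auto)
  have comb: "\<exists>n c. (\<forall>x. (\<Sum>j\<in>J. a j * Z j x) = (\<Sum>i<n. c i * x i)) \<and>
       (\<Sum>i<n. (c i)\<^sup>2) = ?q J a"
    if "finite J" for J and a :: "nat \<Rightarrow> real"
  proof -
    obtain n where n: "\<And>j. j \<in> J \<Longrightarrow> j < n" using \<open>finite J\<close> by (meson finite_nat_set_iff_bounded)
    define c where "c i = (\<Sum>j\<in>J. a j * cholesky K j i)" for i
    have "(\<Sum>j\<in>J. a j * Z j x) = (\<Sum>i<n. c i * x i)" for x
    proof -
      have "(\<Sum>j\<in>J. a j * Z j x) = (\<Sum>j\<in>J. \<Sum>i<n. a j * cholesky K j i * x i)"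
        using n by (intro sum.cong refl) (simp add: Z[of _ n] sum_distrib_left mult_ac)
      also have "\<dots> = (\<Sum>i<n. c i * x i)"
        by (subst sum.swap) (simp add: c_def sum_distrib_right)
      finally show ?thesis .
    qed
    moreover have "(\<Sum>i<n. (c i)\<^sup>2) = ?q J a"
    proof -
      have "(\<Sum>i<n. (c i)\<^sup>2) = (\<Sum>i<n. \<Sum>j\<in>J. \<Sum>l\<in>J. a j * a l * (cholesky K j i * cholesky K l i))"
        unfolding c_def power2_eq_square sum_product by (simp add: mult_ac)
      also have "\<dots> = (\<Sum>j\<in>J. \<Sum>l\<in>J. \<Sum>i<n. a j * a l * (cholesky K j i * cholesky K l i))"
        by (subst (2) sum.swap) (rule sum.swap)
      also have "\<dots> = ?q J a"
        by (intro sum.cong refl) (simp add: cholesky_decomposition[OF K n] sum_distrib_left)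
      finally show ?thesis .
    qed
    ultimately show ?thesis by blast
  qed
  have Zmeas: "Z k \<in> borel_measurable iid_normal" for k
    unfolding Z_def by measurable
  have mean: "(\<integral>x. Z k x \<partial>iid_normal) = 0" for k
    unfolding Z_def by (simp add: iid_normal_moments)
  show ?thesis
  proof (rule that[of Z])
    show "gaussian_process iid_normal UNIV Z"
      unfolding gaussian_process_def
    proof (intro conjI allI impI)
      show "prob_space iid_normal" by (rule iid_normal.prob_space_axioms)
      show "normal_rv iid_normal (\<lambda>x. \<Sum>j\<in>J. a j * Z j x)" if "finite J \<and> J \<subseteq> UNIV" for J a
        using comb[of J a] that normal_rv_iid_normal_sum by auto
    qed
    show "cov iid_normal (Z k) (Z l) = K k l" for k l
    proof -
      define n where "n = Suc (max k l)"
      have n: "k < n" "l < n" by (auto simp: n_def)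
      have "cov iid_normal (Z k) (Z l)
          = (\<integral>x. (\<Sum>i<n. \<Sum>j<n. cholesky K k i * cholesky K l j * (x i * x j)) \<partial>iid_normal)"
        unfolding cov_def mean by (simp add: Z[OF n(1)] Z[OF n(2)] sum_product mult_ac)
      also have "\<dots> = (\<Sum>i<n. \<Sum>j<n. cholesky K k i * cholesky K l j * (if i = j then 1 else 0))"
        by (simp add: iid_normal_moments)
      also have "\<dots> = (\<Sum>i<n. cholesky K k i * cholesky K l i)"
        by (intro sum.cong refl) (simp add: if_distrib[of "(*) _"] cong: if_cong)
      also have "\<dots> = K k l" using cholesky_decomposition[OF K n(1)] by simp
      finally show ?thesis .
    qed
    show "(\<integral>x. iexp (\<Sum>j\<in>J. a j * Z j x) \<partial>iid_normal)
           = complex_of_real (exp (- ?q J a / 2))" if "finite J" for J a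
    proof -
      obtain n c where "\<And>x. (\<Sum>j\<in>J. a j * Z j x) = (\<Sum>i<n. c i * x i)"
        "(\<Sum>i<n. (c i)\<^sup>2) = ?q J a" using comb[OF \<open>finite J\<close>, of a] by blast
      then show ?thesis using char_iid_normal_sum[of c n] by simp
    qed
  qed (use Zmeas mean in auto)
qed

section \<open>The central limit theorem\<close>

context pa_params
begin

text \<open>The sum in \<open>Q_lim\<close> stops at the first index, which hides the symmetry. Its
  terms vanish beyond either index, so both sums extend to the maximum.\<close>

lemma Q_lim_sym: "Q_lim t1 t2 = Q_lim t2 t1"
proof -
  have e: "(\<Sum>q=m..t1. (real q + \<delta>) * p q * (b_diff q t1 * b_diff q t2))
      = (\<Sum>q=m..max t1 t2. (real q + \<delta>) * p q * (b_diff q t1 * b_diff q t2))" for t1 t2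
    by (intro sum.mono_neutral_left) (auto simp: b_diff_eq_0)
  have "(\<Sum>q=m..t1. (real q + \<delta>) * p q * (b_diff q t1 * b_diff q t2))
      = (\<Sum>q=m..t2. (real q + \<delta>) * p q * (b_diff q t2 * b_diff q t1))"
    unfolding e[of t1 t2] e[of t2 t1] by (simp only: max.commute mult.commute)
  then show ?thesis unfolding Q_lim_def by (simp add: mult_ac)
qed

lemma cov_U_sym: "cov_U t1 t2 = cov_U t2 t1"
  unfolding cov_U_def using Q_lim_sym[of t1 t2] by (simp add: add_ac)

lemma R_Z_sym: "m \<le> r \<Longrightarrow> m \<le> l \<Longrightarrow> R_Z m \<delta> r l = R_Z m \<delta> l r"
  unfolding R_Z_eq by (subst sum.swap) (simp add: cov_U_sym mult_ac)

end

context pa_model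
begin

lemma norm_phi_le_1: "norm (phi K \<alpha> h n) \<le> 1"
proof -
  have "norm (phi K \<alpha> h n) \<le> (\<integral>\<omega>. 1 \<partial>M)"
    unfolding phi_def by (rule norm_integral_le) (auto intro!: integrable_iexp)
  then show ?thesis by (simp add: prob_space)
qed

lemma quad_cov_U_nonneg: "0 \<le> quad K \<alpha> cov_U"
proof -
  have "norm (complex_of_real (exp (- (quad K \<alpha> cov_U / 2)))) \<le> 1"
    using tendsto_norm[OF char_limit[of K \<alpha> 0]] norm_phi_le_1 by (intro LIMSEQ_le_const2) auto
  then show ?thesis by simp
qed

text \<open>Writing a combination of the \<open>N_k\<close> with weights \<open>a k\<close> in terms
  of the \<open>U_t\<close> produces exactly these coefficients; \<open>R_Z_eq\<close> and an
  exchange of finite sums do the rest.\<close>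

lemma quad_cov_U_R_Z:
  "quad K (\<lambda>t. \<Sum>k=m..K. a k * b_abs t k) cov_U = (\<Sum>r=m..K. \<Sum>l=m..K. a r * a l * R_Z m \<delta> r l)"
proof -
  have R: "R_Z m \<delta> r l = (\<Sum>t1=m..K. \<Sum>t2=m..K. b_abs t1 l * b_abs t2 r * cov_U t1 t2)"
    if "r \<in> {m..K}" "l \<in> {m..K}" for r l
  proof -
    have "R_Z m \<delta> r l = (\<Sum>t1=m..l. \<Sum>t2=m..r. b_abs t1 l * b_abs t2 r * cov_U t1 t2)"
      using that by (intro R_Z_eq) auto
    also have "\<dots> = (\<Sum>t1=m..l. \<Sum>t2=m..K. b_abs t1 l * b_abs t2 r * cov_U t1 t2)"
      using that by (intro sum.cong refl sum.mono_neutral_left) (auto simp: b_abs_eq_0)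
    also have "\<dots> = (\<Sum>t1=m..K. \<Sum>t2=m..K. b_abs t1 l * b_abs t2 r * cov_U t1 t2)"
      using that by (intro sum.mono_neutral_left) (auto simp: b_abs_eq_0)
    finally show ?thesis .
  qed
  have "quad K (\<lambda>t. \<Sum>k=m..K. a k * b_abs t k) cov_U
     = (\<Sum>t1=m..K. \<Sum>t2=m..K. \<Sum>l=m..K. \<Sum>r=m..K. a r * a l * (b_abs t1 l * b_abs t2 r * cov_U t1 t2))"
    unfolding quad_def sum_product by (simp add: sum_distrib_right sum_distrib_left mult_ac)
  also have "\<dots> = (\<Sum>t1=m..K. \<Sum>l=m..K. \<Sum>t2=m..K. \<Sum>r=m..K. a r * a l * (b_abs t1 l * b_abs t2 r * cov_U t1 t2))"
    by (intro sum.cong refl sum.swap)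
  also have "\<dots> = (\<Sum>l=m..K. \<Sum>t1=m..K. \<Sum>t2=m..K. \<Sum>r=m..K. a r * a l * (b_abs t1 l * b_abs t2 r * cov_U t1 t2))"
    by (rule sum.swap)
  also have "\<dots> = (\<Sum>l=m..K. \<Sum>t1=m..K. \<Sum>r=m..K. \<Sum>t2=m..K. a r * a l * (b_abs t1 l * b_abs t2 r * cov_U t1 t2))"
    by (intro sum.cong refl sum.swap)
  also have "\<dots> = (\<Sum>l=m..K. \<Sum>r=m..K. \<Sum>t1=m..K. \<Sum>t2=m..K. a r * a l * (b_abs t1 l * b_abs t2 r * cov_U t1 t2))"
    by (intro sum.cong refl sum.swap)
  also have "\<dots> = (\<Sum>l=m..K. \<Sum>r=m..K. a r * a l * R_Z m \<delta> r l)"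
    by (intro sum.cong refl) (simp add: R sum_distrib_left)
  also have "\<dots> = (\<Sum>r=m..K. \<Sum>l=m..K. a r * a l * R_Z m \<delta> r l)" by (rule sum.swap)
  finally show ?thesis .
qed

text \<open>Zero rows below m extend the covariance to all naturals, the index set in
  \<open>gaussian_process_exists\<close>.\<close>

definition R_ext :: "nat \<Rightarrow> nat \<Rightarrow> real" where
  "R_ext r l = (if m \<le> r \<and> m \<le> l then R_Z m \<delta> r l else 0)"

lemma positive_semidefinite_R_ext: "positive_semidefinite R_ext"
  unfolding positive_semidefinite_def
proof (intro conjI allI impI)
  show "R_ext i j = R_ext j i" for i j by (simp add: R_ext_def R_Z_sym)
  fix I :: "nat set" and a0 :: "nat \<Rightarrow> real" assume "finite I"
  then obtain K where K: "\<And>k. k \<in> I \<Longrightarrow> k \<le> K" by (meson finite_nat_set_iff_bounded_le)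
  define a where "a k = (if k \<in> I then a0 k else 0)" for k
  have sums: "(\<Sum>k\<in>I. a0 k * f k) = (\<Sum>k=m..K. a k * f k)" if "\<And>k. k < m \<Longrightarrow> f k = 0" for f :: "nat \<Rightarrow> real"
  proof -
    have "(\<Sum>k\<in>I. a0 k * f k) = (\<Sum>k\<in>I \<inter> {m..K}. a k * f k)"
      using \<open>finite I\<close> K that by (intro sum.mono_neutral_cong_right) (auto simp: a_def intro!: leI)
    also have "\<dots> = (\<Sum>k=m..K. a k * f k)"
      by (intro sum.mono_neutral_left) (auto simp: a_def)
    finally show ?thesis .
  qed
  have "(\<Sum>i\<in>I. \<Sum>j\<in>I. a0 i * a0 j * R_ext i j) = (\<Sum>i\<in>I. a0 i * (\<Sum>j\<in>I. a0 j * R_ext i j))"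
    by (simp add: sum_distrib_left mult_ac)
  also have "\<dots> = (\<Sum>i\<in>I. a0 i * (\<Sum>j=m..K. a j * R_ext i j))"
    by (intro sum.cong refl, subst sums) (auto simp: R_ext_def)
  also have "\<dots> = (\<Sum>i=m..K. a i * (\<Sum>j=m..K. a j * R_ext i j))"
    by (rule sums) (auto simp: R_ext_def)
  also have "\<dots> = (\<Sum>i=m..K. \<Sum>j=m..K. a i * a j * R_Z m \<delta> i j)"
    unfolding sum_distrib_left by (intro sum.cong refl) (simp add: R_ext_def)
  also have "\<dots> = quad K (\<lambda>t. \<Sum>k=m..K. a k * b_abs t k) cov_U" by (rule quad_cov_U_R_Z[symmetric])
  also have "\<dots> \<ge> 0" by (rule quad_cov_U_nonneg)
  finally show "0 \<le> (\<Sum>i\<in>I. \<Sum>j\<in>I. a0 i * a0 j * R_ext i j)" .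
qed

definition X_deg :: "nat \<Rightarrow> nat \<Rightarrow> nat \<Rightarrow> 'a \<Rightarrow> real" where
  "X_deg i s k \<omega> = sqrt (real s) * (real (deg_count m (cfg \<omega>) k s i) / real s - p k)"

lemma X_deg_measurable [measurable]:
  assumes "i \<le> m" shows "X_deg i s k \<in> borel_measurable M"
proof -
  have "(\<lambda>\<omega>. real (deg_count m (cfg \<omega>) k s i)) \<in> borel_measurable M"
  proof (cases "2 \<le> s")
    case True
    then show ?thesis using assms by (simp add: deg_count_eq)
  next
    case False
    then have "s = 0 \<or> s = Suc 0" by auto
    then show ?thesis by (auto simp: deg_count_def)
  qed
  note [measurable] = this
  show ?thesis unfolding X_deg_def[abs_def] by measurable
qed

text \<open>\<open>N_k\<close> and \<open>p k\<close> expand with the same matrix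
  \<open>b_abs\<close>. The upper limit K can be shared by all k because \<open>b_abs t k\<close>
  vanishes for \<open>t > k\<close>.\<close>

lemma X_deg_eq:
  assumes "2 \<le> s" "i \<le> m" "\<omega> \<in> space M" "k \<in> {m..K}"
  shows "X_deg i s k \<omega> = 1 / sqrt (real s) * (\<Sum>t=m..K. b_abs t k * (U t (s * m + i) \<omega> - real s * c_lim t))"
proof -
  have N: "2 * m \<le> s * m + i" using assms(1) by (simp add: trans_le_add1)
  have ext: "(\<Sum>t=m..k. b_abs t k * f t) = (\<Sum>t=m..K. b_abs t k * f t)" for f :: "nat \<Rightarrow> real"
    using assms(4) by (intro sum.mono_neutral_left) (auto simp: b_abs_eq_0)
  have "real (deg_count m (cfg \<omega>) k s i) = (\<Sum>t=m..K. b_abs t k * U t (s * m + i) \<omega>)"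
    unfolding deg_count_eq[OF assms(1,2)] lin_stat_indicator_eq[OF valid_cfg[OF assms(3)] N] U_def[symmetric] by (rule ext)
  moreover have "p k = (\<Sum>t=m..K. b_abs t k * c_lim t)"
    using sum_b_abs_c_lim[of k] assms(4) ext[of c_lim] by simp
  ultimately have "(\<Sum>t=m..K. b_abs t k * (U t (s * m + i) \<omega> - real s * c_lim t))
      = real (deg_count m (cfg \<omega>) k s i) - real s * p k"
    by (simp add: right_diff_distrib sum_subtractf sum_distrib_left mult_ac)
  moreover have "y * (D / (y * y) - z) = 1 / y * (D - y * y * z)" if "y > 0" for y D z :: real
    using that by (simp add: field_simps)
  from this[of "sqrt (real s)"] have "sqrt (real s) * (D / real s - z) = 1 / sqrt (real s) * (D - real s * z)" for D z
    using assms(1) by simp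
  ultimately show ?thesis unfolding X_deg_def by simp
qed

text \<open>Replaces the exact mean by \<open>s * c_lim t\<close> as centring. Both are within
  \<open>o(sqrt s)\<close> of \<open>center\<close>: the mean by \<open>mean_U_center\<close>, the
  other up to \<open>|c_lim t|\<close> for \<open>i = m\<close> and \<open>i * |mean_step t|\<close>
  otherwise.\<close>

lemma mean_U_shift:
  assumes t: "m \<le> t" and "i \<le> m"
  shows "(\<lambda>s. (mean_U t (s * m + i) - real s * c_lim t) / sqrt (real s)) \<longlonglongrightarrow> 0"
proof -
  define N where "N s = s * m + i" for s
  have N_ge: "s \<le> N s" for s using m_pos by (simp add: N_def trans_le_add1)
  have N_top: "filterlim N at_top sequentially"
    unfolding filterlim_at_top using N_ge by (auto intro: eventually_sequentiallyI order_trans)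
  have "(\<lambda>s. real m + real i / real s) \<longlonglongrightarrow> real m + 0"
    by (intro tendsto_intros lim_const_over_n)
  then have Ns: "(\<lambda>s. sqrt (real m + real i / real s)) \<longlonglongrightarrow> sqrt (real m)" by (intro tendsto_intros) simp
  define D where "D = \<bar>c_lim t\<bar> + real m * \<bar>mean_step t\<bar>"
  have center: "\<bar>center t (N s) - real s * c_lim t\<bar> \<le> D" for s
  proof (cases "i = m")
    case True
    have e: "N s = Suc s * m" by (simp add: N_def True)
    have "center t (N s) = real (Suc s) * c_lim t"
      unfolding e center_def using m_pos by simp
    then show ?thesis by (simp add: D_def algebra_simps)
  next
    case False
    then have "center t (N s) = real s * c_lim t + real i * mean_step t"
      unfolding N_def center_def using \<open>i \<le> m\<close> by simp
    moreover have "real i * \<bar>mean_step t\<bar> \<le> real m * \<bar>mean_step t\<bar>" using \<open>i \<le> m\<close> by (intro mult_right_mono) auto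
    ultimately show ?thesis by (simp add: D_def abs_mult)
  qed
  have "(\<lambda>s. 1 / real s) \<longlonglongrightarrow> 0" by (rule lim_const_over_n)
  then have s0: "(\<lambda>s. sqrt (1 / real s)) \<longlonglongrightarrow> 0" using tendsto_real_sqrt by fastforce
  have small: "(\<lambda>s. (center t (N s) - real s * c_lim t) / sqrt (real s)) \<longlonglongrightarrow> 0"
  proof (rule Lim_null_comparison)
    show "\<forall>\<^sub>F s in sequentially. norm ((center t (N s) - real s * c_lim t) / sqrt (real s)) \<le> D * sqrt (1 / real s)"
      using center by (intro always_eventually allI) (simp add: real_sqrt_divide divide_right_mono)
    show "(\<lambda>s. D * sqrt (1 / real s)) \<longlonglongrightarrow> 0" using tendsto_mult_left[OF s0, of D] by simp
  qed
  have "(\<lambda>s. (mean_U t (N s) - center t (N s)) / sqrt (real (N s)) * sqrt (real m + real i / real s)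
      + (center t (N s) - real s * c_lim t) / sqrt (real s)) \<longlonglongrightarrow> 0 * sqrt (real m) + 0"
    by (intro tendsto_intros Ns small filterlim_compose[OF mean_U_center[OF t] N_top])
  then have "(\<lambda>s. (mean_U t (N s) - center t (N s)) / sqrt (real (N s)) * sqrt (real m + real i / real s)
      + (center t (N s) - real s * c_lim t) / sqrt (real s)) \<longlonglongrightarrow> 0" by simp
  moreover have "\<forall>\<^sub>F s in sequentially. (mean_U t (N s) - center t (N s)) / sqrt (real (N s)) * sqrt (real m + real i / real s)
      + (center t (N s) - real s * c_lim t) / sqrt (real s) = (mean_U t (N s) - real s * c_lim t) / sqrt (real s)"
    using eventually_gt_at_top[of 0]
  proof eventually_elim
    case (elim s)
    have "real m + real i / real s = real (N s) / real s" using elim by (simp add: N_def field_simps)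
    moreover have "x / y * (y / z) + w / z = (x + w) / z" if "y > 0" for x y z w :: real
      using that by (simp add: add_divide_distrib)
    moreover have "sqrt (real (N s)) > 0" using elim N_ge[of s] by simp
    ultimately show ?case by (simp add: real_sqrt_divide del: times_divide_eq_left times_divide_eq_right)
  qed
  ultimately show ?thesis unfolding N_def by (rule Lim_transform_eventually)
qed

text \<open>By \<open>X_deg_eq\<close> the exponent is that of \<open>phi\<close> with coefficients
  \<alpha>, up to the deterministic shift \<open>d s\<close>. The shift tends to 0 and contributes a
  factor tending to 1.\<close>

lemma X_deg_char_limit:
  assumes i: "i \<le> m"
  shows "(\<lambda>s. \<integral>\<omega>. iexp (\<Sum>k=m..K. a k * X_deg i s k \<omega>) \<partial>M)
    \<longlonglongrightarrow> of_real (exp (- (\<Sum>r=m..K. \<Sum>l=m..K. a r * a l * R_Z m \<delta> r l) / 2))"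
proof -
  define \<alpha> where "\<alpha> t = (\<Sum>k=m..K. a k * b_abs t k)" for t
  define d where "d s = (\<Sum>t=m..K. \<alpha> t * ((mean_U t (s * m + i) - real s * c_lim t) / sqrt (real s)))" for s
  have "d \<longlonglongrightarrow> (\<Sum>t=m..K. \<alpha> t * 0)"
    unfolding d_def[abs_def] by (intro tendsto_intros mean_U_shift i) auto
  then have d: "d \<longlonglongrightarrow> 0" by simp
  have "(\<lambda>s. iexp (d s) * phi K \<alpha> (1 / sqrt (real s)) (s * m + i)) \<longlonglongrightarrow> iexp 0 * of_real (exp (- (quad K \<alpha> cov_U / 2)))"
    by (intro tendsto_intros d char_limit)
  moreover have "iexp 0 * of_real (exp (- (quad K \<alpha> cov_U / 2)))
      = complex_of_real (exp (- (\<Sum>r=m..K. \<Sum>l=m..K. a r * a l * R_Z m \<delta> r l) / 2))"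
    unfolding \<alpha>_def[abs_def] quad_cov_U_R_Z by simp
  moreover have "\<forall>\<^sub>F s in sequentially. iexp (d s) * phi K \<alpha> (1 / sqrt (real s)) (s * m + i)
      = (\<integral>\<omega>. iexp (\<Sum>k=m..K. a k * X_deg i s k \<omega>) \<partial>M)"
    using eventually_ge_at_top[of 2]
  proof eventually_elim
    case (elim s)
    have "(\<integral>\<omega>. iexp (\<Sum>k=m..K. a k * X_deg i s k \<omega>) \<partial>M)
       = (\<integral>\<omega>. iexp (d s) * iexp (1 / sqrt (real s) * (\<Sum>t=m..K. \<alpha> t * (U t (s * m + i) \<omega> - mean_U t (s * m + i)))) \<partial>M)"
    proof (rule Bochner_Integration.integral_cong[OF refl])
      fix \<omega> assume \<omega>: "\<omega> \<in> space M"
      have "(\<Sum>k=m..K. a k * X_deg i s k \<omega>)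
          = (\<Sum>k=m..K. \<Sum>t=m..K. 1 / sqrt (real s) * (a k * b_abs t k * (U t (s * m + i) \<omega> - real s * c_lim t)))"
        by (intro sum.cong refl, subst X_deg_eq[OF elim i \<omega>, of _ K]) (simp_all add: sum_distrib_left mult_ac)
      also have "\<dots> = 1 / sqrt (real s) * (\<Sum>t=m..K. \<alpha> t * (U t (s * m + i) \<omega> - real s * c_lim t))"
        by (subst sum.swap) (simp add: \<alpha>_def sum_distrib_left sum_distrib_right mult_ac)
      also have "\<dots> = d s + 1 / sqrt (real s) * (\<Sum>t=m..K. \<alpha> t * (U t (s * m + i) \<omega> - mean_U t (s * m + i)))"
        unfolding d_def sum_distrib_left sum.distrib[symmetric]
        by (intro sum.cong refl) (simp add: algebra_simps diff_divide_distrib)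
      finally have e: "(\<Sum>k=m..K. a k * X_deg i s k \<omega>) = \<dots>" .
      show "iexp (\<Sum>k=m..K. a k * X_deg i s k \<omega>) = iexp (d s) *
          iexp (1 / sqrt (real s) * (\<Sum>t=m..K. \<alpha> t * (U t (s * m + i) \<omega> - mean_U t (s * m + i))))"
        unfolding e of_real_add distrib_left exp_add ..
    qed
    also have "\<dots> = iexp (d s) * phi K \<alpha> (1 / sqrt (real s)) (s * m + i)"
      unfolding phi_def by (rule integral_mult_right_zero)
    finally show ?case ..
  qed
  ultimately show ?thesis using Lim_transform_eventually by auto
qed

lemma degree_counts_clt:
  assumes i: "i \<le> m"
  shows "\<exists>(N :: (nat \<Rightarrow> real) measure) (Z :: nat \<Rightarrow> (nat \<Rightarrow> real) \<Rightarrow> real).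
           gaussian_process N {m..} Z \<and>
           (\<forall>k\<ge>m. (\<integral>x. Z k x \<partial>N) = 0) \<and>
           (\<forall>r\<ge>m. \<forall>l\<ge>m. cov N (Z r) (Z l) = R_Z m \<delta> r l) \<and>
           sequence_conv_distr m M (X_deg i) N Z"
proof -
  obtain Z :: "nat \<Rightarrow> (nat \<Rightarrow> real) \<Rightarrow> real" where Z: "gaussian_process iid_normal UNIV Z"
    "\<And>k. Z k \<in> borel_measurable iid_normal"
    "\<And>k. (\<integral>x. Z k x \<partial>iid_normal) = 0"
    "\<And>k l. cov iid_normal (Z k) (Z l) = R_ext k l"
    "\<And>J a. finite J \<Longrightarrow> (\<integral>x. iexp (\<Sum>j\<in>J. a j * Z j x) \<partial>iid_normal)
           = complex_of_real (exp (- (\<Sum>j\<in>J. \<Sum>l\<in>J. a j * a l * R_ext j l) / 2))"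
    using gaussian_process_exists[OF positive_semidefinite_R_ext] by blast
  have "gaussian_process iid_normal {m..} Z" using Z(1) by (auto simp: gaussian_process_def)
  moreover have "sequence_conv_distr m M (X_deg i) iid_normal Z"
    unfolding sequence_conv_distr_def
  proof (intro allI impI)
    fix K assume "m \<le> K"
    show "vector_conv_distr {m..K} M (X_deg i) iid_normal Z"
    proof (rule vector_conv_distr_char)
      fix a :: "nat \<Rightarrow> real"
      have "(\<Sum>j=m..K. \<Sum>l=m..K. a j * a l * R_ext j l) = (\<Sum>j=m..K. \<Sum>l=m..K. a j * a l * R_Z m \<delta> j l)"
        by (intro sum.cong refl) (simp add: R_ext_def)
      then show "(\<lambda>s. \<integral>\<omega>. iexp (\<Sum>j=m..K. a j * X_deg i s j \<omega>) \<partial>M)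
          \<longlonglongrightarrow> (\<integral>\<omega>. iexp (\<Sum>j=m..K. a j * Z j \<omega>) \<partial>iid_normal)"
        using X_deg_char_limit[OF i, of a K] Z(5)[of "{m..K}" a] by simp
    qed (use Z(2) i prob_space_axioms iid_normal.prob_space_axioms in auto)
  qed
  ultimately show ?thesis using Z(3,4) by (intro exI[of _ iid_normal] exI[of _ Z]) (auto simp: R_ext_def)
qed

end

theorem theorem1:
  fixes m i :: nat and \<delta> :: real and M :: "'a measure" and V :: "nat \<Rightarrow> nat \<Rightarrow> 'a \<Rightarrow> nat"
  assumes "m \<ge> 1" and "\<delta> > - real m"
    and "preferential_attachment M m \<delta> V"
    and "i \<le> m"
  shows "\<exists>(N :: (nat \<Rightarrow> real) measure) (Z :: nat \<Rightarrow> (nat \<Rightarrow> real) \<Rightarrow> real).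
           gaussian_process N {m..} Z \<and>
           (\<forall>k\<ge>m. (\<integral>x. Z k x \<partial>N) = 0) \<and>
           (\<forall>r\<ge>m. \<forall>l\<ge>m. cov N (Z r) (Z l) = R_Z m \<delta> r l) \<and>
           sequence_conv_distr m M
             (\<lambda>s k \<omega>. sqrt (real s) *
                (real (deg_count m (\<lambda>t j. V t j \<omega>) k s i) / real s - p_lim m \<delta> k)) N Z"
proof -
  interpret pa_model M m \<delta> V
    using assms by (intro pa_model.intro pa_params.intro) auto
  have "X_deg i = (\<lambda>s k \<omega>. sqrt (real s) *
                (real (deg_count m (\<lambda>t j. V t j \<omega>) k s i) / real s - p_lim m \<delta> k))"
    by (simp add: X_deg_def[abs_def] cfg_def)
  then show ?thesis using degree_counts_clt[OF \<open>i \<le> m\<close>] by simp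
qed

end
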